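(* Let $\lambda\in V$ and let $U$ be a connected, simply connected open subset of $V-\bigcup_{\alpha\in A}\Pi_\alpha$. The map (the Matsuo--Cherednik map) \[ \psi\mapsto\phi=\mu\circ\psi \] is an isomorphism from the space $\mathit{KZ}(\lambda;U)$ of solutions $\psi:U\to S/I(\lambda)$ of the KZ equations \[ \partial_\xi\psi(x)=\sum_{\alpha\in A}m_\alpha\frac{(\alpha,\xi)}{(\alpha,x)}(s_\alpha+1)\psi(x)+\pi(\xi)\psi(x),\qquad \xi\in V, \] to the space $\mathit{CM}(\lambda;U)$ of solutions $\phi$ on $U$ of the Calogero--Moser system of differential equations \[ \mathcal{L}_i\phi=\sigma_i(\lambda)\phi,\qquad i=1,\dots,n. \]
   Context: Let $G$ be a finite group generated by orthogonal hyperplane reflections of Euclidean space $\mathbb{R}^n$, acting also on the complexification $V=\mathbb{C}^n$; $(\ ,\ )$ denotes the complex bilinear form on $V$ induced by the Euclidean inner product. $A$ is a set consisting of one arbitrarily chosen (real) normal vector $\alpha$ for each reflection $s_\alpha\in G$, and $\Pi_\alpha=\{x\in V:(\alpha,x)=0\}$. The multiplicities are integers $m_\alpha\in\mathbb{Z}_{\ge0}$ with $m_\alpha=m_\beta$ whenever $s_\alpha,s_\beta$ are conjugate in $G$. $S$ is the algebra of polynomial functions on $V$, with $G$-action $(gp)(z)=p(g^{-1}z)$; the invariants $S^G$ are freely generated by homogeneous polynomials $\sigma_1,\dots,\sigma_n$. A polynomial $p\in S$ is also identified with a constant coefficient differential operator $p(\partial)$, the linear function $z\mapsto(\xi,z)$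 corresponding to $\partial_\xi$. $I(\lambda)\subset S$ is the ideal generated by the $G$-invariant polynomials vanishing at $\lambda$; it is $G$-stable, so $S/I(\lambda)$ is a $G$-module (in fact of dimension $|G|$). $\pi(\xi)$ is the operator on $S/I(\lambda)$ of multiplication by the linear function $z\mapsto(\xi,z)$. $\epsilon:G\to\{1,-1\}$ is the homomorphism with $\epsilon(s_\alpha)=-1$ for all reflections. Set \[ w_\lambda(y)=\frac{\sum_{g\in G}\epsilon(g)e^{(g\lambda,y)}}{\prod_{\alpha\in A}(\alpha,\lambda)}, \] which extends to a holomorphic function of $(\lambda,y)\in V\times V$. The linear map $\mu:S\to\mathbb{C}$, $p\mapsto p(\partial)w_\lambda(y)|_{y=0}$, vanishes on $I(\lambda)$ and the induced map $S/I(\lambda)\to\mathbb{C}$ is also denoted $\mu$. Calogero--Moser operators: the Dunkl operators $D_\xi u(x)=\partial_\xi u(x)+\sum_{\alpha\in A}m_\alpha\frac{(\alpha,\xi)}{(\alpha,x)}(u(s_\alpha x)-u(x))$, $\xi\in V$, commute, so that $\sigma_i(D)$ is defined. $\mathcal{L}_i$ is the differential operator (with highest symbol $\sigma_i$ and coefficients regular on $V-\bigcup_\alpha\Pi_\alpha$) whose restriction to $G$-invariant functions coincides with that of $\sigma_i(D)$. Solutions are understood to be holomorphic. *)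

theory Defs
  imports
    "HOL-Analysis.Analysis"
    "HOL-Algebra.Generated_Groups"
    "HOL-Algebra.QuotRing"
    "HOL-Algebra.Module"
begin

type_synonym 'n cspace = "complex ^ 'n"

definition cvec :: "real ^ 'n \<Rightarrow> 'n cspace" where
  "cvec v = (\<chi> i. complex_of_real (v $ i))"

definition cmat :: "real ^ 'n ^ 'n \<Rightarrow> complex ^ 'n ^ 'n" where
  "cmat g = (\<chi> i j. complex_of_real (g $ i $ j))"

text \<open>The complex bilinear (not Hermitian) extension of the Euclidean inner product.\<close>

definition cform :: "'n::finite cspace \<Rightarrow> 'n cspace \<Rightarrow> complex" where
  "cform x y = (\<Sum>i\<in>UNIV. x $ i * y $ i)"

text \<open>
  Complex Frechet differentiability at every point of an open set; \<open>s\<close> is the multiplication by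
  complex scalars of the domain.
\<close>

definition holomorphic_wrt ::
    "(complex \<Rightarrow> 'v \<Rightarrow> 'v) \<Rightarrow> ('v::real_normed_vector \<Rightarrow> complex) \<Rightarrow> 'v set \<Rightarrow> bool" where
  "holomorphic_wrt s f W \<longleftrightarrow>
     (\<forall>x\<in>W. \<exists>f'. (f has_derivative f') (at x) \<and> (\<forall>c v. f' (s c v) = c * f' v))"

abbreviation holo_on :: "('n::finite cspace \<Rightarrow> complex) \<Rightarrow> 'n cspace set \<Rightarrow> bool" where
  "holo_on \<equiv> holomorphic_wrt (*s)"

definition dir_deriv :: "'n::finite cspace \<Rightarrow> ('n cspace \<Rightarrow> complex) \<Rightarrow> 'n cspace \<Rightarrow> complex" where
  "dir_deriv \<xi> f x = deriv (\<lambda>t. f (x + t *s \<xi>)) 0"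

definition refl_mat :: "real ^ 'n \<Rightarrow> real ^ 'n ^ 'n" where
  "refl_mat v = matrix (\<lambda>x. x - (2 * (v \<bullet> x) / (v \<bullet> v)) *\<^sub>R v)"

definition reflections :: "(real ^ 'n ^ 'n) set" where
  "reflections = {refl_mat v | v. v \<noteq> 0}"

definition orth_group :: "(real ^ 'n ^ 'n) monoid" where
  "orth_group = \<lparr>carrier = {g. orthogonal_matrix g}, mult = (**), one = mat 1\<rparr>"

definition finite_reflection_group :: "(real ^ 'n ^ 'n) set \<Rightarrow> bool" where
  "finite_reflection_group G \<longleftrightarrow> finite G \<and> (\<exists>R\<subseteq>reflections. G = generate orth_group R)"

definition normal_vectors :: "(real ^ 'n ^ 'n) set \<Rightarrow> (real ^ 'n) set \<Rightarrow> bool" where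
  "normal_vectors G A \<longleftrightarrow> 0 \<notin> A \<and> bij_betw refl_mat A (G \<inter> reflections)"

definition invariant_multiplicity ::
    "(real ^ 'n ^ 'n) set \<Rightarrow> (real ^ 'n) set \<Rightarrow> (real ^ 'n \<Rightarrow> nat) \<Rightarrow> bool" where
  "invariant_multiplicity G A m \<longleftrightarrow>
     (\<forall>\<alpha>\<in>A. \<forall>\<beta>\<in>A. (\<exists>g\<in>G. refl_mat \<beta> = g ** refl_mat \<alpha> ** matrix_inv g) \<longrightarrow> m \<alpha> = m \<beta>)"

definition sign_character :: "(real ^ 'n ^ 'n) set \<Rightarrow> (real ^ 'n ^ 'n \<Rightarrow> int) \<Rightarrow> bool" where
  "sign_character G \<epsilon> \<longleftrightarrow>
     (\<forall>g\<in>G. \<epsilon> g \<in> {1, -1}) \<and>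
     (\<forall>g\<in>G. \<forall>h\<in>G. \<epsilon> (g ** h) = \<epsilon> g * \<epsilon> h) \<and>
     (\<forall>s\<in>G \<inter> reflections. \<epsilon> s = -1)"

definition regular_set :: "(real ^ 'n::finite) set \<Rightarrow> 'n cspace set" where
  "regular_set A = {x. \<forall>\<alpha>\<in>A. cform (cvec \<alpha>) x \<noteq> 0}"

definition monomial :: "('n \<Rightarrow> nat) \<Rightarrow> 'n::finite cspace \<Rightarrow> complex" where
  "monomial k z = (\<Prod>i\<in>UNIV. z $ i ^ k i)"

definition has_coeffs :: "('n::finite cspace \<Rightarrow> complex) \<Rightarrow> (('n \<Rightarrow> nat) \<Rightarrow> complex) \<Rightarrow> bool" where
  "has_coeffs p c \<longleftrightarrow> finite {k. c k \<noteq> 0} \<and> p = (\<lambda>z. \<Sum>k | c k \<noteq> 0. c k * monomial k z)"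

definition polys :: "('n::finite cspace \<Rightarrow> complex) set" where
  "polys = {p. \<exists>c. has_coeffs p c}"

definition poly_coeffs :: "('n::finite cspace \<Rightarrow> complex) \<Rightarrow> ('n \<Rightarrow> nat) \<Rightarrow> complex" where
  "poly_coeffs p = (THE c. has_coeffs p c)"

definition poly_alg :: "('n::finite cspace \<Rightarrow> complex) ring" where
  "poly_alg = \<lparr>carrier = polys,
     mult = (\<lambda>p q z. p z * q z), one = (\<lambda>z. 1),
     zero = (\<lambda>z. 0), add = (\<lambda>p q z. p z + q z)\<rparr>"

definition act ::
    "real ^ 'n ^ 'n \<Rightarrow> ('n::finite cspace \<Rightarrow> complex) \<Rightarrow> 'n cspace \<Rightarrow> complex" where
  "act g p = (\<lambda>z. p (cmat (matrix_inv g) *v z))"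

definition inv_polys :: "(real ^ 'n ^ 'n) set \<Rightarrow> ('n::finite cspace \<Rightarrow> complex) set" where
  "inv_polys G = {p \<in> polys. \<forall>g\<in>G. act g p = p}"

text \<open>
  Free generation: every invariant is \<open>P(\<sigma>\<^sub>1,\<dots>,\<sigma>\<^sub>n)\<close> for exactly one polynomial \<open>P\<close> in \<open>n\<close> variables.
\<close>

definition free_homogeneous_generators ::
    "(real ^ 'n ^ 'n) set \<Rightarrow> ('n \<Rightarrow> 'n::finite cspace \<Rightarrow> complex) \<Rightarrow> bool" where
  "free_homogeneous_generators G \<sigma> \<longleftrightarrow>
     (\<forall>i. \<sigma> i \<in> inv_polys G \<and> (\<exists>d. \<forall>c z. \<sigma> i (c *s z) = c ^ d * \<sigma> i z)) \<and>
     bij_betw (\<lambda>P z. P (\<chi> i. \<sigma> i z)) polys (inv_polys G)"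

text \<open>
  For a family \<open>T \<xi>\<close> of operators, linear in \<open>\<xi>\<close> and commuting on the functions of interest
  (directional derivatives, Dunkl operators), \<open>poly_op T p\<close> substitutes the operator
  \<open>T \<xi>\<close> for the linear function \<open>z \<mapsto> (\<xi>, z)\<close> in \<open>p\<close>. Because of commutativity it does not matter
  in which order the coordinates are enumerated.
\<close>

definition coords :: "'n::finite list" where
  "coords = (SOME xs. distinct xs \<and> set xs = UNIV)"

definition monomial_op ::
    "('n::finite cspace \<Rightarrow> ('n cspace \<Rightarrow> complex) \<Rightarrow> ('n cspace \<Rightarrow> complex))
     \<Rightarrow> ('n \<Rightarrow> nat) \<Rightarrow> ('n cspace \<Rightarrow> complex) \<Rightarrow> ('n cspace \<Rightarrow> complex)" where
  "monomial_op T k = foldr (\<lambda>i F. (T (axis i 1) ^^ k i) \<circ> F) coords id"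

definition poly_op ::
    "('n::finite cspace \<Rightarrow> ('n cspace \<Rightarrow> complex) \<Rightarrow> ('n cspace \<Rightarrow> complex))
     \<Rightarrow> ('n cspace \<Rightarrow> complex) \<Rightarrow> ('n cspace \<Rightarrow> complex) \<Rightarrow> ('n cspace \<Rightarrow> complex)" where
  "poly_op T p u x = (\<Sum>k | poly_coeffs p k \<noteq> 0. poly_coeffs p k * monomial_op T k u x)"

definition dunkl ::
    "(real ^ 'n) set \<Rightarrow> (real ^ 'n \<Rightarrow> nat) \<Rightarrow> 'n::finite cspace
     \<Rightarrow> ('n cspace \<Rightarrow> complex) \<Rightarrow> ('n cspace \<Rightarrow> complex)" where
  "dunkl A m \<xi> u x = dir_deriv \<xi> u x +
     (\<Sum>\<alpha>\<in>A. of_nat (m \<alpha>) * (cform (cvec \<alpha>) \<xi> / cform (cvec \<alpha>) x)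
        * (u (cmat (refl_mat \<alpha>) *v x) - u x))"

text \<open>
  A differential operator \<open>\<Sum>\<^sub>k L\<^sub>k(x) \<partial>\<^sup>k\<close> is given by its coefficients, indexed by multi-indices \<open>k\<close>.
  Only their values on the regular set are relevant. The order bound in \<open>highest_symbol\<close> makes
  the sum finite there.
\<close>

type_synonym 'n diffop = "('n \<Rightarrow> nat) \<Rightarrow> 'n cspace \<Rightarrow> complex"

definition apply_diffop ::
    "'n::finite diffop \<Rightarrow> ('n cspace \<Rightarrow> complex) \<Rightarrow> ('n cspace \<Rightarrow> complex)" where
  "apply_diffop L u x = (\<Sum>k | L k x \<noteq> 0. L k x * monomial_op dir_deriv k u x)"

definition regular_function :: "(real ^ 'n) set \<Rightarrow> ('n::finite cspace \<Rightarrow> complex) \<Rightarrow> bool" where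
  "regular_function A f \<longleftrightarrow>
     (\<exists>p\<in>polys. \<exists>N::nat. \<forall>x\<in>regular_set A. f x = p x / (\<Prod>\<alpha>\<in>A. cform (cvec \<alpha>) x) ^ N)"

definition highest_symbol ::
    "(real ^ 'n) set \<Rightarrow> 'n::finite diffop \<Rightarrow> ('n cspace \<Rightarrow> complex) \<Rightarrow> bool" where
  "highest_symbol A L p \<longleftrightarrow> (\<exists>d.
     (\<forall>k. d < (\<Sum>i\<in>UNIV. k i) \<longrightarrow> (\<forall>x\<in>regular_set A. L k x = 0)) \<and>
     (\<forall>x\<in>regular_set A. \<forall>\<zeta>. (\<Sum>k | (\<Sum>i\<in>UNIV. k i) = d. L k x * monomial k \<zeta>) = p \<zeta>))"

text \<open>
  The defining property of the Calogero-Moser operator associated with \<open>p\<close>. The invariant functions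
  are the holomorphic ones on arbitrary \<open>G\<close>-stable open subsets of the regular set; they determine
  the operator uniquely on the regular set.
\<close>

definition calogero_moser_operator ::
    "(real ^ 'n ^ 'n) set \<Rightarrow> (real ^ 'n) set \<Rightarrow> (real ^ 'n \<Rightarrow> nat)
     \<Rightarrow> ('n::finite cspace \<Rightarrow> complex) \<Rightarrow> 'n diffop \<Rightarrow> bool" where
  "calogero_moser_operator G A m p L \<longleftrightarrow>
     (\<forall>k. regular_function A (L k)) \<and>
     highest_symbol A L p \<and>
     (\<forall>W u. open W \<longrightarrow> W \<subseteq> regular_set A \<longrightarrow> holo_on u W \<longrightarrow>
        (\<forall>g\<in>G. \<forall>x\<in>W. cmat g *v x \<in> W \<and> u (cmat g *v x) = u x) \<longrightarrow>
        (\<forall>x\<in>W. apply_diffop L u x = poly_op (dunkl A m) p u x))"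

text \<open>The point \<open>\<lambda>\<close> is written \<open>l\<close>.\<close>

definition ideal_at :: "(real ^ 'n ^ 'n) set \<Rightarrow> 'n::finite cspace \<Rightarrow> ('n cspace \<Rightarrow> complex) set" where
  "ideal_at G l = genideal poly_alg {p \<in> inv_polys G. p l = 0}"

definition quot :: "(real ^ 'n ^ 'n) set \<Rightarrow> 'n::finite cspace \<Rightarrow> ('n cspace \<Rightarrow> complex) set ring" where
  "quot G l = poly_alg Quot ideal_at G l"

definition quot_class ::
    "(real ^ 'n ^ 'n) set \<Rightarrow> 'n::finite cspace \<Rightarrow> ('n cspace \<Rightarrow> complex) \<Rightarrow> ('n cspace \<Rightarrow> complex) set" where
  "quot_class G l p = ideal_at G l +>\<^bsub>poly_alg\<^esub> p"

definition quot_smult ::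
    "(real ^ 'n ^ 'n) set \<Rightarrow> 'n::finite cspace \<Rightarrow> complex
     \<Rightarrow> ('n cspace \<Rightarrow> complex) set \<Rightarrow> ('n cspace \<Rightarrow> complex) set" where
  "quot_smult G l c X = quot_class G l (\<lambda>z. c) \<otimes>\<^bsub>quot G l\<^esub> X"

definition quot_act ::
    "real ^ 'n ^ 'n \<Rightarrow> ('n::finite cspace \<Rightarrow> complex) set \<Rightarrow> ('n cspace \<Rightarrow> complex) set" where
  "quot_act g X = act g ` X"

definition quot_pi ::
    "(real ^ 'n ^ 'n) set \<Rightarrow> 'n::finite cspace \<Rightarrow> 'n cspace
     \<Rightarrow> ('n cspace \<Rightarrow> complex) set \<Rightarrow> ('n cspace \<Rightarrow> complex) set" where
  "quot_pi G l \<xi> X = quot_class G l (\<lambda>z. cform \<xi> z) \<otimes>\<^bsub>quot G l\<^esub> X"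

definition quot_dual ::
    "(real ^ 'n ^ 'n) set \<Rightarrow> 'n::finite cspace \<Rightarrow> (('n cspace \<Rightarrow> complex) set \<Rightarrow> complex) set" where
  "quot_dual G l = {f.
     (\<forall>X\<in>carrier (quot G l). \<forall>Y\<in>carrier (quot G l). f (X \<oplus>\<^bsub>quot G l\<^esub> Y) = f X + f Y) \<and>
     (\<forall>c. \<forall>X\<in>carrier (quot G l). f (quot_smult G l c X) = c * f X)}"

text \<open>\<open>w_fun G A \<epsilon> l y\<close> is \<open>w\<^sub>\<lambda>(y)\<close>, the jointly holomorphic extension of the quotient.\<close>

definition w_fun ::
    "(real ^ 'n ^ 'n) set \<Rightarrow> (real ^ 'n) set \<Rightarrow> (real ^ 'n ^ 'n \<Rightarrow> int)
     \<Rightarrow> 'n::finite cspace \<Rightarrow> 'n cspace \<Rightarrow> complex" where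
  "w_fun G A \<epsilon> = (THE w.
     holomorphic_wrt (\<lambda>c v. (c *s fst v, c *s snd v)) (\<lambda>v. w (fst v) (snd v)) UNIV \<and>
     (\<forall>l\<in>regular_set A. \<forall>y. w l y =
        (\<Sum>g\<in>G. of_int (\<epsilon> g) * exp (cform (cmat g *v l) y)) / (\<Prod>\<alpha>\<in>A. cform (cvec \<alpha>) l)))"

definition mu ::
    "(real ^ 'n ^ 'n) set \<Rightarrow> (real ^ 'n) set \<Rightarrow> (real ^ 'n ^ 'n \<Rightarrow> int)
     \<Rightarrow> 'n::finite cspace \<Rightarrow> ('n cspace \<Rightarrow> complex) \<Rightarrow> complex" where
  "mu G A \<epsilon> l p = poly_op dir_deriv p (w_fun G A \<epsilon> l) 0"

definition quot_mu ::
    "(real ^ 'n ^ 'n) set \<Rightarrow> (real ^ 'n) set \<Rightarrow> (real ^ 'n ^ 'n \<Rightarrow> int)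
     \<Rightarrow> 'n::finite cspace \<Rightarrow> ('n cspace \<Rightarrow> complex) set \<Rightarrow> complex" where
  "quot_mu G A \<epsilon> l X = the_elem (mu G A \<epsilon> l ` X)"

definition KZ_rhs ::
    "(real ^ 'n ^ 'n) set \<Rightarrow> (real ^ 'n) set \<Rightarrow> (real ^ 'n \<Rightarrow> nat) \<Rightarrow> 'n::finite cspace
     \<Rightarrow> 'n cspace \<Rightarrow> 'n cspace \<Rightarrow> ('n cspace \<Rightarrow> complex) set \<Rightarrow> ('n cspace \<Rightarrow> complex) set" where
  "KZ_rhs G A m l \<xi> x X =
     (\<Oplus>\<^bsub>quot G l\<^esub>\<alpha>\<in>A.
        quot_smult G l (of_nat (m \<alpha>) * (cform (cvec \<alpha>) \<xi> / cform (cvec \<alpha>) x))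
          (quot_act (refl_mat \<alpha>) X \<oplus>\<^bsub>quot G l\<^esub> X))
     \<oplus>\<^bsub>quot G l\<^esub> quot_pi G l \<xi> X"

text \<open>
  Holomorphy and derivatives of a map into the finite-dimensional vector space \<open>S/I(\<lambda>)\<close> are tested
  by composing with all linear functionals, i.e. in coordinates. Functions on \<open>U\<close> are extensional.
\<close>

definition KZ_solutions ::
    "(real ^ 'n ^ 'n) set \<Rightarrow> (real ^ 'n) set \<Rightarrow> (real ^ 'n \<Rightarrow> nat) \<Rightarrow> 'n::finite cspace
     \<Rightarrow> 'n cspace set \<Rightarrow> ('n cspace \<Rightarrow> ('n cspace \<Rightarrow> complex) set) set" where
  "KZ_solutions G A m l U = {\<psi> \<in> U \<rightarrow>\<^sub>E carrier (quot G l).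
     \<forall>f\<in>quot_dual G l. holo_on (f \<circ> \<psi>) U \<and>
       (\<forall>\<xi>. \<forall>x\<in>U. dir_deriv \<xi> (f \<circ> \<psi>) x = f (KZ_rhs G A m l \<xi> x (\<psi> x)))}"

definition CM_solutions ::
    "('n \<Rightarrow> 'n::finite cspace \<Rightarrow> complex) \<Rightarrow> ('n \<Rightarrow> 'n diffop) \<Rightarrow> 'n cspace
     \<Rightarrow> 'n cspace set \<Rightarrow> ('n cspace \<Rightarrow> complex) set" where
  "CM_solutions \<sigma> L l U = {\<phi> \<in> extensional U. holo_on \<phi> U \<and>
     (\<forall>i. \<forall>x\<in>U. apply_diffop (L i) \<phi> x = \<sigma> i l * \<phi> x)}"

definition complex_field :: "complex ring" where
  "complex_field = \<lparr>carrier = UNIV, mult = (*), one = 1, zero = 0, add = (+)\<rparr>"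

text \<open>The fields \<open>mult\<close> and \<open>one\<close> of a \<open>module\<close> record play no role in the locale \<open>module\<close>.\<close>

definition KZ_space ::
    "(real ^ 'n ^ 'n) set \<Rightarrow> (real ^ 'n) set \<Rightarrow> (real ^ 'n \<Rightarrow> nat) \<Rightarrow> 'n::finite cspace
     \<Rightarrow> 'n cspace set \<Rightarrow> (complex, 'n cspace \<Rightarrow> ('n cspace \<Rightarrow> complex) set) module" where
  "KZ_space G A m l U = \<lparr>carrier = KZ_solutions G A m l U, mult = undefined, one = undefined,
     zero = (\<lambda>x\<in>U. \<zero>\<^bsub>quot G l\<^esub>),
     add = (\<lambda>\<psi> \<psi>'. \<lambda>x\<in>U. \<psi> x \<oplus>\<^bsub>quot G l\<^esub> \<psi>' x),
     smult = (\<lambda>c \<psi>. \<lambda>x\<in>U. quot_smult G l c (\<psi> x))\<rparr>"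

definition CM_space ::
    "('n \<Rightarrow> 'n::finite cspace \<Rightarrow> complex) \<Rightarrow> ('n \<Rightarrow> 'n diffop) \<Rightarrow> 'n cspace
     \<Rightarrow> 'n cspace set \<Rightarrow> (complex, 'n cspace \<Rightarrow> complex) module" where
  "CM_space \<sigma> L l U = \<lparr>carrier = CM_solutions \<sigma> L l U, mult = undefined, one = undefined,
     zero = (\<lambda>x\<in>U. 0),
     add = (\<lambda>\<phi> \<phi>'. \<lambda>x\<in>U. \<phi> x + \<phi>' x),
     smult = (\<lambda>c \<phi>. \<lambda>x\<in>U. c * \<phi> x)\<rparr>"

definition module_isomorphism ::
    "'r ring \<Rightarrow> ('r, 'a) module \<Rightarrow> ('r, 'b) module \<Rightarrow> ('a \<Rightarrow> 'b) \<Rightarrow> bool" where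
  "module_isomorphism R M N F \<longleftrightarrow>
     module R M \<and> module R N \<and> bij_betw F (carrier M) (carrier N) \<and>
     (\<forall>a\<in>carrier M. \<forall>b\<in>carrier M. F (a \<oplus>\<^bsub>M\<^esub> b) = F a \<oplus>\<^bsub>N\<^esub> F b) \<and>
     (\<forall>r\<in>carrier R. \<forall>a\<in>carrier M. F (r \<odot>\<^bsub>M\<^esub> a) = r \<odot>\<^bsub>N\<^esub> F a)"

definition matsuo_cherednik ::
    "(real ^ 'n ^ 'n) set \<Rightarrow> (real ^ 'n) set \<Rightarrow> (real ^ 'n ^ 'n \<Rightarrow> int) \<Rightarrow> 'n::finite cspace
     \<Rightarrow> 'n cspace set \<Rightarrow> ('n cspace \<Rightarrow> ('n cspace \<Rightarrow> complex) set) \<Rightarrow> ('n cspace \<Rightarrow> complex)" where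
  "matsuo_cherednik G A \<epsilon> l U \<psi> = (\<lambda>x\<in>U. quot_mu G A \<epsilon> l (\<psi> x))"

end

theory Submission
  imports Defs "HOL-Complex_Analysis.Cauchy_Integral_Formula"
begin

text \<open>
  Write \<open>B p\<close> for the polynomial obtained by dividing the antisymmetrization of \<open>p\<close> by the product
  \<open>\<Delta>\<close> of the linear forms of the normal vectors. Differentiating the exponentials in \<open>w\<close> gives
  \<open>\<mu>(p) = B p \<lambda>\<close> at regular \<open>\<lambda>\<close>, hence everywhere by continuity (\<open>mu_eq_B\<close>). So \<open>\<mu>\<close> is the value at
  \<open>\<lambda>\<close> of a map that is linear over the invariants and changes by the sign character under the group.

  The algebraic core is nondegeneracy (\<open>ideal_at_iff\<close>): the radical of the form
  \<open>(p, q) \<mapsto> \<mu>(p q)\<close> on polynomials is exactly \<open>I(\<lambda>)\<close>. For \<open>\<lambda> = 0\<close> this is Steinberg's argument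
  (\<open>J_nondegenerate\<close>). For general \<open>\<lambda>\<close> one compares top degree parts: \<open>B\<close> lowers degrees by the
  number of reflections, so pairing \<open>q\<close> with polynomials of complementary degree only sees its top
  part at \<open>0\<close>; if these pairings vanish, the top part lies in \<open>I(0)\<close> and can be traded modulo \<open>I(\<lambda>)\<close>
  for terms of lower degree. Two consequences are used throughout. Every functional on \<open>S/I(\<lambda>)\<close> has
  the form \<open>p \<mapsto> \<mu>(p r)\<close> (\<open>functional_representation\<close>), so a map \<open>\<psi>\<close> into the quotient amounts to
  the family of functions \<open>F p = \<mu>(p \<psi>)\<close>. And regular points, including complex ones, have trivial
  stabilizers (\<open>regular_stabilizer\<close>), so that functions near a regular point extend to invariant
  functions near its orbit.

  In terms of \<open>F\<close>, the sign rule for \<open>\<mu>\<close> turns the terms \<open>s\<^sub>\<alpha> + 1\<close> of the KZ equations into the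
  difference part of a Dunkl operator: spread over the orbit of a small open set, the equations say
  \<open>D\<^sub>\<xi> (F p) = F (\<xi> p)\<close>, hence \<open>F p = p(D) (F 1)\<close> (\<open>KZ_family_pD\<close>). Therefore \<open>F 1 = \<mu>(\<psi>)\<close> determines
  \<open>\<psi>\<close>, and as \<open>p = \<sigma>\<^sub>i\<close> acts on the quotient by the scalar \<open>\<sigma>\<^sub>i(\<lambda>)\<close>, the function \<open>F 1\<close> solves the
  Calogero-Moser system. Conversely, a solution \<open>\<phi>\<close> with local invariant extension \<open>u\<close> yields the
  family \<open>F p = p(D) u\<close>. As the Dunkl operators commute (\<open>dunkl_commute\<close>), this family vanishes on
  \<open>I(\<lambda>)\<close> and solves the KZ equations (\<open>KZ_family_of_eigenfunction\<close>). The local families agree on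
  overlaps because they are determined by \<open>\<phi>\<close>, so they glue.
\<close>

section \<open>Polynomial functions\<close>

lemma monomial_mult: "monomial k z * monomial k' z = monomial (\<lambda>i. k i + k' i) z"
  by (simp add: monomial_def power_add prod.distrib)

lemma monomial_zero [simp]: "monomial (\<lambda>i. 0) z = 1"
  by (simp add: monomial_def)

lemma monomial_single: "monomial (\<lambda>j. if j = i then 1 else 0) z = z $ i"
proof -
  have "monomial (\<lambda>j. if j = i then 1 else 0) z = (\<Prod>j\<in>UNIV. if j = i then z $ j else 1)"
    unfolding monomial_def by (intro prod.cong) auto
  then show ?thesis by simp
qed

lemma monomial_coord: "z $ i * monomial k z = monomial (k(i := Suc (k i))) z"
proof -
  have "(\<lambda>j. (if j = i then 1 else 0) + k j) = k(i := Suc (k i))" by auto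
  then show ?thesis by (metis monomial_mult monomial_single)
qed

text \<open>Monomials are distinct characters of the multiplicative monoid of vectors with componentwise
  product, so this is Dedekind's independence of characters.\<close>

lemma monomial_indep:
  fixes c :: "('n::finite \<Rightarrow> nat) \<Rightarrow> complex"
  assumes "finite K" "\<And>z::'n cspace. (\<Sum>k\<in>K. c k * monomial k z) = 0"
  shows "\<forall>k\<in>K. c k = 0"
  using assms
proof (induction K arbitrary: c rule: finite_induct)
  case empty
  then show ?case by simp
next
  case (insert k0 K)
  have ck: "c k = 0" if k: "k \<in> K" for k
  proof -
    have "k \<noteq> k0" using insert k by auto
    then obtain i where i: "k i \<noteq> k0 i" by auto
    \<comment> \<open>This vector separates the characters \<open>k\<close> and \<open>k0\<close>; translating by it and subtracting eliminates \<open>k0\<close>.\<close>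
    define w :: "'n cspace" where "w = (\<chi> j. if j = i then 2 else 1)"
    have mw: "monomial k w = 2 ^ k i" for k
      using prod.delta[of UNIV i "\<lambda>j. 2 ^ k j :: complex"]
      by (simp add: monomial_def w_def if_distrib[of "\<lambda>x. x ^ _"] cong: if_cong)
    have mm: "monomial k (\<chi> j. z $ j * w $ j) = monomial k z * monomial k w" for k and z :: "'n cspace"
      by (simp add: monomial_def power_mult_distrib prod.distrib)
    have "(\<Sum>k\<in>K. (c k * (monomial k w - monomial k0 w)) * monomial k z) = 0" for z :: "'n cspace"
    proof -
      have a: "c k0 * monomial k0 z + (\<Sum>k\<in>K. c k * monomial k z) = 0"
        using insert.prems[of z] insert.hyps by simp
      have b: "c k0 * (monomial k0 z * monomial k0 w) + (\<Sum>k\<in>K. c k * (monomial k z * monomial k w)) = 0"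
        using insert.prems[of "\<chi> j. z $ j * w $ j"] insert.hyps by (simp add: mm)
      have "(\<Sum>k\<in>K. (c k * (monomial k w - monomial k0 w)) * monomial k z)
          = (\<Sum>k\<in>K. c k * (monomial k z * monomial k w)) - monomial k0 w * (\<Sum>k\<in>K. c k * monomial k z)"
        by (simp add: sum_distrib_left sum_subtractf algebra_simps)
      also have "\<dots> = - c k0 * (monomial k0 z * monomial k0 w) - monomial k0 w * (- c k0 * monomial k0 z)"
        using a b by (simp add: add_eq_0_iff)
      also have "\<dots> = 0" by simp
      finally show ?thesis .
    qed
    then have "\<forall>k\<in>K. c k * (monomial k w - monomial k0 w) = 0" by (rule insert.IH)
    then have "c k = 0 \<or> (2::complex) ^ k i = 2 ^ k0 i" using k mw by auto
    moreover have "(2::complex) ^ k i \<noteq> 2 ^ k0 i"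
    proof
      assume "(2::complex) ^ k i = 2 ^ k0 i"
      then have "norm ((2::complex) ^ k i) = norm ((2::complex) ^ k0 i)" by simp
      then have "(2::real) ^ k i = 2 ^ k0 i" by (simp add: norm_power)
      then show False using i by simp
    qed
    ultimately show "c k = 0" by blast
  qed
  have "c k0 = 0"
    using insert.prems[of "\<chi> j. 1"] insert.hyps ck by (simp add: monomial_def)
  with ck show ?case by auto
qed

lemma has_coeffs_supset:
  assumes "has_coeffs p c" "finite K" "{k. c k \<noteq> 0} \<subseteq> K"
  shows "p z = (\<Sum>k\<in>K. c k * monomial k z)"
  using assms unfolding has_coeffs_def
  by (auto intro!: sum.mono_neutral_left)

lemma has_coeffsI:
  assumes "finite K" "\<And>k. k \<notin> K \<Longrightarrow> c k = 0" "\<And>z. p z = (\<Sum>k\<in>K. c k * monomial k z)"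
  shows "has_coeffs p c"
proof -
  have "{k. c k \<noteq> 0} \<subseteq> K" using assms(2) by auto
  moreover from this have "(\<Sum>k\<in>K. c k * monomial k z) = (\<Sum>k | c k \<noteq> 0. c k * monomial k z)" for z
    using assms(1) by (intro sum.mono_neutral_right) auto
  ultimately show ?thesis
    unfolding has_coeffs_def using assms finite_subset by fastforce
qed

lemma has_coeffs_unique:
  assumes "has_coeffs p c" "has_coeffs p c'"
  shows "c = c'"
proof -
  let ?K = "{k. c k \<noteq> 0} \<union> {k. c' k \<noteq> 0}"
  have fin: "finite ?K" using assms by (auto simp: has_coeffs_def)
  have "\<forall>k\<in>?K. c k - c' k = 0"
  proof (rule monomial_indep[OF fin])
    fix z
    show "(\<Sum>k\<in>?K. (c k - c' k) * monomial k z) = 0"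
      using has_coeffs_supset[OF assms(1) fin, of z] has_coeffs_supset[OF assms(2) fin, of z]
      by (simp add: sum_subtractf left_diff_distrib)
  qed
  then show ?thesis by (intro ext) (metis (mono_tags, lifting) UnI1 UnI2 eq_iff_diff_eq_0 mem_Collect_eq)
qed

lemma poly_coeffs_eq: "has_coeffs p c \<Longrightarrow> poly_coeffs p = c"
  unfolding poly_coeffs_def by (rule the_equality) (auto dest: has_coeffs_unique)

lemma has_coeffs_poly_coeffs: "p \<in> polys \<Longrightarrow> has_coeffs p (poly_coeffs p)"
  using poly_coeffs_eq by (auto simp: polys_def)

lemma has_coeffs_add:
  assumes "has_coeffs p c" "has_coeffs q d"
  shows "has_coeffs (\<lambda>z. p z + q z) (\<lambda>k. c k + d k)"
proof -
  let ?K = "{k. c k \<noteq> 0} \<union> {k. d k \<noteq> 0}"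
  have fin: "finite ?K" using assms by (auto simp: has_coeffs_def)
  show ?thesis
    using has_coeffs_supset[OF assms(1) fin] has_coeffs_supset[OF assms(2) fin]
    by (intro has_coeffsI[OF fin]) (auto simp: sum.distrib algebra_simps)
qed

lemma has_coeffs_scale:
  assumes "has_coeffs p c"
  shows "has_coeffs (\<lambda>z. a * p z) (\<lambda>k. a * c k)"
  using assms unfolding has_coeffs_def
  by (intro has_coeffsI[of "{k. c k \<noteq> 0}", unfolded has_coeffs_def])
     (auto simp: sum_distrib_left algebra_simps)

lemma has_coeffs_monomial: "has_coeffs (monomial k) (\<lambda>j. if j = k then 1 else 0)"
  by (rule has_coeffsI[of "{k}"]) auto

lemma polys_add [intro]: "p \<in> polys \<Longrightarrow> q \<in> polys \<Longrightarrow> (\<lambda>z. p z + q z) \<in> polys"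
  using has_coeffs_add unfolding polys_def by blast

lemma polys_scale [intro]: "p \<in> polys \<Longrightarrow> (\<lambda>z. a * p z) \<in> polys"
  using has_coeffs_scale unfolding polys_def by blast

lemma polys_monomial [intro]: "monomial k \<in> polys"
  using has_coeffs_monomial unfolding polys_def by blast

lemma polys_const [intro]: "(\<lambda>z. c) \<in> polys"
  using polys_scale[OF polys_monomial[of "\<lambda>i. 0"], of c] by simp

lemma polys_minus [intro]: "p \<in> polys \<Longrightarrow> (\<lambda>z. - p z) \<in> polys"
  using polys_scale[of p "-1"] by simp

lemma polys_diff [intro]: "p \<in> polys \<Longrightarrow> q \<in> polys \<Longrightarrow> (\<lambda>z. p z - q z) \<in> polys"
  using polys_add[OF _ polys_minus, of p q] by simp

lemma polys_sum [intro]: "(\<And>i. i \<in> I \<Longrightarrow> f i \<in> polys) \<Longrightarrow> (\<lambda>z. \<Sum>i\<in>I. f i z) \<in> polys"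
  by (induction I rule: infinite_finite_induct) auto

text \<open>
  Multiplying by one coordinate at a time is the form of induction that fits the substitution of
  operators for coordinates.
\<close>

lemma polys_induct [consumes 1, case_names const add coord]:
  assumes "p \<in> polys"
    and const: "\<And>c. Q (\<lambda>z. c)"
    and add: "\<And>p q. p \<in> polys \<Longrightarrow> q \<in> polys \<Longrightarrow> Q p \<Longrightarrow> Q q \<Longrightarrow> Q (\<lambda>z. p z + q z)"
    and coord: "\<And>i p. p \<in> polys \<Longrightarrow> Q p \<Longrightarrow> Q (\<lambda>z. z $ i * p z)"
  shows "Q p"
proof -
  have mon: "Q (\<lambda>z. a * monomial k z)" for a k
  proof (induction "\<Sum>i\<in>UNIV. k i" arbitrary: k)
    case 0
    then have "k = (\<lambda>i. 0)" by auto
    then show ?case using const[of a] by simp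
  next
    case (Suc n)
    then obtain i where i: "k i > 0"
      by (metis (no_types, lifting) gr0I nat.distinct(1) sum.neutral)
    define k' where "k' = k(i := k i - 1)"
    have "(\<Sum>i\<in>UNIV. k i) = k i + (\<Sum>j\<in>UNIV - {i}. k j)"
      by (simp add: sum.remove)
    moreover have "(\<Sum>i\<in>UNIV. k' i) = k' i + (\<Sum>j\<in>UNIV - {i}. k' j)"
      by (simp add: sum.remove)
    moreover have "(\<Sum>j\<in>UNIV - {i}. k' j) = (\<Sum>j\<in>UNIV - {i}. k j)"
      by (rule sum.cong) (auto simp: k'_def)
    ultimately have "n = (\<Sum>i\<in>UNIV. k' i)" using Suc(2) i by (simp add: k'_def)
    then have "Q (\<lambda>z. a * monomial k' z)" by (rule Suc(1))
    then have "Q (\<lambda>z. z $ i * (a * monomial k' z))" by (intro coord) auto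
    moreover have "z $ i * (a * monomial k' z) = a * monomial k z" for z :: "'a cspace"
    proof -
      have "k'(i := Suc (k' i)) = k" using i by (auto simp: k'_def)
      then show ?thesis using monomial_coord[of z i k'] by (simp add: algebra_simps)
    qed
    ultimately show ?case by simp
  qed
  obtain c where c: "has_coeffs p c" using assms(1) by (auto simp: polys_def)
  have "Q (\<lambda>z. \<Sum>k\<in>K. c k * monomial k z) \<and> (\<lambda>z. \<Sum>k\<in>K. c k * monomial k z) \<in> polys" if "finite K" for K
    using that
  proof induction
    case empty
    then show ?case using const[of 0] by auto
  next
    case (insert k K)
    have "Q (\<lambda>z. c k * monomial k z + (\<Sum>k\<in>K. c k * monomial k z))"
      using insert mon by (intro add) auto
    moreover have "(\<lambda>z. c k * monomial k z + (\<Sum>k\<in>K. c k * monomial k z)) \<in> polys"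
      using insert by (intro polys_add polys_scale polys_monomial) auto
    ultimately show ?case using insert.hyps by simp
  qed
  then show ?thesis using c unfolding has_coeffs_def by metis
qed

lemma polys_coord_mult [intro]:
  assumes "p \<in> polys"
  shows "(\<lambda>z. z $ i * p z) \<in> polys"
proof -
  obtain c where c: "has_coeffs p c" using assms by (auto simp: polys_def)
  have "(\<lambda>z. \<Sum>k | c k \<noteq> 0. c k * monomial (k(i := Suc (k i))) z) \<in> polys"
    by (intro polys_sum polys_scale polys_monomial)
  also have "(\<lambda>z. \<Sum>k | c k \<noteq> 0. c k * monomial (k(i := Suc (k i))) z) = (\<lambda>z. z $ i * p z)"
    using c by (simp add: has_coeffs_def sum_distrib_left monomial_coord[symmetric] mult.left_commute)
  finally show ?thesis .
qed

lemma polys_coord [intro]: "(\<lambda>z. z $ i) \<in> polys"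
  using polys_coord_mult[OF polys_const[of 1]] by simp

lemma polys_mult [intro]:
  assumes "p \<in> polys" "q \<in> polys"
  shows "(\<lambda>z. p z * q z) \<in> polys"
  using assms(1)
proof (induction rule: polys_induct)
  case (add p p')
  then have "(\<lambda>z. p z * q z + p' z * q z) \<in> polys" by auto
  then show ?case by (simp add: ring_distribs)
next
  case (coord i p)
  then have "(\<lambda>z. z $ i * (p z * q z)) \<in> polys" by auto
  then show ?case by (simp add: mult.assoc)
qed (use assms(2) in auto)

lemma polys_prod [intro]: "(\<And>i. i \<in> I \<Longrightarrow> f i \<in> polys) \<Longrightarrow> (\<lambda>z. \<Prod>i\<in>I. f i z) \<in> polys"
  by (induction I rule: infinite_finite_induct) auto

lemma polys_cform [intro]: "(\<lambda>z. cform a z) \<in> polys"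
  unfolding cform_def by (intro polys_sum polys_scale polys_coord)

lemma polys_compose:
  assumes "p \<in> polys" "\<And>i. (\<lambda>z. f z $ i) \<in> polys"
  shows "(\<lambda>z. p (f z)) \<in> polys"
  using assms(1) by (induction rule: polys_induct) (use assms(2) in auto)

lemma polys_matrix:
  assumes "p \<in> polys"
  shows "(\<lambda>z. p (M *v z)) \<in> polys"
  by (rule polys_compose[OF assms]) (simp add: matrix_vector_mult_def, intro polys_sum polys_scale polys_coord)

lemma polys_compose_polys:
  assumes "P \<in> polys" "\<And>i. \<sigma> i \<in> polys"
  shows "(\<lambda>z. P (\<chi> i. \<sigma> i z)) \<in> polys"
  by (rule polys_compose[OF assms(1)]) (use assms(2) in auto)

lemma polys_continuous: "p \<in> polys \<Longrightarrow> continuous_on S p"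
  by (induction rule: polys_induct) (auto intro!: continuous_intros)

subsection \<open>The bilinear form\<close>

lemma cform_commute: "cform x y = cform y x"
  by (simp add: cform_def mult.commute)

lemma cform_add_left: "cform (x + y) z = cform x z + cform y z"
  and cform_add_right: "cform z (x + y) = cform z x + cform z y"
  by (simp_all add: cform_def sum.distrib algebra_simps)

lemma cform_diff_left: "cform (x - y) z = cform x z - cform y z"
  and cform_diff_right: "cform z (x - y) = cform z x - cform z y"
  by (simp_all add: cform_def sum_subtractf algebra_simps)

lemma cform_scale_left: "cform (c *s x) z = c * cform x z"
  and cform_scale_right: "cform z (c *s x) = c * cform z x"
  by (simp_all add: cform_def sum_distrib_left algebra_simps)

lemma cform_zero [simp]: "cform 0 z = 0" "cform z 0 = 0"
  by (simp_all add: cform_def)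

lemma cform_uminus: "cform (- x) z = - cform x z" "cform z (- x) = - cform z x"
  by (simp_all add: cform_def sum_negf)

lemmas cform_linear = cform_add_left cform_add_right cform_diff_left cform_diff_right
  cform_scale_left cform_scale_right cform_uminus

lemma cform_cvec: "cform (cvec a) (cvec b) = complex_of_real (a \<bullet> b)"
  by (simp add: cform_def cvec_def inner_vec_def)

lemma cform_axis: "cform (axis i 1) z = z $ i"
proof -
  have "cform (axis i 1) z = (\<Sum>j\<in>UNIV. if j = i then z $ j else 0)"
    unfolding cform_def by (rule sum.cong) (auto simp: axis_def)
  then show ?thesis by simp
qed

lemma cform_nondeg: "(\<And>y. cform x y = 0) \<Longrightarrow> x = 0"
  by (metis cform_axis cform_commute vec_eq_iff zero_index)

lemma continuous_on_cform [continuous_intros]: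
  "continuous_on S f \<Longrightarrow> continuous_on S (\<lambda>x. cform a (f x))"
  unfolding cform_def by (intro continuous_intros)

lemma bounded_linear_cform: "bounded_linear (cform \<zeta>)"
  by (rule linear_conv_bounded_linear[THEN iffD1], rule linearI, rule cform_add_right)
     (simp add: cform_def scaleR_sum_right)

subsection \<open>Division by a linear form\<close>

text \<open>
  A difference of products telescopes, so divisibility propagates from the coordinates. With
  \<open>cform a b = 1\<close> the shifted point is a projection to the hyperplane of \<open>a\<close>; with
  \<open>cform a b = 2\<close> it is a reflection.
\<close>

lemma polys_divided_difference:
  assumes "p \<in> polys"
  shows "\<exists>q\<in>polys. \<forall>z. p z - p (z - cform a z *s b) = cform a z * q z"
  using assms
proof (induction rule: polys_induct)
  case (const c)
  then show ?case by (intro bexI[of _ "\<lambda>z. 0"]) auto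
next
  case (add p p')
  then obtain q q' where q: "q \<in> polys" "q' \<in> polys"
    "\<And>z. p z - p (z - cform a z *s b) = cform a z * q z"
    "\<And>z. p' z - p' (z - cform a z *s b) = cform a z * q' z" by blast
  have "p z + p' z - (p (z - cform a z *s b) + p' (z - cform a z *s b)) = cform a z * (q z + q' z)" for z
  proof -
    have "p z + p' z - (p (z - cform a z *s b) + p' (z - cform a z *s b))
      = (p z - p (z - cform a z *s b)) + (p' z - p' (z - cform a z *s b))" by simp
    then show ?thesis by (simp only: q(3,4) ring_distribs)
  qed
  with q(1,2) show ?case by (intro bexI[of _ "\<lambda>z. q z + q' z"]) auto
next
  case (coord i p)
  then obtain q where q: "q \<in> polys" "\<And>z. p z - p (z - cform a z *s b) = cform a z * q z" by blast
  have p': "(\<lambda>z. p (z - cform a z *s b)) \<in> polys"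
    by (rule polys_compose[OF coord(1)]) (auto intro!: polys_diff polys_mult)
  have "z $ i * p z - (z - cform a z *s b) $ i * p (z - cform a z *s b)
      = cform a z * (z $ i * q z + b $ i * p (z - cform a z *s b))" for z
  proof -
    have "p z = p (z - cform a z *s b) + cform a z * q z" using q(2)[of z] by (simp add: algebra_simps)
    then show ?thesis by (simp add: algebra_simps)
  qed
  then show ?case using q p'
    by (intro bexI[of _ "\<lambda>z. z $ i * q z + b $ i * p (z - cform a z *s b)"]) auto
qed

subsection \<open>Points off finitely many hyperplanes\<close>

text \<open>A line through a point that avoids the old hyperplanes, in a direction transversal to the new one,
  meets each hyperplane at most once.\<close>

lemma finite_hyperplanes_avoid:
  fixes T :: "'n::finite cspace set"
  assumes "finite T" "0 \<notin> T"
  shows "\<exists>v. \<forall>a\<in>T. cform a v \<noteq> 0"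
  using assms
proof (induction T rule: finite_induct)
  case empty
  then show ?case by simp
next
  case (insert a T)
  then obtain v where v: "\<forall>b\<in>T. cform b v \<noteq> 0" by auto
  obtain w where w: "cform a w \<noteq> 0" using insert.prems cform_nondeg by (metis insertI1)
  have "finite {t. \<exists>b\<in>insert a T. cform b v + t * cform b w = 0 \<and> (cform b w \<noteq> 0 \<or> cform b v \<noteq> 0)}"
    (is "finite ?B")
  proof -
    have "?B \<subseteq> (\<lambda>b. - cform b v / cform b w) ` insert a T"
    proof
      fix t assume "t \<in> ?B"
      then obtain b where b: "b \<in> insert a T" "cform b v + t * cform b w = 0"
        "cform b w \<noteq> 0 \<or> cform b v \<noteq> 0" by auto
      then have "cform b w \<noteq> 0" by auto
      then have "t = - cform b v / cform b w" using b(2)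
        by (simp add: field_simps add_eq_0_iff)
      then show "t \<in> (\<lambda>b. - cform b v / cform b w) ` insert a T" using b(1) by blast
    qed
    then show ?thesis using insert.hyps by (meson finite_imageI finite_insert finite_subset)
  qed
  then obtain t :: complex where "t \<notin> ?B"
    using infinite_UNIV_char_0 ex_new_if_finite by blast
  then show ?case using v w
    by (intro exI[of _ "v + t *s w"]) (auto simp: cform_linear)
qed

lemma hyperplanes_complement_closure:
  fixes T :: "'n::finite cspace set"
  assumes "finite T" "0 \<notin> T"
  shows "closure {z. \<forall>a\<in>T. cform a z \<noteq> 0} = UNIV"
proof -
  obtain v where v: "\<forall>a\<in>T. cform a v \<noteq> 0" using finite_hyperplanes_avoid[OF assms] by blast
  have "z \<in> closure {z. \<forall>a\<in>T. cform a z \<noteq> 0}" for z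
  proof -
    have "finite ((\<lambda>a. - cform a z / cform a v) ` T)" using assms by auto
    then obtain e where e: "e > 0" "\<forall>t\<in>((\<lambda>a. - cform a z / cform a v) ` T). t \<noteq> 0 \<longrightarrow> e \<le> dist 0 t"
      using finite_set_avoid[of _ 0] by meson
    \<comment> \<open>The parameters are positive and smaller than \<open>e\<close>, hence avoid all bad values.\<close>
    define t where "t n = complex_of_real (e / (n + 2))" for n :: nat
    have "z + t n *s v \<in> {z. \<forall>a\<in>T. cform a z \<noteq> 0}" for n
    proof (clarsimp simp: cform_linear)
      fix a assume a: "a \<in> T" "cform a z + t n * cform a v = 0"
      have "t n = - cform a z / cform a v"
        using a v by (simp add: field_simps add_eq_0_iff)
      moreover have "t n \<noteq> 0" using e by (simp add: t_def add_eq_0_iff_both_eq_0 del: of_real_divide)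
      ultimately have "e \<le> dist 0 (t n)" using e a by auto
      then have "e \<le> e / (n + 2)" using e by (simp add: t_def norm_divide del: of_real_divide)
      then have "e * (real n + 1) \<le> 0" by (simp add: field_simps)
      then show False using e(1) by (simp add: mult_le_0_iff)
    qed
    moreover have "(\<lambda>n. z + t n *s v) \<longlonglongrightarrow> z"
    proof -
      have "(\<lambda>n. e / (real n + 2)) \<longlonglongrightarrow> 0" 
        by real_asymp
      then have "t \<longlonglongrightarrow> of_real 0" unfolding t_def by (intro tendsto_of_real) (simp add: add.commute)
      then have "(\<lambda>n. \<chi> i. z $ i + t n * v $ i) \<longlonglongrightarrow> (\<chi> i. z $ i + 0 * v $ i)"
        by (intro tendsto_intros) auto
      moreover have "(\<lambda>n. \<chi> i. z $ i + t n * v $ i) = (\<lambda>n. z + t n *s v)"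
        by (auto simp: vec_eq_iff)
      moreover have "(\<chi> i. z $ i + 0 * v $ i) = z" by (auto simp: vec_eq_iff)
      ultimately show ?thesis by simp
    qed
    ultimately show ?thesis unfolding closure_sequential by (intro exI[of _ "\<lambda>n. z + t n *s v"]) auto
  qed
  then show ?thesis by auto
qed

lemma eq_off_hyperplanes:
  fixes f g :: "'n::finite cspace \<Rightarrow> complex"
  assumes "finite T" "0 \<notin> T" "continuous_on UNIV f" "continuous_on UNIV g"
    and "\<And>z. (\<And>a. a \<in> T \<Longrightarrow> cform a z \<noteq> 0) \<Longrightarrow> f z = g z"
  shows "f = g"
proof
  fix z
  have "f z - g z = 0"
    using continuous_constant_on_closure[of "{z. \<forall>a\<in>T. cform a z \<noteq> 0}" "\<lambda>z. f z - g z" 0 z]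
      hyperplanes_complement_closure[OF assms(1,2)] assms(3-5)
    by (auto intro!: continuous_intros)
  then show "f z = g z" by simp
qed

subsection \<open>Homogeneous polynomials\<close>

text \<open>
  Degrees are integers, so that division by linear forms lowers the degree without case
  distinctions; in negative degrees there is only the zero polynomial.
\<close>

definition homp :: "int \<Rightarrow> ('n::finite cspace \<Rightarrow> complex) set" where
  "homp d = {p \<in> polys. \<forall>c z. c \<noteq> 0 \<longrightarrow> p (c *s z) = c powi d * p z}"

lemma homp_polys: "p \<in> homp d \<Longrightarrow> p \<in> polys"
  by (simp add: homp_def)

lemma homp_zero [intro]: "(\<lambda>z. 0) \<in> homp d"
  by (auto simp: homp_def)

lemma homp_add [intro]: "p \<in> homp d \<Longrightarrow> q \<in> homp d \<Longrightarrow> (\<lambda>z. p z + q z) \<in> homp d"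
  by (auto simp: homp_def algebra_simps)

lemma homp_scale [intro]: "p \<in> homp d \<Longrightarrow> (\<lambda>z. a * p z) \<in> homp d"
  by (auto simp: homp_def)

lemma homp_sum [intro]: "(\<And>i. i \<in> I \<Longrightarrow> f i \<in> homp d) \<Longrightarrow> (\<lambda>z. \<Sum>i\<in>I. f i z) \<in> homp d"
  by (induction I rule: infinite_finite_induct) auto

lemma homp_mult: "p \<in> homp d \<Longrightarrow> q \<in> homp e \<Longrightarrow> (\<lambda>z. p z * q z) \<in> homp (d + e)"
  by (auto simp: homp_def power_int_add algebra_simps)

lemma homp_const [intro]: "(\<lambda>z. c) \<in> homp 0"
  by (auto simp: homp_def)

lemma homp_cform [intro]: "(\<lambda>z. cform a z) \<in> homp 1"
  by (auto simp: homp_def cform_linear)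

lemma homp_coord [intro]: "(\<lambda>z. z $ i) \<in> homp 1"
  by (auto simp: homp_def)

lemma homp_power: "p \<in> homp d \<Longrightarrow> (\<lambda>z. p z ^ n) \<in> homp (int n * d)"
  using homp_mult[of p d "\<lambda>z. p z ^ k" "int k * d" for k]
  by (induction n) (auto simp: ring_distribs)

lemma homp_prod:
  assumes "finite I" "\<And>i. i \<in> I \<Longrightarrow> f i \<in> homp (d i)"
  shows "(\<lambda>z. \<Prod>i\<in>I. f i z) \<in> homp (\<Sum>i\<in>I. d i)"
  using assms by (induction I rule: finite_induct) (auto intro: homp_mult)

lemma homp_matrix: "p \<in> homp d \<Longrightarrow> (\<lambda>z. p (M *v z)) \<in> homp d"
  by (auto simp: homp_def polys_matrix vector_scalar_commute)

lemma homp_limit_at_0: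
  fixes p :: "'n::finite cspace \<Rightarrow> complex"
  assumes "p \<in> polys"
  shows "((\<lambda>c. p (c *s z)) \<longlongrightarrow> p 0) (at 0)"
proof -
  have "continuous_on UNIV (\<lambda>c. p (\<chi> i. c * z $ i))"
    by (rule continuous_on_compose2[OF polys_continuous[OF assms, of UNIV]])
       (auto intro!: continuous_intros)
  then have "((\<lambda>c. p (\<chi> i. c * z $ i)) \<longlongrightarrow> p (\<chi> i. 0 * z $ i)) (at 0)"
    by (metis UNIV_I continuous_on_def)
  moreover have "(\<chi> i. 0 * z $ i) = (0 :: 'n cspace)" by (simp add: vec_eq_iff)
  ultimately show ?thesis by (simp add: vector_scalar_mult_def)
qed

text \<open>Let \<open>c\<close> tend to \<open>0\<close> in \<open>p z = c powi (-d) * p (c *s z)\<close>.\<close>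

lemma homp_neg:
  assumes "p \<in> homp d" "d < 0"
  shows "p z = 0"
proof -
  have "((\<lambda>c. c ^ nat (-d) * p (c *s z)) \<longlongrightarrow> 0 ^ nat (-d) * p 0) (at 0)"
    by (intro tendsto_intros homp_limit_at_0 homp_polys[OF assms(1)])
  moreover have "\<forall>\<^sub>F c in at 0. c ^ nat (-d) * p (c *s z) = p z"
    using assms unfolding eventually_at_filter
    by (intro always_eventually) (auto simp: homp_def power_int_def field_simps)
  ultimately have "((\<lambda>c::complex. p z) \<longlongrightarrow> 0) (at 0)"
    using assms(2) Lim_transform_eventually[of _ "0 ^ nat (- d) * p 0" "at 0" "\<lambda>c. p z"]
    by (simp add: zero_power)
  then show ?thesis by (simp add: tendsto_const_iff)
qed

lemma homp_0_const:
  assumes "p \<in> homp 0"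
  shows "p z = p 0"
proof -
  have "((\<lambda>c. p (c *s z)) \<longlongrightarrow> p 0) (at 0)"
    by (intro homp_limit_at_0 homp_polys[OF assms(1)])
  moreover have "\<forall>\<^sub>F c in at 0. p (c *s z) = p z"
    using assms unfolding eventually_at_filter
    by (intro always_eventually) (auto simp: homp_def)
  ultimately have "((\<lambda>c::complex. p z) \<longlongrightarrow> p 0) (at 0)"
    by (auto intro: Lim_transform_eventually)
  then show ?thesis by (simp add: tendsto_const_iff)
qed

lemma polys_homp_sum:
  assumes "p \<in> polys"
  shows "\<exists>N h. (\<forall>e. h e \<in> homp (int e)) \<and> p = (\<lambda>z. \<Sum>e<N::nat. h e z)"
  using assms
proof (induction rule: polys_induct)
  case (const c)
  show ?case
    by (intro exI[of _ 1] exI[of _ "\<lambda>e z. if e = 0 then c else 0"]) auto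
next
  case (add p q)
  then obtain N h M g where
    h: "\<forall>e. h e \<in> homp (int e)" "p = (\<lambda>z. \<Sum>e<N::nat. h e z)" and
    g: "\<forall>e. g e \<in> homp (int e)" "q = (\<lambda>z. \<Sum>e<M::nat. g e z)" by blast
  let ?f = "\<lambda>e z. (if e < N then h e z else 0) + (if e < M then g e z else 0)"
  have "?f e \<in> homp (int e)" for e using h g by (cases "e < N"; cases "e < M") auto
  moreover have "p z + q z = (\<Sum>e < max N M. ?f e z)" for z
  proof -
    have "(\<Sum>e < max N M. if e < N then h e z else 0) = (\<Sum>e < N. h e z)"
      by (intro sum.mono_neutral_cong_right) auto
    moreover have "(\<Sum>e < max N M. if e < M then g e z else 0) = (\<Sum>e < M. g e z)"
      by (intro sum.mono_neutral_cong_right) auto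
    ultimately show ?thesis using h g by (simp add: sum.distrib)
  qed
  ultimately show ?case by (intro exI[of _ "max N M"] exI[of _ ?f]) auto
next
  case (coord i p)
  then obtain N h where
    h: "\<forall>e. h e \<in> homp (int e)" "p = (\<lambda>z. \<Sum>e<N::nat. h e z)" by blast
  let ?f = "\<lambda>e z. case e of 0 \<Rightarrow> 0 | Suc e \<Rightarrow> z $ i * h e z"
  have "?f e \<in> homp (int e)" for e
    using homp_mult[OF homp_coord[of i]] h by (cases e) auto
  moreover have "z $ i * p z = (\<Sum>e < Suc N. ?f e z)" for z
    using h by (subst sum.lessThan_Suc_shift) (simp add: sum_distrib_left)
  ultimately show ?case by (intro exI[of _ "Suc N"] exI[of _ ?f]) auto
qed

text \<open>Scaling \<open>z\<close> by \<open>2\<close> multiplies the coefficient at \<open>k\<close> by \<open>2\<close> to the power \<open>\<bar>k\<bar>\<close>.\<close>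

lemma homp_coeffs_degree:
  assumes "q \<in> homp d" "poly_coeffs q k \<noteq> 0"
  shows "int (\<Sum>i\<in>UNIV. k i) = d"
proof -
  let ?c = "poly_coeffs q"
  have c: "has_coeffs q ?c" using assms(1) homp_polys has_coeffs_poly_coeffs by auto
  have mon: "monomial k (2 *s z) = 2 ^ (\<Sum>i\<in>UNIV. k i) * monomial k z" for k and z :: "'a cspace"
    by (simp add: monomial_def power_mult_distrib prod.distrib power_sum)
  have fin: "finite {k. ?c k \<noteq> 0}" using c by (simp add: has_coeffs_def)
  have "has_coeffs (\<lambda>z. q (2 *s z)) (\<lambda>k. 2 ^ (\<Sum>i\<in>UNIV. k i) * ?c k)"
    using c fin by (intro has_coeffsI[OF fin])
      (auto simp: has_coeffs_supset[OF c fin] mon intro!: sum.cong)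
  moreover have "(\<lambda>z. q (2 *s z)) = (\<lambda>z. 2 powi d * q z)" using assms(1) by (auto simp: homp_def)
  moreover have "has_coeffs (\<lambda>z. 2 powi d * q z) (\<lambda>k. 2 powi d * ?c k)"
    by (rule has_coeffs_scale[OF c])
  ultimately have "(\<lambda>k. 2 ^ (\<Sum>i\<in>UNIV. k i) * ?c k) = (\<lambda>k. 2 powi d * ?c k)"
    using has_coeffs_unique by metis
  then have "(2::complex) ^ (\<Sum>i\<in>UNIV. k i) = 2 powi d" using assms(2) by (auto dest: fun_cong[of _ _ k])
  then have "norm ((2::complex) ^ (\<Sum>i\<in>UNIV. k i)) = norm ((2::complex) powi d)" by simp
  then have "(2::real) powi int (\<Sum>i\<in>UNIV. k i) = 2 powi d" by (simp add: norm_power norm_power_int del: of_nat_sum)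
  then show ?thesis
    by (metis linorder_neqE_linordered_idom one_less_numeral_iff order_less_irrefl power_int_strict_increasing semiring_norm(76))
qed

lemma homp_divided_difference:
  assumes "p \<in> homp d" "a \<noteq> 0"
  shows "\<exists>q\<in>homp (d - 1). \<forall>z. p z - p (z - cform a z *s b) = cform a z * q z"
proof -
  obtain q where q: "q \<in> polys" "\<And>z. p z - p (z - cform a z *s b) = cform a z * q z"
    using polys_divided_difference[OF homp_polys[OF assms(1)]] by metis
  have "(\<lambda>z. q (c *s z)) = (\<lambda>z. c powi (d - 1) * q z)" if c: "c \<noteq> 0" for c
  proof (rule eq_off_hyperplanes[of "{a}"])
    have "(\<lambda>z. q (c *s z)) \<in> polys" by (rule polys_compose[OF q(1)]) (auto intro: polys_scale)
    then show "continuous_on UNIV (\<lambda>z. q (c *s z))" by (rule polys_continuous)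
    show "continuous_on UNIV (\<lambda>z. c powi (d - 1) * q z)" by (intro continuous_intros polys_continuous q)
    fix z assume "\<And>a'. a' \<in> {a} \<Longrightarrow> cform a' z \<noteq> 0"
    then have az: "cform a z \<noteq> 0" by auto
    have "c *s z - cform a (c *s z) *s b = c *s (z - cform a z *s b)"
      by (simp add: vec_eq_iff cform_linear algebra_simps)
    then have "c * cform a z * q (c *s z) = p (c *s z) - p (c *s (z - cform a z *s b))"
      using q(2)[of "c *s z"] by (simp add: cform_linear)
    also have "\<dots> = c powi d * (p z - p (z - cform a z *s b))"
    proof -
      have "p (c *s w) = c powi d * p w" for w using assms(1) c by (simp add: homp_def)
      then show ?thesis by (simp only: right_diff_distrib)
    qed
    also have "\<dots> = c powi d * (cform a z * q z)" by (simp only: q(2))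
    also have "\<dots> = c * cform a z * (c powi (d - 1) * q z)"
      using c by (simp add: power_int_diff field_simps)
    finally show "q (c *s z) = c powi (d - 1) * q z" using c az by simp
  qed (use assms in auto)
  then show ?thesis using q unfolding homp_def by (auto dest: fun_cong)
qed

definition pdeg :: "nat \<Rightarrow> ('n::finite cspace \<Rightarrow> complex) set" where
  "pdeg N = {p. \<exists>h. (\<forall>e. h e \<in> homp (int e)) \<and> p = (\<lambda>z. \<Sum>e<N. h e z)}"

lemma pdeg_zero: "(\<lambda>z. 0) \<in> pdeg N"
  unfolding pdeg_def by (auto intro!: exI[of _ "\<lambda>e z. 0"])

lemma pdeg_add: "p \<in> pdeg N \<Longrightarrow> q \<in> pdeg N \<Longrightarrow> (\<lambda>z. p z + q z) \<in> pdeg N"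
proof -
  assume "p \<in> pdeg N" "q \<in> pdeg N"
  then obtain h g where "\<forall>e. h e \<in> homp (int e)" "p = (\<lambda>z. \<Sum>e<N. h e z)"
    "\<forall>e. g e \<in> homp (int e)" "q = (\<lambda>z. \<Sum>e<N. g e z)" by (auto simp: pdeg_def)
  then show ?thesis unfolding pdeg_def
    by (auto intro!: exI[of _ "\<lambda>e z. h e z + g e z"] simp: sum.distrib)
qed

lemma pdeg_homp:
  assumes "p \<in> homp d" "d < int N"
  shows "p \<in> pdeg N"
proof (cases "d < 0")
  case True
  then have "p = (\<lambda>z. 0)" using homp_neg[OF assms(1)] by auto
  then show ?thesis by (simp add: pdeg_zero)
next
  case False
  define h where "h e = (if int e = d then p else (\<lambda>z. 0))" for e
  have "(\<Sum>e<N. h e z) = p z" for z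
  proof -
    have "(\<Sum>e<N. h e z) = (\<Sum>e<N. if e = nat d then p z else 0)"
      using False by (intro sum.cong) (auto simp: h_def)
    then show ?thesis using False assms(2) by auto
  qed
  then show ?thesis unfolding pdeg_def using assms(1)
    by (auto intro!: exI[of _ h] simp: h_def)
qed

lemma pdeg_polys: "p \<in> pdeg N \<Longrightarrow> p \<in> polys"
  unfolding pdeg_def using homp_polys by (auto intro!: polys_sum)

lemma polys_has_derivative:
  assumes "p \<in> polys"
  shows "\<exists>D. (p has_derivative D) (at x) \<and> (\<forall>c v. D (c *s v) = c * D v)"
  using assms
proof (induction rule: polys_induct)
  case (const c)
  then show ?case by (intro exI[of _ "\<lambda>v. 0"]) auto
next
  case (add p q)
  then obtain D D' where "(p has_derivative D) (at x)" "\<forall>c v. D (c *s v) = c * D v"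
    "(q has_derivative D') (at x)" "\<forall>c v. D' (c *s v) = c * D' v" by blast
  then show ?case
    by (intro exI[of _ "\<lambda>v. D v + D' v"] conjI has_derivative_add) (simp_all add: distrib_left)
next
  case (coord i p)
  then obtain D where D: "(p has_derivative D) (at x)" "\<forall>c v. D (c *s v) = c * D v" by blast
  have "((\<lambda>z. z $ i * p z) has_derivative (\<lambda>v. x $ i * D v + v $ i * p x)) (at x)"
    by (intro has_derivative_mult D bounded_linear.has_derivative[OF bounded_linear_vec_nth] has_derivative_ident)
  then show ?case using D by (intro exI[of _ "\<lambda>v. x $ i * D v + v $ i * p x"]) (auto simp: algebra_simps)
qed

subsection \<open>The polynomial ring and the ideal of a point\<close>

lemma cring_poly_alg: "cring (poly_alg :: ('n::finite cspace \<Rightarrow> complex) ring)"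
proof (rule cringI)
  show "abelian_group (poly_alg :: ('n cspace \<Rightarrow> complex) ring)"
  proof (rule abelian_groupI)
    fix x :: "'n cspace \<Rightarrow> complex" assume "x \<in> carrier poly_alg"
    then show "\<exists>y\<in>carrier poly_alg. y \<oplus>\<^bsub>poly_alg\<^esub> x = \<zero>\<^bsub>poly_alg\<^esub>"
      by (intro bexI[of _ "\<lambda>z. - x z"]) (auto simp: poly_alg_def)
  qed (auto simp: poly_alg_def algebra_simps)
  show "comm_monoid (poly_alg :: ('n cspace \<Rightarrow> complex) ring)"
    by (rule comm_monoidI) (auto simp: poly_alg_def algebra_simps)
qed (auto simp: poly_alg_def algebra_simps)

lemma ring_poly_alg: "ring (poly_alg :: ('n::finite cspace \<Rightarrow> complex) ring)"
  using cring_poly_alg by (rule cring.axioms)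

lemma carrier_poly_alg [simp]: "carrier poly_alg = polys"
  and mult_poly_alg [simp]: "p \<otimes>\<^bsub>poly_alg\<^esub> q = (\<lambda>z. p z * q z)"
  and add_poly_alg [simp]: "p \<oplus>\<^bsub>poly_alg\<^esub> q = (\<lambda>z. p z + q z)"
  and zero_poly_alg [simp]: "\<zero>\<^bsub>poly_alg\<^esub> = (\<lambda>z. 0)"
  and one_poly_alg [simp]: "\<one>\<^bsub>poly_alg\<^esub> = (\<lambda>z. 1)"
  by (simp_all add: poly_alg_def)

lemma ideal_poly_algI:
  assumes "I \<subseteq> polys" "(\<lambda>z. 0) \<in> I" "\<And>p q. p \<in> I \<Longrightarrow> q \<in> I \<Longrightarrow> (\<lambda>z. p z + q z) \<in> I"
    and mult: "\<And>p q. p \<in> I \<Longrightarrow> q \<in> polys \<Longrightarrow> (\<lambda>z. q z * p z) \<in> I"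
  shows "ideal I (poly_alg :: ('n::finite cspace \<Rightarrow> complex) ring)"
proof (rule idealI[OF ring_poly_alg])
  have inv: "(\<lambda>z. - p z) \<in> I" if "p \<in> I" for p
    using mult[OF that polys_const[of "-1"]] by simp
  interpret R: cring "poly_alg :: ('n cspace \<Rightarrow> complex) ring" by (rule cring_poly_alg)
  have ainv: "\<ominus>\<^bsub>poly_alg\<^esub> p = (\<lambda>z. - p z)" if "p \<in> I" for p
    using that assms(1) R.minus_equality[of "\<lambda>z. - p z" p] by auto
  show "subgroup I (add_monoid poly_alg)"
  proof (rule subgroup.intro)
    show "inv\<^bsub>add_monoid poly_alg\<^esub> x \<in> I" if "x \<in> I" for x
      using ainv[OF that] inv[OF that] unfolding a_inv_def by metis
  qed (use assms in auto)
qed (use mult in \<open>auto simp: mult.commute\<close>)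

lemma ideal_at_ideal: "ideal (ideal_at G l) poly_alg"
  unfolding ideal_at_def
  by (rule ring.genideal_ideal[OF ring_poly_alg]) (auto simp: inv_polys_def)

lemma ideal_at_polys: "p \<in> ideal_at G l \<Longrightarrow> p \<in> polys"
  using additive_subgroup.a_subset[OF ideal.axioms(1)[OF ideal_at_ideal]] by auto

lemma ideal_at_zero: "(\<lambda>z. 0) \<in> ideal_at G l"
  using additive_subgroup.zero_closed[OF ideal.axioms(1)[OF ideal_at_ideal]] by simp

lemma ideal_at_add: "p \<in> ideal_at G l \<Longrightarrow> q \<in> ideal_at G l \<Longrightarrow> (\<lambda>z. p z + q z) \<in> ideal_at G l"
  using additive_subgroup.a_closed[OF ideal.axioms(1)[OF ideal_at_ideal]] by simp

lemma ideal_at_generator: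
  assumes "f \<in> inv_polys G" "h \<in> polys"
  shows "(\<lambda>z. (f z - f l) * h z) \<in> ideal_at G l"
proof -
  have *: "(\<lambda>z. f z - f l) \<in> {p \<in> inv_polys G. p l = 0}"
    using assms(1) by (auto simp: inv_polys_def act_def fun_eq_iff)
  have "(\<lambda>z. f z - f l) \<in> ideal_at G l"
    unfolding ideal_at_def
    by (rule subsetD[OF ring.genideal_self[OF ring_poly_alg] *]) (auto simp: inv_polys_def)
  then show ?thesis using ideal.I_r_closed[OF ideal_at_ideal, of "\<lambda>z. f z - f l" G l h] assms(2) by simp
qed

lemma ideal_at_subset:
  assumes "ideal I poly_alg" "\<And>f. f \<in> inv_polys G \<Longrightarrow> f l = 0 \<Longrightarrow> f \<in> I"
  shows "ideal_at G l \<subseteq> I"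
  unfolding ideal_at_def by (rule ring.genideal_minimal[OF ring_poly_alg assms(1)]) (use assms(2) in auto)

section \<open>Finite reflection groups\<close>

(* The group acts by matrices from the left, so transposes are not to become row vector products. *)
declare transpose_matrix_vector [simp del]

lemma cmat_mult: "cmat (g ** h) = cmat g ** cmat h"
  by (simp add: cmat_def matrix_matrix_mult_def vec_eq_iff)

lemma cmat_one [simp]: "cmat (mat 1) = mat 1"
  by (simp add: cmat_def mat_def vec_eq_iff)

lemma cmat_transpose: "cmat (transpose g) = transpose (cmat g)"
  by (simp add: cmat_def transpose_def)

lemma cmat_cvec: "cmat g *v cvec a = cvec (g *v a)"
  by (simp add: cmat_def cvec_def matrix_vector_mult_def vec_eq_iff)

lemma cvec_scaleR: "cvec (c *\<^sub>R a) = complex_of_real c *s cvec a"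
  by (simp add: cvec_def vec_eq_iff)

lemma cvec_eq_0_iff [simp]: "cvec a = 0 \<longleftrightarrow> a = 0"
  by (simp add: cvec_def vec_eq_iff)

lemma cform_transpose: "cform (M *v x) y = cform x (transpose M *v y)"
proof -
  have "cform (M *v x) y = (\<Sum>i\<in>UNIV. \<Sum>j\<in>UNIV. M $ i $ j * x $ j * y $ i)"
    by (simp add: cform_def matrix_vector_mult_def sum_distrib_right)
  also have "\<dots> = (\<Sum>j\<in>UNIV. \<Sum>i\<in>UNIV. M $ i $ j * x $ j * y $ i)"
    by (rule sum.swap)
  also have "\<dots> = cform x (transpose M *v y)"
    by (simp add: cform_def matrix_vector_mult_def transpose_def sum_distrib_left algebra_simps)
  finally show ?thesis .
qed

lemma matrix_inv_orthogonal:
  fixes g :: "real ^ 'n::finite ^ 'n"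
  assumes "orthogonal_matrix g"
  shows "matrix_inv g = transpose g"
proof -
  have "\<exists>h. g ** h = mat 1 \<and> h ** g = mat 1" using assms by (auto simp: orthogonal_matrix_def)
  then have "matrix_inv g ** g = mat 1" unfolding matrix_inv_def by (rule someI2_ex) simp
  then have "matrix_inv g ** (g ** transpose g) = transpose g"
    by (simp add: matrix_mul_assoc)
  then show ?thesis using assms by (simp add: orthogonal_matrix_def)
qed

lemma cform_orthogonal:
  assumes "orthogonal_matrix g"
  shows "cform (cmat g *v x) (cmat g *v y) = cform x y"
proof -
  have "cform (cmat g *v x) (cmat g *v y) = cform x (cmat (transpose g ** g) *v y)"
    by (simp add: cform_transpose cmat_transpose cmat_mult matrix_vector_mul_assoc)
  then show ?thesis using assms by (simp add: orthogonal_matrix_def)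
qed

lemma refl_mat_apply: "refl_mat a *v x = x - (2 * (a \<bullet> x) / (a \<bullet> a)) *\<^sub>R a"
proof -
  have "linear (\<lambda>x. x - (2 * (a \<bullet> x) / (a \<bullet> a)) *\<^sub>R a)"
    by (rule linearI) (auto simp: algebra_simps inner_right_distrib add_divide_distrib)
  then show ?thesis unfolding refl_mat_def by (simp add: matrix_works)
qed

lemma cmat_refl_mat_apply:
  "cmat (refl_mat a) *v z = z - (2 * cform (cvec a) z / of_real (a \<bullet> a)) *s cvec a"
proof (rule vec_eq_iff[THEN iffD2, rule_format])
  fix i
  have "refl_mat a $ i $ j = (if j = i then 1 else 0) - 2 * a $ j / (a \<bullet> a) * a $ i" for j
  proof -
    have "refl_mat a $ i $ j = (refl_mat a *v axis j 1) $ i"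
      by (simp add: matrix_vector_mul_component inner_axis)
    then show ?thesis unfolding refl_mat_apply by (simp add: inner_axis) (simp add: axis_def)
  qed
  then have "(cmat (refl_mat a) *v z) $ i
      = (\<Sum>j\<in>UNIV. of_real ((if j = i then 1 else 0) - 2 * a $ j / (a \<bullet> a) * a $ i) * z $ j)"
    by (simp add: matrix_vector_mult_def cmat_def)
  also have "\<dots> = (\<Sum>j\<in>UNIV. (if j = i then z $ j else 0)
      - 2 / of_real (a \<bullet> a) * of_real (a $ i) * (of_real (a $ j) * z $ j))"
    by (intro sum.cong) (auto simp: algebra_simps)
  also have "\<dots> = z $ i - 2 / of_real (a \<bullet> a) * of_real (a $ i) * cform (cvec a) z"
    by (simp add: sum_subtractf cform_def cvec_def sum_distrib_left)
  finally show "(cmat (refl_mat a) *v z) $ i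
      = (z - (2 * cform (cvec a) z / of_real (a \<bullet> a)) *s cvec a) $ i"
    by (simp add: cvec_def)
qed

lemma cmat_refl_mat_apply':
  "cmat (refl_mat a) *v z = z - cform (cvec a) z *s ((2 / of_real (a \<bullet> a)) *s cvec a)"
  by (simp add: cmat_refl_mat_apply vec_eq_iff)

lemma refl_mat_scaleR:
  assumes "c \<noteq> 0"
  shows "refl_mat (c *\<^sub>R a) = refl_mat a"
  by (rule matrix_eq[THEN iffD2]) (use assms in \<open>auto simp: refl_mat_apply field_simps\<close>)

text \<open>A reflection determines its normal line: it is the eigenspace for \<open>-1\<close>.\<close>

lemma refl_mat_eqD:
  assumes "refl_mat a = refl_mat b" "a \<noteq> 0" "b \<noteq> 0"
  shows "\<exists>c. c \<noteq> 0 \<and> a = c *\<^sub>R b"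
proof -
  have "refl_mat b *v a = refl_mat a *v a" using assms by simp
  also have "\<dots> = - a" unfolding refl_mat_apply using assms by (simp add: scaleR_2)
  finally have "a - (2 * (b \<bullet> a) / (b \<bullet> b)) *\<^sub>R b = - a" by (simp add: refl_mat_apply)
  then have "2 *\<^sub>R a = (2 * (b \<bullet> a) / (b \<bullet> b)) *\<^sub>R b" by (simp add: algebra_simps scaleR_2)
  then have "(1/2) *\<^sub>R 2 *\<^sub>R a = (1/2) *\<^sub>R (2 * (b \<bullet> a) / (b \<bullet> b)) *\<^sub>R b" by simp
  then have "a = ((b \<bullet> a) / (b \<bullet> b)) *\<^sub>R b" by simp
  with assms(2) show ?thesis by (metis scaleR_zero_left)
qed

lemma refl_mat_conj:
  assumes "orthogonal_matrix g"
  shows "refl_mat (g *v a) = g ** refl_mat a ** transpose g"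
proof (rule matrix_eq[THEN iffD2], rule allI)
  fix x
  have 1: "g *v (transpose g *v x) = x" using assms
    by (simp add: matrix_vector_mul_assoc orthogonal_matrix_def)
  have 3: "(g *v y) \<bullet> x = y \<bullet> (transpose g *v x)" for y x
    using dot_lmul_matrix[of y "transpose g" x] transpose_matrix_vector[of "transpose g" y] by simp
  have 2: "(g *v a) \<bullet> (g *v a) = a \<bullet> a"
    using assms by (simp add: 3 matrix_vector_mul_assoc orthogonal_matrix_def)
  have "(g ** refl_mat a ** transpose g) *v x = g *v (refl_mat a *v (transpose g *v x))"
    by (simp add: matrix_vector_mul_assoc matrix_mul_assoc)
  also have "\<dots> = x - (2 * (a \<bullet> (transpose g *v x)) / (a \<bullet> a)) *\<^sub>R (g *v a)"
    unfolding refl_mat_apply matrix_vector_mult_diff_distrib 1 matrix_vector_mult_scaleR ..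
  finally show "refl_mat (g *v a) *v x = (g ** refl_mat a ** transpose g) *v x"
    by (simp only: refl_mat_apply[of "g *v a"] 2 3[of a x])
qed

lemma orthogonal_refl_mat: "orthogonal_matrix (refl_mat a :: real ^ 'n::finite ^ 'n)"
proof -
  have "orthogonal_transformation ((*v) (refl_mat a))"
    unfolding orthogonal_transformation_def
  proof (intro conjI allI)
    show "linear ((*v) (refl_mat a))" by simp
    show "(refl_mat a *v v) \<bullet> (refl_mat a *v w) = v \<bullet> w" for v w
    proof (cases "a = 0")
      case False
      define c where "c = 2 / (a \<bullet> a)"
      have c: "c * (a \<bullet> a) = 2" using False by (simp add: c_def)
      have "(refl_mat a *v v) \<bullet> (refl_mat a *v w)
          = (v - (c * (a \<bullet> v)) *\<^sub>R a) \<bullet> (w - (c * (a \<bullet> w)) *\<^sub>R a)"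
        by (simp add: refl_mat_apply c_def)
      also have "\<dots> = v \<bullet> w - 2 * c * (a \<bullet> v) * (a \<bullet> w) + (c * (a \<bullet> a)) * c * (a \<bullet> v) * (a \<bullet> w)"
        by (simp add: inner_diff_left inner_diff_right inner_commute[of v a] algebra_simps)
      finally show ?thesis by (simp add: c)
    qed (simp add: refl_mat_apply)
  qed
  then show ?thesis by (simp add: orthogonal_transformation_matrix)
qed

lemma refl_mat_involution: "refl_mat a ** refl_mat a = (mat 1 :: real ^ 'n::finite ^ 'n)"
proof (rule matrix_eq[THEN iffD2], rule allI)
  fix x :: "real ^ 'n"
  show "(refl_mat a ** refl_mat a) *v x = mat 1 *v x"
  proof (cases "a = 0")
    case False
    then have "a \<bullet> (refl_mat a *v x) = - (a \<bullet> x)"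
      by (simp add: refl_mat_apply inner_diff_right)
    then have "refl_mat a *v (refl_mat a *v x) = x"
      by (subst refl_mat_apply) (simp add: refl_mat_apply)
    then show ?thesis by (simp add: matrix_vector_mul_assoc)
  qed (simp add: refl_mat_apply matrix_vector_mul_assoc[symmetric])
qed

lemma group_orth_group: "group (orth_group :: (real ^ 'n::finite ^ 'n) monoid)"
proof (rule groupI)
  fix x y z :: "real ^ 'n ^ 'n"
  show "x \<in> carrier orth_group \<Longrightarrow> y \<in> carrier orth_group \<Longrightarrow> x \<otimes>\<^bsub>orth_group\<^esub> y \<in> carrier orth_group"
    by (simp add: orth_group_def orthogonal_matrix_mul)
  show "\<one>\<^bsub>orth_group\<^esub> \<in> carrier (orth_group :: (real ^ 'n ^ 'n) monoid)"
    by (simp add: orth_group_def orthogonal_matrix_id)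
  show "x \<otimes>\<^bsub>orth_group\<^esub> y \<otimes>\<^bsub>orth_group\<^esub> z = x \<otimes>\<^bsub>orth_group\<^esub> (y \<otimes>\<^bsub>orth_group\<^esub> z)"
    by (simp add: orth_group_def matrix_mul_assoc)
  show "\<one>\<^bsub>orth_group\<^esub> \<otimes>\<^bsub>orth_group\<^esub> x = x"
    by (simp add: orth_group_def)
  show "x \<in> carrier orth_group \<Longrightarrow> \<exists>y\<in>carrier orth_group. y \<otimes>\<^bsub>orth_group\<^esub> x = \<one>\<^bsub>orth_group\<^esub>"
    by (intro bexI[of _ "transpose x"]) (auto simp: orth_group_def orthogonal_matrix_def)
qed

lemma orth_group_inv:
  assumes "orthogonal_matrix g"
  shows "inv\<^bsub>orth_group\<^esub> g = transpose g"
  using assms by (intro group.inv_equality[OF group_orth_group]) (auto simp: orth_group_def orthogonal_matrix_def)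

locale refl_group =
  fixes G :: "(real ^ 'n::finite ^ 'n) set"
    and A :: "(real ^ 'n) set"
    and m :: "real ^ 'n \<Rightarrow> nat"
    and \<epsilon> :: "real ^ 'n ^ 'n \<Rightarrow> int"
  assumes reflection_group: "finite_reflection_group G"
    and normal: "normal_vectors G A"
    and mult_invariant: "invariant_multiplicity G A m"
    and sign: "sign_character G \<epsilon>"
begin

lemma finite_G: "finite G"
  using reflection_group by (simp add: finite_reflection_group_def)

lemma subgroup_G: "subgroup G orth_group"
proof -
  obtain R where R: "R \<subseteq> reflections" "G = generate orth_group R"
    using reflection_group by (auto simp: finite_reflection_group_def)
  then have "R \<subseteq> carrier orth_group"
    by (auto simp: reflections_def orth_group_def orthogonal_refl_mat)
  then show ?thesis using R group.generate_is_subgroup[OF group_orth_group] by blast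
qed

lemma orthogonal_G: "g \<in> G \<Longrightarrow> orthogonal_matrix g"
  using subgroup.subset[OF subgroup_G] by (auto simp: orth_group_def)

lemma one_G: "mat 1 \<in> G"
  using subgroup.one_closed[OF subgroup_G] by (simp add: orth_group_def)

lemma mult_G: "g \<in> G \<Longrightarrow> h \<in> G \<Longrightarrow> g ** h \<in> G"
  using subgroup.m_closed[OF subgroup_G] by (simp add: orth_group_def)

lemma transpose_G: "g \<in> G \<Longrightarrow> transpose g \<in> G"
  using subgroup.m_inv_closed[OF subgroup_G] by (metis orth_group_inv orthogonal_G)

lemma transpose_mult_G: "g \<in> G \<Longrightarrow> transpose g ** g = mat 1"
  and mult_transpose_G: "g \<in> G \<Longrightarrow> g ** transpose g = mat 1"
  using orthogonal_G by (auto simp: orthogonal_matrix_def)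

lemma matrix_inv_G: "g \<in> G \<Longrightarrow> matrix_inv g = transpose g"
  by (simp add: matrix_inv_orthogonal orthogonal_G)

lemma cmat_cancel:
  assumes "g \<in> G"
  shows "cmat g *v (cmat (transpose g) *v z) = z" "cmat (transpose g) *v (cmat g *v z) = z"
  using assms by (simp_all add: matrix_vector_mul_assoc cmat_mult[symmetric] transpose_mult_G mult_transpose_G)

lemma cform_G: "g \<in> G \<Longrightarrow> cform (cmat g *v x) (cmat g *v y) = cform x y"
  by (simp add: cform_orthogonal orthogonal_G)

lemma cform_G_left: "g \<in> G \<Longrightarrow> cform x (cmat g *v y) = cform (cmat (transpose g) *v x) y"
  by (metis cform_transpose cmat_transpose transpose_transpose)

lemma G_reindex_left:
  assumes "h \<in> G"
  shows "(\<Sum>g\<in>G. f (h ** g)) = (\<Sum>g\<in>G. f g)"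
proof (rule sum.reindex_bij_witness[of _ "\<lambda>g. transpose h ** g" "\<lambda>g. h ** g"])
qed (use assms in \<open>auto simp: matrix_mul_assoc transpose_mult_G mult_transpose_G mult_G transpose_G\<close>)

lemma G_reindex_right:
  assumes "h \<in> G"
  shows "(\<Sum>g\<in>G. f (g ** h)) = (\<Sum>g\<in>G. f g)"
proof (rule sum.reindex_bij_witness[of _ "\<lambda>g. g ** transpose h" "\<lambda>g. g ** h"])
qed (use assms in \<open>auto simp: matrix_mul_assoc[symmetric] transpose_mult_G mult_transpose_G mult_G transpose_G\<close>)

text \<open>The group is generated by its reflections as a monoid, because reflections are involutions.\<close>

lemma G_induct [consumes 1, case_names one refl]:
  assumes "g \<in> G" "Q (mat 1)"
    "\<And>s g. s \<in> G \<inter> reflections \<Longrightarrow> g \<in> G \<Longrightarrow> Q g \<Longrightarrow> Q (s ** g)"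
  shows "Q g"
proof -
  obtain R where R: "R \<subseteq> reflections" "G = generate orth_group R"
    using reflection_group by (auto simp: finite_reflection_group_def)
  have "\<forall>h\<in>G. Q h \<longrightarrow> Q (g ** h)"
    using assms(1) unfolding R(2)
  proof (induction rule: generate.induct)
    case one
    then show ?case by (simp add: orth_group_def)
  next
    case (incl h)
    then show ?case using R assms(3) generate.incl[of h R orth_group] by auto
  next
    case (inv h)
    then obtain a where a: "h = refl_mat a" "a \<noteq> 0" using R by (auto simp: reflections_def)
    have "transpose h = transpose h ** (h ** h)" using a by (simp add: refl_mat_involution)
    also have "\<dots> = h" using a orthogonal_refl_mat[of a]
      by (simp add: matrix_mul_assoc orthogonal_matrix_def)
    finally have "inv\<^bsub>orth_group\<^esub> h = h" using a orthogonal_refl_mat[of a] by (simp add: orth_group_inv)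
    then show ?case using inv R assms(3) generate.incl[of h R orth_group] by auto
  next
    case (eng h1 h2)
    then show ?case using mult_G[unfolded R(2)]
      by (auto simp: orth_group_def matrix_mul_assoc[symmetric])
  qed
  then show ?thesis using one_G assms(2) by (metis matrix_mul_rid)
qed

lemma A_nonzero: "a \<in> A \<Longrightarrow> a \<noteq> 0"
  using normal by (auto simp: normal_vectors_def)

lemma refl_A: "a \<in> A \<Longrightarrow> refl_mat a \<in> G \<inter> reflections"
  using normal by (auto simp: normal_vectors_def bij_betw_def)

lemma refl_G: "a \<in> A \<Longrightarrow> refl_mat a \<in> G"
  using refl_A by auto

lemma finite_A: "finite A"
  using normal finite_G by (auto simp: normal_vectors_def dest: bij_betw_finite)

lemma refl_inj: "inj_on refl_mat A"
  using normal by (auto simp: normal_vectors_def bij_betw_def)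

lemma reflection_cases:
  assumes "s \<in> G \<inter> reflections"
  obtains a where "a \<in> A" "s = refl_mat a"
  using assms normal by (auto simp: normal_vectors_def bij_betw_def)

lemma transpose_refl: "transpose (refl_mat a) = (refl_mat a :: real ^ 'n ^ 'n)"
proof -
  have "transpose (refl_mat a) ** refl_mat a ** refl_mat a = refl_mat a"
    using orthogonal_refl_mat[of a] by (simp add: orthogonal_matrix_def)
  then show ?thesis by (simp add: matrix_mul_assoc[symmetric] refl_mat_involution)
qed

lemma refl_refl [simp]: "cmat (refl_mat a) *v (cmat (refl_mat a) *v z) = (z :: 'n cspace)"
  by (simp add: matrix_vector_mul_assoc cmat_mult[symmetric] refl_mat_involution)

lemma matrix_inv_refl: "matrix_inv (refl_mat a) = (refl_mat a :: real ^ 'n ^ 'n)"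
  by (simp add: matrix_inv_orthogonal orthogonal_refl_mat transpose_refl)

lemma sign_G: "g \<in> G \<Longrightarrow> \<epsilon> g = 1 \<or> \<epsilon> g = -1"
  and sign_mult: "g \<in> G \<Longrightarrow> h \<in> G \<Longrightarrow> \<epsilon> (g ** h) = \<epsilon> g * \<epsilon> h"
  and sign_refl: "a \<in> A \<Longrightarrow> \<epsilon> (refl_mat a) = -1"
  using sign refl_A by (auto simp: sign_character_def)

lemma sign_square: "g \<in> G \<Longrightarrow> \<epsilon> g * \<epsilon> g = 1"
  using sign_G by fastforce

lemma sign_one: "\<epsilon> (mat 1) = 1"
  using sign_mult[OF one_G one_G] sign_G[OF one_G] by auto

subsection \<open>Permutation of the normal vectors\<close>

text \<open>The normal vectors need not have equal lengths, so \<open>g\<close> permutes them only up to nonzero factors.\<close>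

definition perm :: "real ^ 'n ^ 'n \<Rightarrow> real ^ 'n \<Rightarrow> real ^ 'n" where
  "perm g a = the_inv_into A refl_mat (g ** refl_mat a ** transpose g)"

lemma perm_props:
  assumes "g \<in> G" "a \<in> A"
  shows "perm g a \<in> A" "refl_mat (perm g a) = g ** refl_mat a ** transpose g"
proof -
  have "g *v a \<noteq> 0"
  proof
    assume "g *v a = 0"
    then have "transpose g *v (g *v a) = 0" by simp
    then show False using assms A_nonzero by (simp add: matrix_vector_mul_assoc transpose_mult_G)
  qed
  moreover have "refl_mat (g *v a) = g ** refl_mat a ** transpose g"
    by (rule refl_mat_conj[OF orthogonal_G[OF assms(1)]])
  ultimately have "g ** refl_mat a ** transpose g \<in> reflections"
    by (metis (mono_tags, lifting) mem_Collect_eq reflections_def)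
  then have *: "g ** refl_mat a ** transpose g \<in> refl_mat ` A"
    using assms normal refl_G mult_G transpose_G by (auto simp: normal_vectors_def bij_betw_def)
  show "perm g a \<in> A" "refl_mat (perm g a) = g ** refl_mat a ** transpose g"
    unfolding perm_def using the_inv_into_into[OF refl_inj * order_refl] f_the_inv_into_f[OF refl_inj *] by auto
qed

lemma perm_scale:
  assumes "g \<in> G" "a \<in> A"
  shows "\<exists>c. c \<noteq> 0 \<and> g *v a = c *\<^sub>R perm g a"
proof (rule refl_mat_eqD)
  show "refl_mat (g *v a) = refl_mat (perm g a)"
    using perm_props[OF assms] refl_mat_conj[OF orthogonal_G[OF assms(1)]] by simp
  show "perm g a \<noteq> 0" using perm_props[OF assms] A_nonzero by auto
  show "g *v a \<noteq> 0"
  proof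
    assume "g *v a = 0"
    then have "transpose g *v (g *v a) = 0" by simp
    then show False using assms A_nonzero by (simp add: matrix_vector_mul_assoc transpose_mult_G)
  qed
qed

lemma perm_cscale:
  assumes "g \<in> G" "a \<in> A"
  shows "\<exists>c. c \<noteq> 0 \<and> cmat g *v cvec a = c *s cvec (perm g a)"
  using perm_scale[OF assms] by (metis cmat_cvec cvec_scaleR of_real_eq_0_iff)

lemma perm_bij:
  assumes "g \<in> G"
  shows "bij_betw (perm g) A A"
proof -
  have "perm (transpose h) (perm h a) = a" if "h \<in> G" "a \<in> A" for h a
  proof -
    have "refl_mat (perm (transpose h) (perm h a)) = transpose h ** (h ** refl_mat a ** transpose h) ** h"
      using that by (simp add: perm_props transpose_G)
    also have "\<dots> = (transpose h ** h) ** refl_mat a ** (transpose h ** h)"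
      by (simp add: matrix_mul_assoc)
    also have "\<dots> = refl_mat a" using that by (simp add: transpose_mult_G)
    finally show ?thesis using refl_inj that perm_props transpose_G by (meson inj_onD)
  qed
  from this[OF assms] this[OF transpose_G[OF assms]] show ?thesis
    using assms perm_props transpose_G
    by (intro bij_betwI[of _ _ _ "perm (transpose g)"]) auto
qed

lemma perm_mult:
  assumes "g \<in> G" "a \<in> A"
  shows "m (perm g a) = m a"
  using mult_invariant assms perm_props[OF assms] unfolding invariant_multiplicity_def
  by (metis matrix_inv_G)

lemma sum_A_reindex:
  assumes "g \<in> G"
  shows "(\<Sum>a\<in>A. f a) = (\<Sum>a\<in>A. f (perm g a))"
  using sum.reindex_bij_betw[OF perm_bij[OF assms], of f] by simp

lemma regular_set_G:
  assumes "g \<in> G" "z \<in> regular_set A"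
  shows "cmat g *v z \<in> regular_set A"
  unfolding regular_set_def
proof (clarify)
  fix a assume a: "a \<in> A" "cform (cvec a) (cmat g *v z) = 0"
  obtain c where "c \<noteq> 0" "cmat (transpose g) *v cvec a = c *s cvec (perm (transpose g) a)"
    using perm_cscale[OF transpose_G[OF assms(1)] a(1)] by blast
  then have "cform (cvec (perm (transpose g) a)) z = 0"
    using a(2) assms(1) by (simp add: cform_G_left cform_linear)
  then show False using assms(2) perm_props(1)[OF transpose_G[OF assms(1)] a(1)]
    by (auto simp: regular_set_def)
qed

lemma cvec_A_nonzero: "0 \<notin> cvec ` A"
  using A_nonzero by (auto simp: eq_commute[of 0])

lemma regular_exists: "\<exists>z. z \<in> regular_set A"
  using finite_hyperplanes_avoid[OF _ cvec_A_nonzero] finite_A by (auto simp: regular_set_def)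

lemma eq_off_regular:
  fixes f g :: "'n cspace \<Rightarrow> complex"
  assumes "continuous_on UNIV f" "continuous_on UNIV g" "\<And>z. z \<in> regular_set A \<Longrightarrow> f z = g z"
  shows "f = g"
proof (rule eq_off_hyperplanes[OF _ cvec_A_nonzero assms(1,2)])
qed (use finite_A assms(3) in \<open>auto simp: regular_set_def\<close>)

subsection \<open>The discriminant factor and antisymmetrization\<close>

definition \<Delta> :: "'n cspace \<Rightarrow> complex" where
  "\<Delta> z = (\<Prod>a\<in>A. cform (cvec a) z)"

lemma \<Delta>_homp: "\<Delta> \<in> homp (int (card A))"
  using homp_prod[OF finite_A homp_cform, of cvec] by (simp add: \<Delta>_def[abs_def])

lemma \<Delta>_polys: "\<Delta> \<in> polys"
  using \<Delta>_homp homp_polys by blast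

lemma \<Delta>_nonzero_iff: "\<Delta> z \<noteq> 0 \<longleftrightarrow> z \<in> regular_set A"
  using finite_A by (simp add: \<Delta>_def regular_set_def)

text \<open>
  Normal vectors of different reflections are not proportional, hence stay nonzero when projected
  along one of them. So the points of the hyperplane of \<open>b\<close> that lie on no other hyperplane are dense
  in it.
\<close>

lemma hyperplane_generic:
  fixes f :: "'n cspace \<Rightarrow> complex"
  assumes b: "b \<in> A" and f: "continuous_on UNIV f"
    and zero: "\<And>z. cform (cvec b) z = 0 \<Longrightarrow> (\<And>a. a \<in> A - {b} \<Longrightarrow> cform (cvec a) z \<noteq> 0) \<Longrightarrow> f z = 0"
    and z: "cform (cvec b) z = 0"
  shows "f z = 0"
proof -
  define pr where "pr z = z - (cform (cvec b) z / of_real (b \<bullet> b)) *s cvec b" for z :: "'n cspace"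
  define a' where "a' a = a - ((b \<bullet> a) / (b \<bullet> b)) *\<^sub>R b" for a
  have bb: "b \<bullet> b \<noteq> 0" using A_nonzero b by auto
  have pr0: "cform (cvec b) (pr z) = 0" for z
    using bb by (simp add: pr_def cform_linear cform_cvec)
  have pra: "cform (cvec a) (pr z) = cform (cvec (a' a)) z" for a z
  proof -
    have "cvec (a' a) = cvec a - of_real ((b \<bullet> a) / (b \<bullet> b)) *s cvec b"
      by (simp add: a'_def cvec_def vec_eq_iff)
    then show ?thesis by (simp add: pr_def cform_linear cform_cvec inner_commute)
  qed
  have "0 \<notin> (\<lambda>a. cvec (a' a)) ` (A - {b})"
  proof
    assume "0 \<in> (\<lambda>a. cvec (a' a)) ` (A - {b})"
    then obtain a where a: "a \<in> A" "a \<noteq> b" "a' a = 0"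
      by (metis (no_types, lifting) Diff_iff cvec_eq_0_iff imageE singletonI)
    then have "a = ((b \<bullet> a) / (b \<bullet> b)) *\<^sub>R b" by (simp add: a'_def)
    moreover from this have "(b \<bullet> a) / (b \<bullet> b) \<noteq> 0" using A_nonzero a(1) by fastforce
    ultimately have "refl_mat a = refl_mat b" by (metis refl_mat_scaleR)
    then show False using a b refl_inj by (auto dest: inj_onD)
  qed
  then have "(\<lambda>z. f (pr z)) = (\<lambda>z. 0)"
  proof (rule eq_off_hyperplanes[rotated])
    have "continuous_on UNIV (\<lambda>z. \<chi> i. z $ i - (cform (cvec b) z / of_real (b \<bullet> b)) * cvec b $ i)"
      by (intro continuous_intros) (use bb in auto)
    then have "continuous_on UNIV pr" unfolding pr_def
      by (rule back_subst[of "continuous_on UNIV"]) (auto simp: vec_eq_iff)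
    then show "continuous_on UNIV (\<lambda>z. f (pr z))"
      by (rule continuous_on_compose2[OF f]) auto
  qed (use finite_A zero pr0 pra in auto)
  moreover have "pr z = z" using z by (simp add: pr_def)
  ultimately show ?thesis by metis
qed

lemma cform_refl: "b \<in> A \<Longrightarrow> cform (cvec b) (cmat (refl_mat b) *v z) = - cform (cvec b) z"
  unfolding cmat_refl_mat_apply using A_nonzero by (simp add: cform_linear cform_cvec)

text \<open>A reflection permutes the linear factors up to constants, so it multiplies \<open>\<Delta>\<close> by some \<open>\<kappa>\<close> with
  \<open>\<kappa> * \<kappa> = 1\<close>. If \<open>\<kappa>\<close> were \<open>1\<close>, the product of the factors other than that of \<open>b\<close> would be odd
  under the reflection in \<open>b\<close> and vanish on its whole hyperplane, which is impossible.\<close>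

lemma \<Delta>_refl:
  assumes b: "b \<in> A"
  shows "\<Delta> (cmat (refl_mat b) *v z) = - \<Delta> z"
proof -
  let ?s = "refl_mat b"
  have s: "?s \<in> G" using b refl_G by auto
  have "\<forall>a\<in>A. \<exists>c. c \<noteq> 0 \<and> cmat ?s *v cvec a = c *s cvec (perm ?s a)"
    using perm_cscale s by auto
  then obtain c where c: "\<And>a. a \<in> A \<Longrightarrow> c a \<noteq> 0 \<and> cmat ?s *v cvec a = c a *s cvec (perm ?s a)"
    by metis
  define \<kappa> where "\<kappa> = (\<Prod>a\<in>A. c a)"
  have k: "\<Delta> (cmat ?s *v z) = \<kappa> * \<Delta> z" for z
  proof -
    have "\<Delta> (cmat ?s *v z) = (\<Prod>a\<in>A. c a * cform (cvec (perm ?s a)) z)"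
      unfolding \<Delta>_def
      by (intro prod.cong) (use c s in \<open>auto simp: cform_G_left transpose_refl cform_linear\<close>)
    also have "\<dots> = \<kappa> * (\<Prod>a\<in>A. cform (cvec (perm ?s a)) z)"
      by (simp add: prod.distrib \<kappa>_def)
    also have "(\<Prod>a\<in>A. cform (cvec (perm ?s a)) z) = \<Delta> z"
      unfolding \<Delta>_def using prod.reindex_bij_betw[OF perm_bij[OF s], of "\<lambda>a. cform (cvec a) z"] by simp
    finally show ?thesis .
  qed
  obtain z0 where z0: "z0 \<in> regular_set A"
    using regular_exists by blast
  then have nz: "\<Delta> z0 \<noteq> 0" by (simp add: \<Delta>_nonzero_iff)
  have "\<Delta> z0 = \<kappa> * (\<kappa> * \<Delta> z0)" using k[of "cmat ?s *v z0"] k[of z0] by simp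
  then have "\<kappa> * \<kappa> = 1" using nz by (simp add: mult.assoc[symmetric])
  then have "\<kappa> = 1 \<or> \<kappa> = -1" by (simp add: square_eq_1_iff)
  moreover have "\<kappa> \<noteq> 1"
  proof
    assume k1: "\<kappa> = 1"
    define D where "D z = (\<Prod>a\<in>A - {b}. cform (cvec a) z)" for z
    have D: "\<Delta> z = cform (cvec b) z * D z" for z
      unfolding \<Delta>_def D_def using b finite_A by (simp add: prod.remove)
    have D_cont: "continuous_on S D" for S
      unfolding D_def by (intro continuous_intros)
    have bb: "b \<bullet> b \<noteq> 0" using A_nonzero b by auto
    have sb: "cform (cvec b) (cmat ?s *v z) = - cform (cvec b) z" for z
      by (rule cform_refl[OF b])
    have "(\<lambda>z. D (cmat ?s *v z)) = (\<lambda>z. - D z)"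
    proof (rule eq_off_regular)
      show "continuous_on UNIV (\<lambda>z. D (cmat ?s *v z))"
        by (rule continuous_on_compose2[OF D_cont[of UNIV]]) (auto intro!: matrix_vector_mult_linear_continuous_on)
      fix z assume z: "z \<in> regular_set A"
      have "cform (cvec b) z * D (cmat ?s *v z) = cform (cvec b) z * (- D z)"
      proof -
        have "- (cform (cvec b) z * D (cmat ?s *v z)) = cform (cvec b) z * D z"
          using k[of z] k1 by (simp add: D sb)
        then show ?thesis by (metis minus_minus mult_minus_right)
      qed
      then show "D (cmat ?s *v z) = - D z"
        using z b by (simp only: mult_cancel_left) (auto simp: regular_set_def)
    qed (intro continuous_intros D_cont)
    then have "D z = 0" if "cform (cvec b) z = 0" for z
    proof -
      have "cmat ?s *v z = z" using that by (simp add: cmat_refl_mat_apply)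
      with \<open>(\<lambda>z. D (cmat ?s *v z)) = (\<lambda>z. - D z)\<close> have "D z = - D z" by metis
      then show ?thesis by simp
    qed
    then have "(\<Prod>a\<in>A - {b}. cform (cvec a) z) = 0" if "cform (cvec b) z = 0" for z
      using that by (simp add: D_def)
    then have "(1::complex) = 0"
      using b finite_A hyperplane_generic[of b "\<lambda>z. 1" 0] by auto
    then show False by simp
  qed
  ultimately show ?thesis using k by auto
qed

lemma \<Delta>_G: "g \<in> G \<Longrightarrow> \<Delta> (cmat g *v z) = of_int (\<epsilon> g) * \<Delta> z"
proof (induction arbitrary: z rule: G_induct)
  case one
  then show ?case by (simp add: sign_one)
next
  case (refl s g)
  then obtain a where "a \<in> A" "s = refl_mat a" using reflection_cases by blast
  then show ?case using refl \<Delta>_refl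
    by (simp add: cmat_mult matrix_vector_mul_assoc[symmetric] sign_mult sign_refl)
qed

definition asym :: "('n cspace \<Rightarrow> complex) \<Rightarrow> 'n cspace \<Rightarrow> complex" where
  "asym p z = (\<Sum>g\<in>G. of_int (\<epsilon> g) * p (cmat g *v z))"

lemma asym_G:
  assumes "h \<in> G"
  shows "asym p (cmat h *v z) = of_int (\<epsilon> h) * asym p z"
proof -
  have "asym p (cmat h *v z) = (\<Sum>g\<in>G. of_int (\<epsilon> h) * (of_int (\<epsilon> (g ** h)) * p (cmat (g ** h) *v z)))"
    unfolding asym_def
  proof (intro sum.cong refl)
    fix g assume "g \<in> G"
    have "of_int (\<epsilon> h) * of_int (\<epsilon> h) = (1::complex)"
      using sign_square[OF assms] by (metis of_int_1 of_int_mult)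
    then show "of_int (\<epsilon> g) * p (cmat g *v (cmat h *v z))
        = of_int (\<epsilon> h) * (of_int (\<epsilon> (g ** h)) * p (cmat (g ** h) *v z))"
      using \<open>g \<in> G\<close> assms
      by (simp add: sign_mult cmat_mult matrix_vector_mul_assoc mult.left_commute flip: mult.assoc)
  qed
  also have "\<dots> = of_int (\<epsilon> h) * asym p z"
    unfolding asym_def sum_distrib_left[symmetric]
    by (simp only: G_reindex_right[OF assms, of "\<lambda>g. of_int (\<epsilon> g) * p (cmat g *v z)"])
  finally show ?thesis .
qed

lemma asym_compose:
  assumes "h \<in> G"
  shows "asym (\<lambda>z. p (cmat h *v z)) z = of_int (\<epsilon> h) * asym p z"
proof -
  have "asym (\<lambda>z. p (cmat h *v z)) z = (\<Sum>g\<in>G. of_int (\<epsilon> h) * (of_int (\<epsilon> (h ** g)) * p (cmat (h ** g) *v z)))"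
    unfolding asym_def
  proof (intro sum.cong refl)
    fix g assume "g \<in> G"
    have "of_int (\<epsilon> h) * of_int (\<epsilon> h) = (1::complex)"
      using sign_square[OF assms] by (metis of_int_1 of_int_mult)
    then show "of_int (\<epsilon> g) * p (cmat h *v (cmat g *v z))
        = of_int (\<epsilon> h) * (of_int (\<epsilon> (h ** g)) * p (cmat (h ** g) *v z))"
      using \<open>g \<in> G\<close> assms
      by (simp add: sign_mult cmat_mult matrix_vector_mul_assoc mult.left_commute flip: mult.assoc)
  qed
  also have "\<dots> = of_int (\<epsilon> h) * asym p z"
    unfolding asym_def sum_distrib_left[symmetric]
    by (simp only: G_reindex_left[OF assms, of "\<lambda>g. of_int (\<epsilon> g) * p (cmat g *v z)"])
  finally show ?thesis .
qed

lemma antiinvariant_zero: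
  assumes b: "b \<in> A" and anti: "f (cmat (refl_mat b) *v z) = - f z" and z: "cform (cvec b) z = 0"
  shows "f z = (0 :: complex)"
proof -
  have "cmat (refl_mat b) *v z = z" using z by (simp add: cmat_refl_mat_apply)
  then show ?thesis using anti by simp
qed

text \<open>An anti-invariant polynomial vanishes on every reflection hyperplane. One divides by one linear
  form at a time; the previous factors do not vanish at generic points of the next hyperplane.\<close>

lemma antiinvariant_divisible:
  assumes p: "p \<in> polys" and anti: "\<And>a z. a \<in> A \<Longrightarrow> p (cmat (refl_mat a) *v z) = - p z"
  shows "\<exists>q\<in>polys. \<forall>z. p z = \<Delta> z * q z"
proof -
  have "\<exists>q\<in>polys. \<forall>z. p z = (\<Prod>a\<in>T. cform (cvec a) z) * q z" if "finite T" "T \<subseteq> A" for T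
    using that
  proof (induction T rule: finite_induct)
    case empty
    then show ?case using p by auto
  next
    case (insert b T)
    then obtain q where q: "q \<in> polys" "\<And>z. p z = (\<Prod>a\<in>T. cform (cvec a) z) * q z" by auto
    have b: "b \<in> A" using insert by auto
    have bb: "b \<bullet> b \<noteq> 0" using A_nonzero b by auto
    have q0: "q z = 0" if "cform (cvec b) z = 0" for z
    proof (rule hyperplane_generic[OF b _ _ that])
      show "continuous_on UNIV q" by (rule polys_continuous[OF q(1)])
      fix z assume z: "cform (cvec b) z = 0" "\<And>a. a \<in> A - {b} \<Longrightarrow> cform (cvec a) z \<noteq> 0"
      have "p z = 0" by (rule antiinvariant_zero[of _ p, OF b anti[OF b] z(1)])
      moreover have "(\<Prod>a\<in>T. cform (cvec a) z) \<noteq> 0"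
        using z(2) insert by (auto simp: prod_zero_iff)
      ultimately show "q z = 0" using q(2)[of z] by simp
    qed
    obtain r where r: "r \<in> polys"
      "\<And>z. q z - q (z - cform (cvec b) z *s ((1 / of_real (b \<bullet> b)) *s cvec b)) = cform (cvec b) z * r z"
      using polys_divided_difference[OF q(1)] by metis
    have "q z = cform (cvec b) z * r z" for z
    proof -
      have "cform (cvec b) (z - cform (cvec b) z *s ((1 / of_real (b \<bullet> b)) *s cvec b)) = 0"
        using bb by (simp add: cform_linear cform_cvec)
      then show ?thesis using r(2)[of z] q0 by simp
    qed
    then show ?case using q(2) r(1) insert.hyps
      by (intro bexI[of _ r]) (auto simp: algebra_simps)
  qed
  from this[OF finite_A order_refl] show ?thesis by (simp add: \<Delta>_def)
qed

text \<open>
  The quotient exists by \<open>antiinvariant_divisible\<close>. Its value at \<open>\<lambda>\<close> is \<open>\<mu>(p)\<close>, by \<open>mu_eq_B\<close>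
  below. As a function of \<open>\<lambda>\<close> it shows that \<open>\<mu>\<close> depends polynomially on \<open>\<lambda>\<close>.
\<close>

definition B :: "('n cspace \<Rightarrow> complex) \<Rightarrow> 'n cspace \<Rightarrow> complex" where
  "B p = (SOME q. q \<in> polys \<and> (\<forall>z. \<Delta> z * q z = asym p z))"

lemma asym_polys: "p \<in> polys \<Longrightarrow> asym p \<in> polys"
  unfolding asym_def[abs_def] by (intro polys_sum polys_scale polys_matrix)

lemma B_props:
  assumes "p \<in> polys"
  shows "B p \<in> polys" "\<Delta> z * B p z = asym p z"
proof -
  have "\<exists>q\<in>polys. \<forall>z. asym p z = \<Delta> z * q z"
    by (rule antiinvariant_divisible[OF asym_polys[OF assms]]) (simp add: asym_G refl_G sign_refl)
  then have "\<exists>q. q \<in> polys \<and> (\<forall>z. \<Delta> z * q z = asym p z)" by metis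
  then have "B p \<in> polys \<and> (\<forall>z. \<Delta> z * B p z = asym p z)" unfolding B_def by (rule someI_ex)
  then show "B p \<in> polys" "\<Delta> z * B p z = asym p z" by auto
qed

lemma polys_eq_regular:
  assumes "p \<in> polys" "q \<in> polys" "\<And>z. z \<in> regular_set A \<Longrightarrow> \<Delta> z * p z = \<Delta> z * q z"
  shows "p = q"
  by (rule eq_off_regular) (use assms polys_continuous \<Delta>_nonzero_iff in auto)

lemma B_eqI:
  assumes "p \<in> polys" "q \<in> polys" "\<And>z. \<Delta> z * q z = asym p z"
  shows "B p = q"
  by (rule polys_eq_regular) (use assms B_props in auto)

lemma B_regular: "p \<in> polys \<Longrightarrow> z \<in> regular_set A \<Longrightarrow> B p z = asym p z / \<Delta> z"
  using B_props(2)[of p z] \<Delta>_nonzero_iff[of z] by (simp add: field_simps)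

lemma B_add: "p \<in> polys \<Longrightarrow> q \<in> polys \<Longrightarrow> B (\<lambda>z. p z + q z) = (\<lambda>z. B p z + B q z)"
  by (rule B_eqI) (auto simp: B_props distrib_left, simp add: asym_def distrib_left sum.distrib)

lemma B_scale: "p \<in> polys \<Longrightarrow> B (\<lambda>z. c * p z) = (\<lambda>z. c * B p z)"
  by (rule B_eqI) (auto simp: B_props mult.left_commute[of _ c], simp add: asym_def sum_distrib_left mult.left_commute)

lemma B_zero: "B (\<lambda>z. 0) = (\<lambda>z. 0)"
  by (rule B_eqI) (auto simp: asym_def)

lemma B_diff:
  assumes "p \<in> polys" "q \<in> polys"
  shows "B (\<lambda>z. p z - q z) = (\<lambda>z. B p z - B q z)"
  using B_add[OF assms(1) polys_minus[OF assms(2)]] B_scale[OF assms(2), of "-1"] by simp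

lemma B_sum: "finite I \<Longrightarrow> (\<And>i. i \<in> I \<Longrightarrow> f i \<in> polys) \<Longrightarrow> B (\<lambda>z. \<Sum>i\<in>I. f i z) = (\<lambda>z. \<Sum>i\<in>I. B (f i) z)"
proof (induction I rule: finite_induct)
  case (insert i I)
  have "B (\<lambda>z. \<Sum>i\<in>insert i I. f i z) = B (\<lambda>z. f i z + (\<Sum>i\<in>I. f i z))" using insert.hyps by simp
  also have "\<dots> = (\<lambda>z. B (f i) z + B (\<lambda>z. \<Sum>i\<in>I. f i z) z)"
    using insert.prems by (intro B_add polys_sum) auto
  finally show ?case using insert by simp
qed (simp add: B_zero)

lemma inv_polys_iff: "f \<in> inv_polys G \<longleftrightarrow> f \<in> polys \<and> (\<forall>g\<in>G. \<forall>z. f (cmat g *v z) = f z)"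
proof -
  have "(\<forall>g\<in>G. act g f = f) \<longleftrightarrow> (\<forall>g\<in>G. \<forall>z. f (cmat g *v z) = f z)"
  proof (intro iffI ballI allI ext)
    fix g z assume "\<forall>g\<in>G. act g f = f" "g \<in> G"
    then have "act (transpose g) f = f" using transpose_G by blast
    then show "f (cmat g *v z) = f z"
      using \<open>g \<in> G\<close> transpose_G by (metis act_def matrix_inv_G transpose_transpose)
  next
    fix g z assume "\<forall>g\<in>G. \<forall>z. f (cmat g *v z) = f z" "g \<in> G"
    then show "act g f z = f z" by (simp add: act_def matrix_inv_G transpose_G)
  qed
  then show ?thesis by (auto simp: inv_polys_def)
qed

lemma inv_polys_polys: "f \<in> inv_polys G \<Longrightarrow> f \<in> polys"
  and inv_polys_G: "f \<in> inv_polys G \<Longrightarrow> g \<in> G \<Longrightarrow> f (cmat g *v z) = f z"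
  by (auto simp: inv_polys_iff)

lemma B_inv_mult:
  assumes "f \<in> inv_polys G" "p \<in> polys"
  shows "B (\<lambda>z. f z * p z) = (\<lambda>z. f z * B p z)"
proof (rule B_eqI)
  fix z
  have "asym (\<lambda>z. f z * p z) z = f z * asym p z"
    unfolding asym_def sum_distrib_left
    by (rule sum.cong) (use assms in \<open>auto simp: inv_polys_G\<close>)
  then show "\<Delta> z * (f z * B p z) = asym (\<lambda>z. f z * p z) z"
    using B_props(2)[OF assms(2), of z] by simp
qed (use assms B_props inv_polys_polys in auto)

lemma B_compose:
  assumes "h \<in> G" "p \<in> polys"
  shows "B (\<lambda>z. p (cmat h *v z)) = (\<lambda>z. of_int (\<epsilon> h) * B p z)"
  by (rule B_eqI) (use assms B_props in \<open>auto simp: polys_matrix asym_compose mult.left_commute\<close>)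

lemma B_invariant:
  assumes "p \<in> polys"
  shows "B p \<in> inv_polys G"
proof -
  have "(\<lambda>z. B p (cmat g *v z)) = B p" if g: "g \<in> G" for g
  proof (rule polys_eq_regular)
    fix z
    have "of_int (\<epsilon> g) \<noteq> (0::complex)" using sign_G[OF g] by auto
    moreover have "of_int (\<epsilon> g) * (\<Delta> z * B p (cmat g *v z)) = of_int (\<epsilon> g) * (\<Delta> z * B p z)"
      using B_props(2)[OF assms, of "cmat g *v z"] B_props(2)[OF assms, of z] g
      by (simp add: \<Delta>_G asym_G mult.assoc)
    ultimately show "\<Delta> z * B p (cmat g *v z) = \<Delta> z * B p z" by simp
  qed (use assms in \<open>auto intro!: polys_matrix B_props\<close>)
  then show ?thesis using B_props(1)[OF assms] by (metis inv_polys_iff)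
qed

lemma B_homp:
  assumes "p \<in> homp d"
  shows "B p \<in> homp (d - int (card A))"
proof -
  have p: "p \<in> polys" using assms homp_polys by auto
  have "(\<lambda>z. B p (c *s z)) = (\<lambda>z. c powi (d - int (card A)) * B p z)" if c: "c \<noteq> 0" for c
  proof (rule polys_eq_regular)
    fix z
    have "\<Delta> (c *s z) = c powi int (card A) * \<Delta> z" using \<Delta>_homp c by (simp add: homp_def)
    moreover have "asym p (c *s z) = c powi d * asym p z"
      using assms c by (simp add: asym_def homp_def vector_scalar_commute sum_distrib_left mult.left_commute)
    ultimately have "c powi int (card A) * (\<Delta> z * B p (c *s z)) = c powi d * (\<Delta> z * B p z)"
      using B_props(2)[OF p, of "c *s z"] B_props(2)[OF p, of z] by (simp add: mult.assoc)
    then show "\<Delta> z * B p (c *s z) = \<Delta> z * (c powi (d - int (card A)) * B p z)"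
      using c by (simp add: power_int_diff field_simps)
  next
    show "(\<lambda>z. B p (c *s z)) \<in> polys"
      by (rule polys_compose[OF B_props(1)[OF p]]) (auto intro: polys_scale)
  qed (use B_props p in auto)
  then show ?thesis unfolding homp_def using B_props(1)[OF p] by (auto dest: fun_cong)
qed

end

section \<open>The coinvariant algebra and nondegeneracy\<close>

text \<open>
  If the new functional \<open>f j\<close> is not zero on the common kernel of the others, a vector of that kernel on
  which it is not zero shows which multiple of \<open>f j\<close> has to be subtracted from \<open>F\<close>.
\<close>

lemma functional_in_span:
  fixes f :: "'k \<Rightarrow> ('n::finite cspace \<Rightarrow> complex) \<Rightarrow> complex"
  defines "lin \<equiv> \<lambda>F. (\<forall>p\<in>polys. \<forall>q\<in>polys. F (\<lambda>z. p z + q z) = F p + F q)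
      \<and> (\<forall>c. \<forall>p\<in>polys. F (\<lambda>z. c * p z) = c * F p)"
  assumes "finite E" "\<And>k. k \<in> E \<Longrightarrow> lin (f k)" "lin F"
    "\<And>q. q \<in> polys \<Longrightarrow> (\<And>k. k \<in> E \<Longrightarrow> f k q = 0) \<Longrightarrow> F q = 0"
  shows "\<exists>a. \<forall>q\<in>polys. F q = (\<Sum>k\<in>E. a k * f k q)"
  using assms(2-)
proof (induction E arbitrary: F rule: finite_induct)
  case empty
  then show ?case by simp
next
  case (insert j E)
  have ext: "\<exists>a. \<forall>q\<in>polys. F q = (\<Sum>k\<in>insert j E. a k * f k q)"
    if "\<forall>q\<in>polys. F q - b * f j q = (\<Sum>k\<in>E. a k * f k q)" for a b and F :: "('n cspace \<Rightarrow> complex) \<Rightarrow> complex"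
  proof (intro exI[of _ "a(j := b)"] ballI)
    fix q :: "'n cspace \<Rightarrow> complex" assume q: "q \<in> polys"
    have "(\<Sum>k\<in>E. (a(j := b)) k * f k q) = (\<Sum>k\<in>E. a k * f k q)"
      using insert.hyps by (intro sum.cong) auto
    then show "F q = (\<Sum>k\<in>insert j E. (a(j := b)) k * f k q)"
      using insert.hyps that q by (simp add: algebra_simps)
  qed
  show ?case
  proof (cases "\<forall>q\<in>polys. (\<forall>k\<in>E. f k q = 0) \<longrightarrow> f j q = 0")
    case True
    then have "\<exists>a. \<forall>q\<in>polys. F q = (\<Sum>k\<in>E. a k * f k q)"
      using insert.prems by (intro insert.IH) auto
    then show ?thesis using ext[where b = 0] by auto
  next
    case False
    then obtain v where v: "v \<in> polys" "\<forall>k\<in>E. f k v = 0" "f j v \<noteq> 0" by auto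
    define b where "b = F v / f j v"
    have "\<exists>a. \<forall>q\<in>polys. F q - b * f j q = (\<Sum>k\<in>E. a k * f k q)"
    proof (rule insert.IH)
      show "lin (f k)" if "k \<in> E" for k using insert.prems that by auto
      show "lin (\<lambda>q. F q - b * f j q)"
        using insert.prems(1)[of j] insert.prems(2) unfolding lin_def by (simp add: algebra_simps)
      fix q :: "'n cspace \<Rightarrow> complex" assume q: "q \<in> polys" "\<And>k. k \<in> E \<Longrightarrow> f k q = 0"
      define c where "c = - (f j q / f j v)"
      have cv: "(\<lambda>z. c * v z) \<in> polys" using v(1) by auto
      have fk: "f k (\<lambda>z. q z + c * v z) = f k q + c * f k v" if "k \<in> insert j E" for k
        using insert.prems(1)[OF that] q(1) v(1) cv unfolding lin_def by simp
      have "F (\<lambda>z. q z + c * v z) = 0"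
      proof (rule insert.prems(3))
        show "f k (\<lambda>z. q z + c * v z) = 0" if "k \<in> insert j E" for k
          using fk[OF that] that q(2) v(2,3) by (auto simp: c_def)
      qed (use q v in auto)
      moreover have "F (\<lambda>z. q z + c * v z) = F q + c * F v"
        using insert.prems(2) q(1) v(1) cv unfolding lin_def by simp
      ultimately show "F q - b * f j q = 0" by (simp add: b_def c_def)
    qed
    then show ?thesis using ext by blast
  qed
qed

context refl_group
begin

text \<open>The part of degree \<open>d\<close> of \<open>I(0)\<close>, the ideal generated by the homogeneous invariants of positive
  degree.\<close>

inductive_set J :: "int \<Rightarrow> ('n cspace \<Rightarrow> complex) set" for d where
  J_zero: "(\<lambda>z. 0) \<in> J d"
| J_step: "\<lbrakk>f \<in> inv_polys G; f \<in> homp a; a > 0; h \<in> homp (d - a); q \<in> J d\<rbrakk>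
    \<Longrightarrow> (\<lambda>z. f z * h z + q z) \<in> J d"

lemma J_single: "f \<in> inv_polys G \<Longrightarrow> f \<in> homp a \<Longrightarrow> a > 0 \<Longrightarrow> h \<in> homp (d - a) \<Longrightarrow> (\<lambda>z. f z * h z) \<in> J d"
  using J_step[OF _ _ _ _ J_zero, of f a h d] by simp

lemma J_add: "p \<in> J d \<Longrightarrow> q \<in> J d \<Longrightarrow> (\<lambda>z. p z + q z) \<in> J d"
proof (induction rule: J.induct)
  case (J_step f a h p)
  then have "(\<lambda>z. f z * h z + (p z + q z)) \<in> J d" by (intro J.J_step) auto
  then show ?case by (simp add: add.assoc)
qed simp

lemma J_mult: "p \<in> J d \<Longrightarrow> h' \<in> homp e \<Longrightarrow> (\<lambda>z. h' z * p z) \<in> J (d + e)"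
proof (induction rule: J.induct)
  case (J_step f a h p)
  then have "(\<lambda>z. f z * (h' z * h z) + h' z * p z) \<in> J (d + e)"
    using homp_mult[of h' e h "d - a"] by (intro J.J_step[of f a]) (auto simp: algebra_simps)
  then show ?case by (simp add: algebra_simps)
qed (simp add: J_zero)

lemma J_scale: "p \<in> J d \<Longrightarrow> (\<lambda>z. c * p z) \<in> J d"
  using J_mult[of p d "\<lambda>z. c" 0] by auto

lemma J_diff: "p \<in> J d \<Longrightarrow> q \<in> J d \<Longrightarrow> (\<lambda>z. p z - q z) \<in> J d"
  using J_add[OF _ J_scale[of q d "-1"]] by simp

lemma J_sum: "(\<And>i. i \<in> I \<Longrightarrow> f i \<in> J d) \<Longrightarrow> (\<lambda>z. \<Sum>i\<in>I. f i z) \<in> J d"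
  by (induction I rule: infinite_finite_induct) (auto intro: J_zero J_add)

lemma J_G: "p \<in> J d \<Longrightarrow> g \<in> G \<Longrightarrow> (\<lambda>z. p (cmat g *v z)) \<in> J d"
proof (induction rule: J.induct)
  case (J_step f a h p)
  then have "(\<lambda>z. f z * h (cmat g *v z) + p (cmat g *v z)) \<in> J d"
    by (intro J.J_step[of f a]) (auto intro: homp_matrix)
  then show ?case using J_step by (simp add: inv_polys_G)
qed (simp add: J_zero)

text \<open>For invariant \<open>f\<close> the difference of \<open>f h\<close> and its reflected copy is \<open>f\<close> times the difference of
  \<open>h\<close> and its reflected copy, and the latter is divisible by the linear form of \<open>b\<close>.\<close>

lemma J_antisym:
  assumes "p \<in> J (d + 1)" "b \<in> A"
  shows "\<exists>r\<in>J d. \<forall>z. p z - p (cmat (refl_mat b) *v z) = cform (cvec b) z * r z"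
  using assms(1)
proof (induction rule: J.induct)
  case J_zero
  then show ?case using J.J_zero by (intro bexI[of _ "\<lambda>z. 0"]) auto
next
  case (J_step f a h p)
  then obtain r where r: "r \<in> J d" "\<And>z. p z - p (cmat (refl_mat b) *v z) = cform (cvec b) z * r z" by blast
  have "cvec b \<noteq> 0" using assms(2) A_nonzero by auto
  moreover have "d + 1 - a - 1 = d - a" by simp
  ultimately obtain k where k: "k \<in> homp (d - a)"
    "\<And>z. h z - h (z - cform (cvec b) z *s ((2 / of_real (b \<bullet> b)) *s cvec b)) = cform (cvec b) z * k z"
    using homp_divided_difference[OF J_step(4)] by metis
  note k = k(1) k(2)[folded cmat_refl_mat_apply']
  have "f z * h z + p z - (f (cmat (refl_mat b) *v z) * h (cmat (refl_mat b) *v z) + p (cmat (refl_mat b) *v z))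
      = cform (cvec b) z * (f z * k z + r z)" for z
  proof -
    have "f (cmat (refl_mat b) *v z) = f z" using J_step assms(2) refl_G inv_polys_G by auto
    then have "f z * h z + p z - (f (cmat (refl_mat b) *v z) * h (cmat (refl_mat b) *v z) + p (cmat (refl_mat b) *v z))
      = f z * (h z - h (cmat (refl_mat b) *v z)) + (p z - p (cmat (refl_mat b) *v z))"
      by (simp add: algebra_simps)
    also have "\<dots> = cform (cvec b) z * (f z * k z + r z)" unfolding k r by (simp add: algebra_simps)
    finally show ?thesis .
  qed
  moreover have "(\<lambda>z. f z * k z + r z) \<in> J d" using J_step r k by (intro J.J_step[of f a]) auto
  ultimately show ?case by (intro bexI[of _ "\<lambda>z. f z * k z + r z"] allI)
qed

lemma J_refl:
  assumes "(\<lambda>z. cform (cvec b) z * q z) \<in> J (d + 1)" "b \<in> A" "q \<in> polys"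
  shows "(\<lambda>z. q (cmat (refl_mat b) *v z) + q z) \<in> J d"
proof -
  obtain r where r: "r \<in> J d"
    "\<And>z. cform (cvec b) z * q z - cform (cvec b) (cmat (refl_mat b) *v z) * q (cmat (refl_mat b) *v z)
       = cform (cvec b) z * r z"
    using J_antisym[OF assms(1,2)] by blast
  have "r \<in> polys" using r(1)
  proof (induction rule: J.induct)
    case (J_step f a h q)
    then have "f \<in> polys" "h \<in> polys" using homp_polys by blast+
    then show ?case using J_step by (intro polys_add polys_mult)
  qed (rule polys_const)
  have "(\<lambda>z. q (cmat (refl_mat b) *v z) + q z) = r"
  proof (rule eq_off_regular)
    fix z assume "z \<in> regular_set A"
    then have "cform (cvec b) z \<noteq> 0" using assms(2) by (auto simp: regular_set_def)
    moreover have "cform (cvec b) z * (q (cmat (refl_mat b) *v z) + q z) = cform (cvec b) z * r z"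
      using r(2)[of z] assms(2) by (simp add: cform_refl algebra_simps)
    ultimately show "q (cmat (refl_mat b) *v z) + q z = r z" by simp
  qed (auto intro!: polys_continuous polys_add polys_matrix assms \<open>r \<in> polys\<close>)
  then show ?thesis using r(1) by simp
qed

text \<open>
  A coordinate function is a root of the monic polynomial whose roots are its images under the group.
  The lower coefficients of this polynomial are invariants of positive degree.
\<close>

lemma coord_power_J: "(\<lambda>z. z $ i ^ card G) \<in> J (int (card G))"
proof -
  let ?N = "card G"
  define e where "e k z = (\<Sum>Y | Y \<subseteq> G \<and> card Y = k. \<Prod>g\<in>Y. - (cmat g *v z) $ i)" for k z
  have fin: "finite {Y. Y \<subseteq> G \<and> card Y = k}" for k using finite_G by auto
  have e_homp: "e k \<in> homp (int k)" for k
  proof -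
    have "(\<lambda>z. \<Prod>g\<in>Y. - (cmat g *v z) $ i) \<in> homp (int k)" if Y: "Y \<subseteq> G" "card Y = k" for Y
    proof -
      have "(\<lambda>z. -1 * (cmat g *v z) $ i) \<in> homp 1" for g
        by (intro homp_scale homp_matrix[OF homp_coord])
      then have "(\<lambda>z. - (cmat g *v z) $ i) \<in> homp 1" for g by simp
      from homp_prod[OF finite_subset[OF Y(1) finite_G] this, of "\<lambda>g. g"] show ?thesis using Y by simp
    qed
    then show ?thesis unfolding e_def[abs_def] by (intro homp_sum) auto
  qed
  have e_inv: "e k \<in> inv_polys G" for k
    unfolding inv_polys_iff
  proof (intro conjI ballI allI)
    show "e k \<in> polys" using e_homp homp_polys by blast
    fix h z assume h: "h \<in> G"
    have inj: "inj_on (\<lambda>g. g ** h) Y" for Y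
      using h mult_transpose_G by (intro inj_onI) (metis matrix_mul_assoc matrix_mul_rid)
    show "e k (cmat h *v z) = e k z"
      unfolding e_def
    proof (rule sum.reindex_bij_witness[of _ "\<lambda>Y. (\<lambda>g. g ** transpose h) ` Y" "\<lambda>Y. (\<lambda>g. g ** h) ` Y"])
      fix Y assume Y: "Y \<in> {Y. Y \<subseteq> G \<and> card Y = k}"
      show "(\<lambda>g. g ** transpose h) ` (\<lambda>g. g ** h) ` Y = Y" "(\<lambda>g. g ** h) ` (\<lambda>g. g ** transpose h) ` Y = Y"
        using h by (auto simp: image_image matrix_mul_assoc[symmetric] transpose_mult_G mult_transpose_G)
      show "(\<lambda>g. g ** h) ` Y \<in> {Y. Y \<subseteq> G \<and> card Y = k}"
        using Y h card_image[OF inj] by (auto simp: mult_G)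
      have "inj_on (\<lambda>g. g ** transpose h) Y"
        using h transpose_mult_G by (intro inj_onI) (metis matrix_mul_assoc matrix_mul_rid)
      then show "(\<lambda>g. g ** transpose h) ` Y \<in> {Y. Y \<subseteq> G \<and> card Y = k}"
        using Y h by (auto simp: card_image mult_G transpose_G)
      show "(\<Prod>g\<in>(\<lambda>g. g ** h) ` Y. - (cmat g *v z) $ i) = (\<Prod>g\<in>Y. - (cmat g *v (cmat h *v z)) $ i)"
        by (subst prod.reindex[OF inj]) (simp add: cmat_mult matrix_vector_mul_assoc)
    qed
  qed
  have sum0: "(\<Sum>k\<le>?N. e k z * z $ i ^ (?N - k)) = 0" for z
  proof -
    have "0 = (\<Prod>g\<in>G. - (cmat g *v z) $ i + z $ i)"
      using finite_G one_G by (auto simp: prod_zero_iff intro!: bexI[of _ "mat 1"])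
    also have "\<dots> = (\<Sum>Y\<in>Pow G. (\<Prod>g\<in>Y. - (cmat g *v z) $ i) * z $ i ^ card (G - Y))"
      by (subst prod_add[OF finite_G]) simp
    also have "\<dots> = (\<Sum>k\<le>?N. \<Sum>Y | Y \<in> Pow G \<and> card Y = k. (\<Prod>g\<in>Y. - (cmat g *v z) $ i) * z $ i ^ card (G - Y))"
      using finite_G by (intro sum.group[symmetric]) (auto intro: card_mono)
    also have "\<dots> = (\<Sum>k\<le>?N. e k z * z $ i ^ (?N - k))"
      unfolding e_def sum_distrib_right
      by (intro sum.cong) (use finite_G in \<open>auto simp: card_Diff_subset finite_subset\<close>)
    finally show ?thesis by simp
  qed
  have e0: "e 0 z = 1" for z
  proof -
    have "{Y. Y \<subseteq> G \<and> card Y = 0} = {{}}" using finite_G finite_subset by fastforce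
    then show ?thesis by (simp add: e_def)
  qed
  have "(\<lambda>z. \<Sum>k\<in>{1..?N}. e k z * z $ i ^ (?N - k)) \<in> J (int ?N)"
  proof (rule J_sum)
    fix k assume k: "k \<in> {1..?N}"
    have "(\<lambda>z. z $ i ^ (?N - k)) \<in> homp (int (?N - k) * 1)" by (rule homp_power[OF homp_coord])
    then show "(\<lambda>z. e k z * z $ i ^ (?N - k)) \<in> J (int ?N)"
      using k by (intro J_single[OF e_inv e_homp]) (auto simp: of_nat_diff)
  qed
  from J_scale[OF this, of "-1"]
  have "(\<lambda>z. - (\<Sum>k\<in>{1..?N}. e k z * z $ i ^ (?N - k))) \<in> J (int ?N)" by simp
  also have "(\<lambda>z. - (\<Sum>k\<in>{1..?N}. e k z * z $ i ^ (?N - k))) = (\<lambda>z. z $ i ^ ?N)"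
  proof
    fix z
    have "{..?N} = insert 0 {1..?N}" by auto
    then have "(\<Sum>k\<le>?N. e k z * z $ i ^ (?N - k)) = z $ i ^ ?N + (\<Sum>k\<in>{1..?N}. e k z * z $ i ^ (?N - k))"
      by (simp add: e0)
    then show "- (\<Sum>k\<in>{1..?N}. e k z * z $ i ^ (?N - k)) = z $ i ^ ?N"
      using sum0[of z] by (simp add: add_eq_0_iff2)
  qed
  finally show ?thesis .
qed

lemma monomial_homp: "monomial k \<in> homp (int (\<Sum>i\<in>UNIV. k i))"
proof -
  have "(\<lambda>z. \<Prod>i\<in>UNIV. z $ i ^ k i) \<in> homp (\<Sum>i\<in>UNIV. int (k i) * 1)"
    by (intro homp_prod homp_power homp_coord) auto
  then show ?thesis by (simp add: monomial_def[abs_def])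
qed

lemma high_degree_J:
  assumes "q \<in> homp d" "d \<ge> int (CARD('n) * card G)"
  shows "q \<in> J d"
proof -
  let ?c = "poly_coeffs q"
  have c: "has_coeffs q ?c" using assms(1) homp_polys has_coeffs_poly_coeffs by auto
  have "(\<lambda>z. \<Sum>k | ?c k \<noteq> 0. ?c k * monomial k z) \<in> J d"
  proof (intro J_sum J_scale)
    fix k assume "k \<in> {k. ?c k \<noteq> 0}"
    then have k: "int (\<Sum>i\<in>UNIV. k i) = d" using homp_coeffs_degree[OF assms(1)] by auto
    have "\<exists>i. k i \<ge> card G"
    proof (rule ccontr)
      assume "\<not> (\<exists>i. k i \<ge> card G)"
      then have "(\<Sum>i\<in>UNIV. k i) < (\<Sum>i\<in>(UNIV::'n set). card G)"
        by (intro sum_strict_mono) (auto simp: not_le)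
      then show False using assms(2) k by (simp flip: of_nat_mult of_nat_sum)
    qed
    then obtain i where i: "k i \<ge> card G" ..
    define k' where "k' = k(i := k i - card G)"
    have mon: "monomial k z = monomial k' z * z $ i ^ card G" for z
    proof -
      have "monomial k z = z $ i ^ k i * (\<Prod>j\<in>UNIV - {i}. z $ j ^ k j)"
        by (simp add: monomial_def prod.remove)
      moreover have "monomial k' z = z $ i ^ k' i * (\<Prod>j\<in>UNIV - {i}. z $ j ^ k' j)"
        by (simp add: monomial_def prod.remove)
      moreover have "(\<Prod>j\<in>UNIV - {i}. z $ j ^ k' j) = (\<Prod>j\<in>UNIV - {i}. z $ j ^ k j)"
        by (rule prod.cong) (auto simp: k'_def)
      moreover have "z $ i ^ k i = z $ i ^ k' i * z $ i ^ card G"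
        using i by (simp add: k'_def flip: power_add)
      ultimately show ?thesis by simp
    qed
    have "int (\<Sum>i\<in>UNIV. k' i) = d - int (card G)"
    proof -
      have "(\<Sum>i\<in>UNIV. k i) = k i + (\<Sum>j\<in>UNIV - {i}. k j)" by (simp add: sum.remove)
      moreover have "(\<Sum>i\<in>UNIV. k' i) = k' i + (\<Sum>j\<in>UNIV - {i}. k' j)" by (simp add: sum.remove)
      moreover have "(\<Sum>j\<in>UNIV - {i}. k' j) = (\<Sum>j\<in>UNIV - {i}. k j)"
        by (rule sum.cong) (auto simp: k'_def)
      ultimately show ?thesis using k i by (simp add: k'_def)
    qed
    then show "monomial k \<in> J d"
      using J_mult[OF coord_power_J[of i] monomial_homp[of k']] by (simp add: mon[abs_def])
  qed
  then show ?thesis using c by (simp add: has_coeffs_def)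
qed

text \<open>Steinberg's argument, by downward induction on the degree. If \<open>q\<close> pairs to zero with everything of
  complementary degree, so does its product with a linear form \<open>\<alpha>\<close>, which therefore lies in
  \<open>I(0)\<close>. Antisymmetrizing and cancelling \<open>\<alpha>\<close> shows that \<open>q + s\<^sub>\<alpha> q\<close> lies in \<open>I(0)\<close>. So modulo \<open>I(0)\<close> the
  polynomial \<open>q\<close> is anti-invariant and equals \<open>\<Delta> * B q\<close> up to a constant factor. Here \<open>B q\<close> is an
  invariant of positive degree, or it is a constant that vanishes by assumption, or it has negative
  degree and is zero; in each case \<open>\<Delta> * B q\<close> lies in \<open>I(0)\<close>.\<close>

lemma J_nondegenerate:
  assumes "q \<in> homp d" "\<And>p. p \<in> homp (int (card A) - d) \<Longrightarrow> B (\<lambda>z. p z * q z) 0 = 0"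
  shows "q \<in> J d"
proof -
  define D where "D = int (CARD('n) * card G)"
  have "d \<ge> D - int k \<Longrightarrow> q \<in> homp d \<Longrightarrow> (\<And>p. p \<in> homp (int (card A) - d) \<Longrightarrow> B (\<lambda>z. p z * q z) 0 = 0)
      \<Longrightarrow> q \<in> J d" for k d q
  proof (induction k arbitrary: d q)
    case 0
    then show ?case using high_degree_J by (simp add: D_def)
  next
    case (Suc k)
    have q: "q \<in> polys" using Suc homp_polys by auto
    \<comment> \<open>Modulo \<open>J d\<close> every reflection acts on \<open>q\<close> by \<open>-1\<close>, hence every \<open>g\<close> by its sign.\<close>
    have anti: "(\<lambda>z. q (cmat (refl_mat b) *v z) + q z) \<in> J d" if b: "b \<in> A" for b
    proof (rule J_refl[OF _ b q])
      show "(\<lambda>z. cform (cvec b) z * q z) \<in> J (d + 1)"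
      proof (rule Suc.IH)
        show "D - int k \<le> d + 1" using Suc by simp
        show "(\<lambda>z. cform (cvec b) z * q z) \<in> homp (d + 1)"
          using homp_mult[OF homp_cform Suc.prems(2)] by (simp add: add.commute)
        fix p :: "'n cspace \<Rightarrow> complex" assume "p \<in> homp (int (card A) - (d + 1))"
        from homp_mult[OF this homp_cform[of "cvec b"]]
        have "(\<lambda>z. p z * cform (cvec b) z) \<in> homp (int (card A) - d)" by simp
        from Suc.prems(3)[OF this] show "B (\<lambda>z. p z * (cform (cvec b) z * q z)) 0 = 0"
          by (simp add: mult.assoc)
      qed
    qed
    have gq: "(\<lambda>z. q (cmat g *v z) - of_int (\<epsilon> g) * q z) \<in> J d" if "g \<in> G" for g
      using that
    proof (induction rule: G_induct)
      case one
      then show ?case using J_zero by (simp add: sign_one)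
    next
      case (refl s g)
      then obtain b where b: "b \<in> A" "s = refl_mat b" using reflection_cases by blast
      have "(\<lambda>z. (q (cmat s *v (cmat g *v z)) + q (cmat g *v z)) - (q (cmat g *v z) - of_int (\<epsilon> g) * q z)) \<in> J d"
        using J_diff[OF J_G[OF anti[OF b(1)] refl(2)] refl(3)] b by simp
      then show ?case using b refl by (simp add: sign_mult sign_refl cmat_mult matrix_vector_mul_assoc)
    qed
    have "(\<lambda>z. \<Sum>g\<in>G. of_int (\<epsilon> g) * (q (cmat g *v z) - of_int (\<epsilon> g) * q z)) \<in> J d"
      by (intro J_sum J_scale gq)
    also have "(\<lambda>z. \<Sum>g\<in>G. of_int (\<epsilon> g) * (q (cmat g *v z) - of_int (\<epsilon> g) * q z))
        = (\<lambda>z. asym q z - of_nat (card G) * q z)"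
    proof
      fix z
      have "of_int (\<epsilon> g) * (of_int (\<epsilon> g) * q z) = q z" if "g \<in> G" for g
        using sign_G[OF that] by auto
      then have "(\<Sum>g\<in>G. of_int (\<epsilon> g) * (of_int (\<epsilon> g) * q z)) = (\<Sum>g\<in>G. q z)"
        by (intro sum.cong refl)
      then show "(\<Sum>g\<in>G. of_int (\<epsilon> g) * (q (cmat g *v z) - of_int (\<epsilon> g) * q z))
          = asym q z - of_nat (card G) * q z"
        by (simp add: asym_def right_diff_distrib sum_subtractf)
    qed
    finally have 1: "(\<lambda>z. asym q z - of_nat (card G) * q z) \<in> J d" .
    have Bq: "B q \<in> homp (d - int (card A))" by (rule B_homp) fact
    have "(\<lambda>z. B q z * \<Delta> z) \<in> J d"
    proof (cases "d > int (card A)")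
      case True
      then show ?thesis
        using \<Delta>_homp by (intro J_single[OF B_invariant[OF q] Bq]) auto
    next
      case False
      have "B q z = 0" for z
      proof (cases "d = int (card A)")
        case True
        then have "B (\<lambda>z. 1 * q z) 0 = 0" by (intro Suc.prems(3)) auto
        then show ?thesis using homp_0_const[of "B q" z] Bq True by simp
      next
        case False
        then show ?thesis using homp_neg[OF Bq] \<open>\<not> d > int (card A)\<close> by simp
      qed
      then show ?thesis by (simp add: J_zero)
    qed
    then have "asym q \<in> J d" using B_props(2)[OF q] by (simp add: mult.commute[of "B q _"])
    from J_diff[OF this 1] have "(\<lambda>z. of_nat (card G) * q z) \<in> J d" by simp
    from J_scale[OF this, of "1 / of_nat (card G)"] show ?case
    proof -
      have "of_nat (card G) \<noteq> (0::complex)" using finite_G one_G by auto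
      then have "(\<lambda>z. 1 / of_nat (card G) * (of_nat (card G) * q z)) = q" by simp
      then show ?thesis using \<open>(\<lambda>z. 1 / of_nat (card G) * (of_nat (card G) * q z)) \<in> J d\<close> by simp
    qed
  qed
  from this[of "nat (D - d)" d q] show ?thesis using assms by auto
qed

text \<open>Modulo \<open>I(\<lambda>)\<close> the invariant factors may be replaced by their values at \<open>\<lambda>\<close>, which lowers the degree.\<close>

lemma J_reduce:
  assumes "q \<in> J (int d)"
  shows "\<exists>r\<in>pdeg d. (\<lambda>z. q z - r z) \<in> ideal_at G l"
  using assms
proof (induction rule: J.induct)
  case J_zero
  then show ?case using pdeg_zero ideal_at_zero by (intro bexI[of _ "\<lambda>z. 0"]) auto
next
  case (J_step f a h q)
  then obtain r where r: "r \<in> pdeg d" "(\<lambda>z. q z - r z) \<in> ideal_at G l" by blast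
  have "(\<lambda>z. f l * h z + r z) \<in> pdeg d"
    using J_step(3) by (intro pdeg_add r(1) pdeg_homp[OF homp_scale[OF J_step(4)]]) auto
  moreover have "(\<lambda>z. f z * h z + q z - (f l * h z + r z)) \<in> ideal_at G l"
    using ideal_at_add[OF ideal_at_generator[OF J_step(1) homp_polys[OF J_step(4)], of l] r(2)]
    by (simp add: algebra_simps)
  ultimately show ?case by (intro bexI[of _ "\<lambda>z. f l * h z + r z"])
qed

text \<open>The polynomials that pair to zero with all others form an ideal, and linearity of \<open>B\<close> over the
  invariants puts the generators of \<open>I(\<lambda>)\<close> into it.\<close>

lemma B_mult_ideal:
  assumes "q \<in> ideal_at G l" "p \<in> polys"
  shows "B (\<lambda>z. p z * q z) l = 0"
proof -
  let ?K = "{q \<in> polys. \<forall>p\<in>polys. B (\<lambda>z. p z * q z) l = 0}"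
  have "ideal_at G l \<subseteq> ?K"
  proof (rule ideal_at_subset)
    show "ideal ?K poly_alg"
    proof (rule ideal_poly_algI)
      fix q q' assume *: "q \<in> ?K" "q' \<in> ?K"
      have "B (\<lambda>z. p z * (q z + q' z)) l = 0" if p: "p \<in> polys" for p :: "'n cspace \<Rightarrow> complex"
        using B_add[OF polys_mult[of p q] polys_mult[of p q']] * p by (simp add: distrib_left)
      then show "(\<lambda>z. q z + q' z) \<in> ?K" using * by auto
    next
      fix q h :: "'n cspace \<Rightarrow> complex" assume *: "q \<in> ?K" "h \<in> polys"
      have "B (\<lambda>z. p z * (h z * q z)) l = 0" if p: "p \<in> polys" for p :: "'n cspace \<Rightarrow> complex"
      proof -
        have "(\<lambda>z. p z * h z) \<in> polys" using p * by auto
        then have "B (\<lambda>z. (\<lambda>z. p z * h z) z * q z) l = 0" using *(1) by fast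
        then show ?thesis by (simp add: mult.assoc)
      qed
      then show "(\<lambda>z. h z * q z) \<in> ?K" using * by auto
    qed (auto simp: B_zero)
    fix f assume f: "f \<in> inv_polys G" "f l = 0"
    show "f \<in> ?K" using B_inv_mult[OF f(1)] f inv_polys_polys by (auto simp: mult.commute)
  qed
  then show ?thesis using assms by auto
qed

text \<open>Pairing \<open>q\<close>, of degree at most \<open>d\<close>, with \<open>p\<close> of degree \<open>card A - d\<close> only involves the top part of
  \<open>q\<close>, because \<open>B\<close> kills what has degree less than \<open>card A\<close>; and the result is constant, so it may be
  evaluated at \<open>0\<close> instead of \<open>\<lambda>\<close>. By \<open>J_nondegenerate\<close> the top part lies in \<open>I(0)\<close>, and \<open>J_reduce\<close>
  replaces it by terms of lower degree.\<close>

lemma pdeg_nondegenerate: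
  assumes "q \<in> pdeg d" "\<And>e p. e \<le> card A \<Longrightarrow> p \<in> homp (int e) \<Longrightarrow> B (\<lambda>z. p z * q z) l = 0"
  shows "q \<in> ideal_at G l"
  using assms
proof (induction d arbitrary: q)
  case 0
  then show ?case using ideal_at_zero by (simp add: pdeg_def)
next
  case (Suc d)
  obtain h where h: "\<And>e. h e \<in> homp (int e)" "q = (\<lambda>z. \<Sum>e<Suc d. h e z)"
    using Suc.prems(1) by (auto simp: pdeg_def)
  have hp: "h e \<in> polys" for e using h homp_polys by blast
  have q: "q \<in> polys" using pdeg_polys Suc by blast
  have "h d \<in> J (int d)"
  proof (rule J_nondegenerate[OF h(1)])
    fix p :: "'n cspace \<Rightarrow> complex" assume p: "p \<in> homp (int (card A) - int d)"
    have pp: "p \<in> polys" using p homp_polys by auto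
    show "B (\<lambda>z. p z * h d z) 0 = 0"
    proof (cases "d \<le> card A")
      case False
      then have "p z = 0" for z using homp_neg[OF p] by simp
      then show ?thesis by (simp add: B_zero)
    next
      case True
      then have "B (\<lambda>z. p z * q z) l = 0" using p by (intro Suc.prems(2)[of "card A - d"]) (auto simp: of_nat_diff)
      moreover have "(\<lambda>z. p z * q z) = (\<lambda>z. \<Sum>e<Suc d. p z * h e z)"
        by (simp add: h(2) sum_distrib_left del: sum.lessThan_Suc)
      then have "B (\<lambda>z. p z * q z) = (\<lambda>z. \<Sum>e<Suc d. B (\<lambda>z. p z * h e z) z)"
        using B_sum[of "{..<Suc d}" "\<lambda>e z. p z * h e z"] hp pp by (simp add: polys_mult del: sum.lessThan_Suc)
      moreover have "B (\<lambda>z. p z * h e z) l = 0" if "e < d" for e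
        using homp_neg[OF B_homp[OF homp_mult[OF p h(1)[of e]]]] that by simp
      ultimately have "B (\<lambda>z. p z * h d z) l = 0" by simp
      moreover have "B (\<lambda>z. p z * h d z) \<in> homp 0" using B_homp[OF homp_mult[OF p h(1)[of d]]] by simp
      ultimately show ?thesis using homp_0_const by metis
    qed
  qed
  then obtain r where r: "r \<in> pdeg d" "(\<lambda>z. h d z - r z) \<in> ideal_at G l" using J_reduce by blast
  define q' where "q' = (\<lambda>z. (\<Sum>e<d. h e z) + r z)"
  have q': "q' \<in> pdeg d" unfolding q'_def
    using h(1) r(1) by (intro pdeg_add) (auto simp: pdeg_def)
  have q_eq: "q = (\<lambda>z. q' z + (h d z - r z))" by (simp add: q'_def h(2))
  have "q' \<in> ideal_at G l"
  proof (rule Suc.IH[OF q'])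
    fix e and p :: "'n cspace \<Rightarrow> complex" assume e: "e \<le> card A" "p \<in> homp (int e)"
    then have pp: "p \<in> polys" using homp_polys by auto
    have "B (\<lambda>z. p z * q z) = B (\<lambda>z. p z * q' z + p z * (h d z - r z))"
      by (simp add: q_eq distrib_left)
    also have "\<dots> = (\<lambda>z. B (\<lambda>z. p z * q' z) z + B (\<lambda>z. p z * (h d z - r z)) z)"
      using pp ideal_at_polys[OF r(2)] pdeg_polys[OF q'] by (intro B_add) auto
    finally show "B (\<lambda>z. p z * q' z) l = 0"
      using Suc.prems(2)[OF e] B_mult_ideal[OF r(2) pp] by simp
  qed
  then show ?case unfolding q_eq using r(2) by (intro ideal_at_add)
qed

text \<open>
  Pairings with the finitely many monomials of degree at most \<open>card A\<close> detect membership in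
  \<open>I(\<lambda>)\<close>, because \<open>pdeg_nondegenerate\<close> only pairs with such degrees.
\<close>

definition low_exponents :: "('n \<Rightarrow> nat) set" where
  "low_exponents = {k. (\<Sum>i\<in>UNIV. k i) \<le> card A}"

lemma finite_low_exponents: "finite low_exponents"
proof (rule finite_subset)
  show "low_exponents \<subseteq> {k. \<forall>i. (i \<in> UNIV \<longrightarrow> k i \<in> {..card A}) \<and> (i \<notin> UNIV \<longrightarrow> k i = 0)}"
  proof
    fix k :: "'n \<Rightarrow> nat" assume "k \<in> low_exponents"
    then have "k i \<le> card A" for i
      using member_le_sum[of i UNIV k] by (auto simp: low_exponents_def)
    then show "k \<in> {k. \<forall>i. (i \<in> UNIV \<longrightarrow> k i \<in> {..card A}) \<and> (i \<notin> UNIV \<longrightarrow> k i = 0)}" by auto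
  qed
qed (rule finite_set_of_finite_funs; simp)

lemma ideal_at_monomials:
  assumes "q \<in> polys" "\<And>k. k \<in> low_exponents \<Longrightarrow> B (\<lambda>z. monomial k z * q z) l = 0"
  shows "q \<in> ideal_at G l"
proof -
  obtain N where "q \<in> pdeg N" using polys_homp_sum[OF assms(1)] by (auto simp: pdeg_def)
  then show ?thesis
  proof (rule pdeg_nondegenerate)
    fix e and p :: "'n cspace \<Rightarrow> complex" assume e: "e \<le> card A" "p \<in> homp (int e)"
    let ?c = "poly_coeffs p"
    have c: "has_coeffs p ?c" using e homp_polys has_coeffs_poly_coeffs by auto
    have fin: "finite {k. ?c k \<noteq> 0}" using c by (simp add: has_coeffs_def)
    have "p z * q z = (\<Sum>k | ?c k \<noteq> 0. ?c k * (monomial k z * q z))" for z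
      by (subst has_coeffs_supset[OF c fin order_refl]) (simp add: sum_distrib_left sum_distrib_right mult.assoc)
    then have "B (\<lambda>z. p z * q z) = (\<lambda>z. \<Sum>k | ?c k \<noteq> 0. B (\<lambda>z. ?c k * (monomial k z * q z)) z)"
      using B_sum[OF fin, of "\<lambda>k z. ?c k * (monomial k z * q z)"] assms(1) by (simp add: polys_mult polys_scale polys_monomial)
    then have "B (\<lambda>z. p z * q z) l = (\<Sum>k | ?c k \<noteq> 0. B (\<lambda>z. ?c k * (monomial k z * q z)) l)" by simp
    also have "\<dots> = (\<Sum>k | ?c k \<noteq> 0. 0)"
    proof (rule sum.cong)
      fix k assume k: "k \<in> {k. ?c k \<noteq> 0}"
      then have "k \<in> low_exponents" using homp_coeffs_degree[OF e(2), of k] e(1)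
        unfolding of_nat_eq_iff low_exponents_def by simp
      then show "B (\<lambda>z. ?c k * (monomial k z * q z)) l = 0"
        using assms by (simp add: B_scale polys_mult polys_monomial)
    qed simp
    finally show "B (\<lambda>z. p z * q z) l = 0" by simp
  qed
qed

lemma ideal_at_iff:
  "q \<in> ideal_at G l \<longleftrightarrow> q \<in> polys \<and> (\<forall>p\<in>polys. B (\<lambda>z. p z * q z) l = 0)"
  using ideal_at_monomials[of q l] B_mult_ideal[of q l] ideal_at_polys[of q G l] by (auto intro: polys_monomial)

text \<open>The pairings with the low monomials have only \<open>I(\<lambda>)\<close> as common kernel, so \<open>F\<close> is a combination of
  them.\<close>

lemma functional_representation:
  assumes add: "\<And>p q. p \<in> polys \<Longrightarrow> q \<in> polys \<Longrightarrow> F (\<lambda>z. p z + q z) = F p + F q"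
    and scale: "\<And>c p. p \<in> polys \<Longrightarrow> F (\<lambda>z. c * p z) = c * F p"
    and vanish: "\<And>q. q \<in> ideal_at G l \<Longrightarrow> F q = 0"
  shows "\<exists>r\<in>polys. \<forall>p\<in>polys. F p = B (\<lambda>z. p z * r z) l"
proof -
  have "\<exists>a. \<forall>q\<in>polys. F q = (\<Sum>k\<in>low_exponents. a k * B (\<lambda>z. monomial k z * q z) l)"
  proof (rule functional_in_span[OF finite_low_exponents])
    fix k :: "'n \<Rightarrow> nat"
    have "B (\<lambda>z. monomial k z * (p z + q z)) l = B (\<lambda>z. monomial k z * p z) l + B (\<lambda>z. monomial k z * q z) l"
      if "p \<in> polys" "q \<in> polys" for p q
      using that B_add[of "\<lambda>z. monomial k z * p z" "\<lambda>z. monomial k z * q z"]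
      by (simp add: distrib_left polys_mult polys_monomial)
    moreover have "B (\<lambda>z. monomial k z * (c * p z)) l = c * B (\<lambda>z. monomial k z * p z) l"
      if "p \<in> polys" for c p
      using that B_scale[of "\<lambda>z. monomial k z * p z" c]
      by (simp add: mult.left_commute polys_mult polys_monomial)
    ultimately show "(\<forall>p\<in>polys. \<forall>q\<in>polys. B (\<lambda>z. monomial k z * (p z + q z)) l
          = B (\<lambda>z. monomial k z * p z) l + B (\<lambda>z. monomial k z * q z) l)
      \<and> (\<forall>c. \<forall>p\<in>polys. B (\<lambda>z. monomial k z * (c * p z)) l = c * B (\<lambda>z. monomial k z * p z) l)" by blast
  qed (use add scale vanish ideal_at_monomials in auto)
  then obtain a where a: "\<And>q. q \<in> polys \<Longrightarrow> F q = (\<Sum>k\<in>low_exponents. a k * B (\<lambda>z. monomial k z * q z) l)" by blast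
  define r where "r z = (\<Sum>k\<in>low_exponents. a k * monomial k z)" for z
  have "r \<in> polys" unfolding r_def[abs_def] by (intro polys_sum polys_scale polys_monomial)
  moreover have "F q = B (\<lambda>z. q z * r z) l" if q: "q \<in> polys" for q
  proof -
    have "(\<lambda>z. q z * r z) = (\<lambda>z. \<Sum>k\<in>low_exponents. a k * (monomial k z * q z))"
      by (simp add: r_def sum_distrib_left mult_ac)
    then have "B (\<lambda>z. q z * r z) = (\<lambda>z. \<Sum>k\<in>low_exponents. B (\<lambda>z. a k * (monomial k z * q z)) z)"
      using B_sum[OF finite_low_exponents, of "\<lambda>k z. a k * (monomial k z * q z)"] q
      by (simp add: polys_mult polys_scale polys_monomial)
    then show ?thesis using q by (simp add: a B_scale polys_mult polys_monomial)
  qed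
  ultimately show ?thesis by blast
qed

subsection \<open>Regular points have trivial stabilizer\<close>

text \<open>At a regular point \<open>c\<close> every polynomial that vanishes on the orbit pairs to zero with all others, so
  it lies in \<open>I(c)\<close>. If \<open>k\<close> fixes \<open>c\<close>, differentials of invariants at \<open>c\<close> are invariant under \<open>k\<close>, so the
  differentials of all elements of \<open>I(c)\<close> at \<open>c\<close> vanish on \<open>k u - u\<close>. But a product of affine functions
  that vanish at the points of the orbit, one factor for each, can have a differential at \<open>c\<close> that does
  not vanish there.\<close>

lemma regular_stabilizer:
  assumes c: "c \<in> regular_set A" and k: "k \<in> G" "cmat k *v c = c"
  shows "k = mat 1"
proof (rule ccontr)
  assume "k \<noteq> mat 1"
  have "\<exists>u. cmat k *v u \<noteq> u"
  proof (rule ccontr)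
    assume "\<not> (\<exists>u. cmat k *v u \<noteq> u)"
    then have "cmat k = mat 1" by (simp add: matrix_eq)
    then have "k = mat 1" by (auto simp: cmat_def mat_def vec_eq_iff split: if_splits)
    then show False using \<open>k \<noteq> mat 1\<close> by simp
  qed
  then obtain u where u: "cmat k *v u \<noteq> u" by blast
  define v where "v = cmat k *v u - u"
  obtain \<zeta> where \<zeta>: "cform \<zeta> v \<noteq> 0"
    by (metis cform_commute cform_nondeg right_minus_eq u v_def)
  let ?N = "{q \<in> polys. q c = 0 \<and> (\<exists>D. (q has_derivative D) (at c) \<and> D v = 0)}"
  have sub: "ideal_at G c \<subseteq> ?N"
  proof (rule ideal_at_subset)
    show "ideal ?N poly_alg"
    proof (rule ideal_poly_algI)
      show "(\<lambda>z. 0) \<in> ?N" by (auto intro!: exI[of _ "\<lambda>v. 0"])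
    next
      fix p q assume "p \<in> ?N" "q \<in> ?N"
      then show "(\<lambda>z. p z + q z) \<in> ?N"
        using has_derivative_add[of p _ "at c" q] by fastforce
    next
      fix p q :: "'n cspace \<Rightarrow> complex" assume *: "p \<in> ?N" "q \<in> polys"
      then obtain D where D: "(p has_derivative D) (at c)" "D v = 0" "p c = 0" by auto
      obtain E where E: "(q has_derivative E) (at c)" using polys_has_derivative[OF *(2)] by blast
      have "((\<lambda>z. q z * p z) has_derivative (\<lambda>v. q c * D v + E v * p c)) (at c)"
        by (rule has_derivative_mult[OF E D(1)])
      then show "(\<lambda>z. q z * p z) \<in> ?N" using * D by auto
    qed auto
    fix f assume f: "f \<in> inv_polys G" "f c = 0"
    obtain D where D: "(f has_derivative D) (at c)" using polys_has_derivative[OF inv_polys_polys[OF f(1)]] by blast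
    have "((\<lambda>z. cmat k *v z) has_derivative (\<lambda>z. cmat k *v z)) (at c)"
      by (intro bounded_linear_imp_has_derivative matrix_vector_mul_bounded_linear)
    from has_derivative_compose[OF this, of f D] D k
    have "((\<lambda>z. f (cmat k *v z)) has_derivative (\<lambda>z. D (cmat k *v z))) (at c)" by simp
    then have "(f has_derivative (\<lambda>z. D (cmat k *v z))) (at c)" by (simp only: inv_polys_G[OF f(1) k(1)])
    then have "(\<lambda>z. D (cmat k *v z)) = D" using D has_derivative_unique by blast
    then have "D (cmat k *v u) = D u" by metis
    then have "D v = 0" unfolding v_def using has_derivative_linear[OF D] by (simp add: linear_diff)
    then show "f \<in> ?N" using f D inv_polys_polys by blast
  qed
  define Y where "Y = (\<lambda>g. cmat g *v c) ` G - {c}"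
  have finY: "finite Y" using finite_G by (simp add: Y_def)
  have "\<exists>\<eta>. cform \<eta> (c - y) \<noteq> 0" if "y \<in> Y" for y
  proof -
    have "c - y \<noteq> 0" using that by (auto simp: Y_def)
    then show ?thesis by (metis cform_commute cform_nondeg)
  qed
  then obtain \<eta> where \<eta>: "\<And>y. y \<in> Y \<Longrightarrow> cform (\<eta> y) (c - y) \<noteq> 0" by metis
  define r where "r z = (\<Prod>y\<in>Y. cform (\<eta> y) (z - y))" for z
  define q where "q z = cform \<zeta> (z - c) * r z" for z
  have lin: "(\<lambda>z. cform a (z - b)) \<in> polys" for a b :: "'n cspace"
    by (simp add: cform_linear polys_diff polys_const polys_cform)
  have r: "r \<in> polys" "r c \<noteq> 0" using \<eta> finY lin by (auto simp: r_def[abs_def] prod_zero_iff)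
  have q: "q \<in> polys" using r lin by (auto simp: q_def[abs_def])
  have q0: "q (cmat g *v c) = 0" if "g \<in> G" for g
  proof (cases "cmat g *v c = c")
    case False
    then have "cmat g *v c \<in> Y" using that by (auto simp: Y_def)
    then have "r (cmat g *v c) = 0" unfolding r_def using finY
      by (auto simp: prod_zero_iff intro!: bexI[of _ "cmat g *v c"])
    then show ?thesis by (simp add: q_def)
  qed (simp add: q_def)
  have "B (\<lambda>z. p z * q z) c = 0" if "p \<in> polys" for p
    using that q by (subst B_regular[OF _ c]) (auto simp: asym_def q0)
  then have "q \<in> ideal_at G c" using q ideal_at_iff by blast
  then obtain D where D: "(q has_derivative D) (at c)" "D v = 0" using sub by blast
  obtain E where E: "(r has_derivative E) (at c)" using polys_has_derivative[OF r(1)] by blast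
  have "((\<lambda>z. cform \<zeta> (z - c)) has_derivative (\<lambda>v. cform \<zeta> v)) (at c)"
    by (rule bounded_linear.has_derivative[OF bounded_linear_cform]) (auto intro!: derivative_eq_intros)
  from has_derivative_mult[OF this E]
  have "(q has_derivative (\<lambda>v. cform \<zeta> (c - c) * E v + cform \<zeta> v * r c)) (at c)"
    by (simp add: q_def[abs_def])
  with D(1) have "D = (\<lambda>v. cform \<zeta> (c - c) * E v + cform \<zeta> v * r c)" by (rule has_derivative_unique)
  then show False using D(2) \<zeta> r(2) by simp
qed

end

section \<open>Holomorphic functions of several variables\<close>

text \<open>
  The functions involved live on \<open>V\<close> and on \<open>V \<times> V\<close>; both carry a multiplication by complex
  scalars that extends the real one.
\<close>

locale complex_scaling =
  fixes s :: "complex \<Rightarrow> 'v \<Rightarrow> 'v::euclidean_space"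
  assumes bilinear: "bounded_bilinear s"
    and scaleR: "s (of_real r) v = r *\<^sub>R v"
    and assoc: "s a (s b v) = s (a * b) v"
begin

abbreviation holo :: "('v \<Rightarrow> complex) \<Rightarrow> 'v set \<Rightarrow> bool" where
  "holo \<equiv> holomorphic_wrt s"

definition dd :: "'v \<Rightarrow> ('v \<Rightarrow> complex) \<Rightarrow> 'v \<Rightarrow> complex" where
  "dd v f x = deriv (\<lambda>t. f (x + s t v)) 0"

lemma s_zero [simp]: "s 0 v = 0" "s c 0 = 0"
  using bounded_bilinear.zero_left[OF bilinear] bounded_bilinear.zero_right[OF bilinear] by auto

lemma s_add: "s (a + b) v = s a v + s b v" "s a (v + w) = s a v + s a w"
  using bounded_bilinear.add_left[OF bilinear] bounded_bilinear.add_right[OF bilinear] by auto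

lemma holo_line:
  assumes "(f has_derivative f') (at (x + s t v))" "\<And>c v. f' (s c v) = c * f' v"
  shows "((\<lambda>t. f (x + s t v)) has_field_derivative f' v) (at t)"
proof -
  have "((\<lambda>t. x + s t v) has_derivative (\<lambda>h. s h v)) (at t)"
    by (auto intro!: derivative_eq_intros bounded_linear.has_derivative[OF bounded_bilinear.bounded_linear_left[OF bilinear]])
  from has_derivative_compose[OF this assms(1)]
  have "((\<lambda>t. f (x + s t v)) has_derivative (\<lambda>h. f' (s h v))) (at t)" .
  then show ?thesis by (simp add: has_field_derivative_def assms(2) mult_commute_abs)
qed

lemma dd_eq:
  assumes "(f has_derivative f') (at x)" "\<And>c v. f' (s c v) = c * f' v"
  shows "dd v f x = f' v"
  unfolding dd_def by (rule DERIV_imp_deriv) (rule holo_line, use assms in auto)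

lemma holo_has_derivative:
  assumes "holo f W" "x \<in> W"
  shows "(f has_derivative (\<lambda>v. dd v f x)) (at x)" "dd (s c v) f x = c * dd v f x"
    "dd (v + w) f x = dd v f x + dd w f x" "bounded_linear (\<lambda>v. dd v f x)"
proof -
  obtain f' where f': "(f has_derivative f') (at x)" "\<And>c v. f' (s c v) = c * f' v"
    using assms unfolding holomorphic_wrt_def by blast
  have eq: "(\<lambda>v. dd v f x) = f'" using dd_eq[OF f'] by auto
  show 1: "(f has_derivative (\<lambda>v. dd v f x)) (at x)" unfolding eq by (rule f')
  show "dd (s c v) f x = c * dd v f x" using f' by (simp add: dd_eq[OF f'])
  show "dd (v + w) f x = dd v f x + dd w f x"
    by (rule linear_add[OF has_derivative_linear[OF 1]])
  show "bounded_linear (\<lambda>v. dd v f x)" by (rule has_derivative_bounded_linear[OF 1])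
qed

lemma holo_line_dd:
  assumes "holo f W" "x + s t v \<in> W"
  shows "((\<lambda>t. f (x + s t v)) has_field_derivative dd v f (x + s t v)) (at t)"
  by (rule holo_line[OF holo_has_derivative(1)[OF assms]]) (rule holo_has_derivative(2)[OF assms])

lemma holo_continuous: "holo f W \<Longrightarrow> continuous_on W f"
  by (meson continuous_at_imp_continuous_on has_derivative_continuous holo_has_derivative(1))

lemma holo_subset: "holo f W \<Longrightarrow> W' \<subseteq> W \<Longrightarrow> holo f W'"
  by (auto simp: holomorphic_wrt_def)

lemma holo_local: "(\<And>x. x \<in> W \<Longrightarrow> \<exists>W'. x \<in> W' \<and> holo f W') \<Longrightarrow> holo f W"
  unfolding holomorphic_wrt_def by meson

lemma holo_cong:
  assumes "holo f W" "open W" "\<And>x. x \<in> W \<Longrightarrow> f x = g x"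
  shows "holo g W"
  unfolding holomorphic_wrt_def
proof
  fix x assume x: "x \<in> W"
  obtain f' where f': "(f has_derivative f') (at x)" "\<forall>c v. f' (s c v) = c * f' v"
    using assms(1) x unfolding holomorphic_wrt_def by blast
  have "(g has_derivative f') (at x)"
    by (rule has_derivative_transform_within_open[OF f'(1) assms(2) x assms(3)])
  with f'(2) show "\<exists>f'. (g has_derivative f') (at x) \<and> (\<forall>c v. f' (s c v) = c * f' v)" by blast
qed

lemma dd_cong:
  assumes "open W" "x \<in> W" "\<And>x. x \<in> W \<Longrightarrow> f x = g x"
  shows "dd v f x = dd v g x"
  unfolding dd_def
proof (rule deriv_cong_ev[OF _ refl])
  have "continuous_on UNIV (\<lambda>t. x + s t v)"
    by (intro continuous_intros bounded_linear.continuous_on[OF bounded_bilinear.bounded_linear_left[OF bilinear]])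
  then have "open ((\<lambda>t. x + s t v) -` W)" using assms(1) by (rule open_vimage[rotated])
  then have "\<forall>\<^sub>F t in nhds 0. t \<in> (\<lambda>t. x + s t v) -` W"
    using assms(2) by (intro eventually_nhds_in_open) auto
  then show "\<forall>\<^sub>F t in nhds 0. f (x + s t v) = g (x + s t v)"
    by eventually_elim (use assms(3) in auto)
qed

lemma holo_const: "holo (\<lambda>x. c) W"
  unfolding holomorphic_wrt_def by (auto intro!: exI[of _ "\<lambda>v. 0"])

lemma holo_add:
  assumes "holo f W" "holo g W"
  shows "holo (\<lambda>x. f x + g x) W" "x \<in> W \<Longrightarrow> dd v (\<lambda>x. f x + g x) x = dd v f x + dd v g x"
proof -
  have 1: "((\<lambda>x. f x + g x) has_derivative (\<lambda>v. dd v f x + dd v g x)) (at x)"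
    "dd (s c v) f x + dd (s c v) g x = c * (dd v f x + dd v g x)" if "x \<in> W" for x c v
    using holo_has_derivative(1,2)[OF assms(1) that] holo_has_derivative(1,2)[OF assms(2) that]
    by (auto intro!: has_derivative_add simp: algebra_simps)
  show "holo (\<lambda>x. f x + g x) W" unfolding holomorphic_wrt_def using 1 by blast
  show "x \<in> W \<Longrightarrow> dd v (\<lambda>x. f x + g x) x = dd v f x + dd v g x" by (rule dd_eq) (use 1 in auto)
qed

lemma holo_mult:
  assumes "holo f W" "holo g W"
  shows "holo (\<lambda>x. f x * g x) W" "x \<in> W \<Longrightarrow> dd v (\<lambda>x. f x * g x) x = f x * dd v g x + dd v f x * g x"
proof -
  have 1: "((\<lambda>x. f x * g x) has_derivative (\<lambda>v. f x * dd v g x + dd v f x * g x)) (at x)"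
    "f x * dd (s c v) g x + dd (s c v) f x * g x = c * (f x * dd v g x + dd v f x * g x)" if "x \<in> W" for x c v
    by (rule has_derivative_mult[OF holo_has_derivative(1)[OF assms(1) that] holo_has_derivative(1)[OF assms(2) that]])
       (simp add: holo_has_derivative(2)[OF assms(1) that] holo_has_derivative(2)[OF assms(2) that] algebra_simps)
  show "holo (\<lambda>x. f x * g x) W" unfolding holomorphic_wrt_def using 1 by blast
  show "x \<in> W \<Longrightarrow> dd v (\<lambda>x. f x * g x) x = f x * dd v g x + dd v f x * g x"
    by (rule dd_eq) (use 1 in auto)
qed

lemma holo_scale: "holo f W \<Longrightarrow> holo (\<lambda>x. c * f x) W"
  by (intro holo_mult holo_const)

lemma holo_diff: "holo f W \<Longrightarrow> holo g W \<Longrightarrow> holo (\<lambda>x. f x - g x) W"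
  using holo_add(1)[OF _ holo_scale[of g W "-1"]] by simp

lemma holo_sum: "(\<And>i. i \<in> I \<Longrightarrow> holo (f i) W) \<Longrightarrow> holo (\<lambda>x. \<Sum>i\<in>I. f i x) W"
  by (induction I rule: infinite_finite_induct) (auto intro: holo_const holo_add)

lemma holo_compose_field:
  assumes "holo f W" "\<And>x. x \<in> W \<Longrightarrow> (h has_field_derivative h' x) (at (f x))"
  shows "holo (\<lambda>x. h (f x)) W"
  unfolding holomorphic_wrt_def
proof
  fix x assume x: "x \<in> W"
  have "((\<lambda>x. h (f x)) has_derivative (\<lambda>v. h' x * dd v f x)) (at x)"
    using has_derivative_compose[OF holo_has_derivative(1)[OF assms(1) x]] assms(2)[OF x]
    by (auto simp: has_field_derivative_def)
  then show "\<exists>f'. ((\<lambda>x. h (f x)) has_derivative f') (at x) \<and> (\<forall>c v. f' (s c v) = c * f' v)"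
    using holo_has_derivative(2)[OF assms(1) x] by (intro exI[of _ "\<lambda>v. h' x * dd v f x"]) auto
qed

lemma holo_inverse: "holo f W \<Longrightarrow> (\<And>x. x \<in> W \<Longrightarrow> f x \<noteq> 0) \<Longrightarrow> holo (\<lambda>x. inverse (f x)) W"
  by (rule holo_compose_field[where h' = "\<lambda>x. - (inverse (f x) * inverse (f x))"])
     (auto intro!: derivative_eq_intros simp: power2_eq_square)

lemma holo_divide: "holo f W \<Longrightarrow> holo g W \<Longrightarrow> (\<And>x. x \<in> W \<Longrightarrow> g x \<noteq> 0) \<Longrightarrow> holo (\<lambda>x. f x / g x) W"
  unfolding divide_inverse by (intro holo_mult holo_inverse)

lemma holo_exp: "holo f W \<Longrightarrow> holo (\<lambda>x. exp (f x)) W"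
  by (rule holo_compose_field[where h' = "\<lambda>x. exp (f x)"]) (auto intro!: derivative_eq_intros)

lemma holo_linear:
  assumes "bounded_linear f" "\<And>c v. f (s c v) = c * f v"
  shows "holo f W"
  unfolding holomorphic_wrt_def using assms bounded_linear_imp_has_derivative by blast

text \<open>
  Differentiation under the integral sign. The partial derivatives are required to be jointly
  continuous because a complex derivative at every point does not provide this by definition.
\<close>

lemma holo_integral:
  assumes U: "open U" "convex U"
    and holo: "\<And>\<theta>. \<theta> \<in> {0..1::real} \<Longrightarrow> holo (\<lambda>x. F x \<theta>) U"
    and cont: "continuous_on (U \<times> {0..1}) (\<lambda>(x, \<theta>). F x \<theta>)"
    and cont': "\<And>v. continuous_on (U \<times> {0..1}) (\<lambda>(x, \<theta>). dd v (\<lambda>x. F x \<theta>) x)"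
  shows "holo (\<lambda>x. integral {0..1} (F x)) U"
    "x \<in> U \<Longrightarrow> dd v (\<lambda>x. integral {0..1} (F x)) x = integral {0..1} (\<lambda>\<theta>. dd v (\<lambda>x. F x \<theta>) x)"
proof -
  have main: "\<exists>f'. ((\<lambda>x. integral {0..1} (F x)) has_derivative f') (at x0) \<and> (\<forall>c v. f' (s c v) = c * f' v)
      \<and> (\<forall>v. f' v = integral {0..1} (\<lambda>\<theta>. dd v (\<lambda>x. F x \<theta>) x0))" if x0: "x0 \<in> U" for x0
  proof -
  define fx where "fx x \<theta> = Blinfun (\<lambda>v. dd v (\<lambda>x. F x \<theta>) x)" for x \<theta>
  have fx: "blinfun_apply (fx x \<theta>) = (\<lambda>v. dd v (\<lambda>x. F x \<theta>) x)" if "x \<in> U" "\<theta> \<in> {0..1}" for x \<theta>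
    unfolding fx_def using holo_has_derivative(4)[OF holo[OF that(2)] that(1)]
    by (rule bounded_linear_Blinfun_apply)
  have cfx: "continuous_on (U \<times> {0..1}) (\<lambda>(x, \<theta>). fx x \<theta>)"
  proof (rule continuous_on_blinfun_componentwise)
    fix i :: 'v
    show "continuous_on (U \<times> {0..1}) (\<lambda>x. blinfun_apply (case x of (x, \<theta>) \<Rightarrow> fx x \<theta>) i)"
      by (rule continuous_on_eq[OF cont'[of i]]) (auto simp: fx)
  qed
  have slice: "continuous_on {0..1} (\<lambda>\<theta>. H x0 \<theta>)" if "continuous_on (U \<times> {0..1}) (\<lambda>(x, \<theta>). H x \<theta>)"
    for H :: "'v \<Rightarrow> real \<Rightarrow> 'b::real_normed_vector"
  proof -
    have "continuous_on {0..1} (\<lambda>\<theta>. (x0, \<theta> :: real))" by (intro continuous_on_Pair continuous_on_const continuous_on_id)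
    from continuous_on_compose2[OF that this] x0 show ?thesis by auto
  qed
  have "((\<lambda>x. integral (cbox 0 1) (F x)) has_derivative integral (cbox 0 1) (fx x0)) (at x0 within U)"
  proof (rule leibniz_rule[OF _ _ _ x0 U(2)])
    fix x \<theta> assume *: "x \<in> U" "\<theta> \<in> cbox (0::real) 1"
    then show "((\<lambda>x. F x \<theta>) has_derivative blinfun_apply (fx x \<theta>)) (at x within U)"
      using holo_has_derivative(1)[OF holo, of \<theta> x] by (auto simp: fx intro: has_derivative_at_withinI)
  next
    fix x assume "x \<in> U"
    have "continuous_on {0..1} (\<lambda>\<theta>. (x, \<theta> :: real))" by (intro continuous_on_Pair continuous_on_const continuous_on_id)
    from continuous_on_compose2[OF cont this] \<open>x \<in> U\<close> have "continuous_on {0..1} (F x)" by auto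
    then show "F x integrable_on cbox 0 1" by (simp add: integrable_continuous_interval)
  qed (use cfx in auto)
  then have 1: "((\<lambda>x. integral {0..1} (F x)) has_derivative integral {0..1} (fx x0)) (at x0)"
    unfolding at_within_open[OF x0 U(1)] cbox_interval .
  have int: "fx x0 integrable_on {0..1}"
    by (intro integrable_continuous_interval slice cfx)
  have app: "blinfun_apply (integral {0..1} (fx x0)) v = integral {0..1} (\<lambda>\<theta>. dd v (\<lambda>x. F x \<theta>) x0)" for v
    unfolding blinfun_apply_integral[OF int]
    by (rule integral_cong) (simp add: fx x0)
  have "blinfun_apply (integral {0..1} (fx x0)) (s c v) = c * blinfun_apply (integral {0..1} (fx x0)) v" for c v
  proof -
    have "integral {0..1} (\<lambda>\<theta>. dd (s c v) (\<lambda>x. F x \<theta>) x0) = integral {0..1} (\<lambda>\<theta>. c * dd v (\<lambda>x. F x \<theta>) x0)"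
      by (rule integral_cong) (use holo_has_derivative(2)[OF holo x0] in auto)
    also have "\<dots> = c * integral {0..1} (\<lambda>\<theta>. dd v (\<lambda>x. F x \<theta>) x0)" by simp
    finally show ?thesis by (simp add: app)
  qed
  with 1 app show ?thesis by blast
  qed
  then show "holo (\<lambda>x. integral {0..1} (F x)) U" unfolding holomorphic_wrt_def by blast
  show "dd v (\<lambda>x. integral {0..1} (F x)) x = integral {0..1} (\<lambda>\<theta>. dd v (\<lambda>x. F x \<theta>) x)" if "x \<in> U"
    using main[OF that] dd_eq by metis
qed

definition circ :: "real \<Rightarrow> real \<Rightarrow> complex" where
  "circ \<rho> \<theta> = of_real \<rho> * exp (2 * of_real pi * \<i> * of_real \<theta>)"

lemma circ_cont [continuous_intros]: "continuous_on S f \<Longrightarrow> continuous_on S (\<lambda>x. circ \<rho> (f x))"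
  unfolding circ_def by (intro continuous_intros)

lemma norm_circ: "\<rho> > 0 \<Longrightarrow> norm (circ \<rho> \<theta>) = \<rho>"
  by (simp add: circ_def norm_mult norm_exp)

text \<open>Cauchy's formula for the derivative on the complex line through \<open>x\<close> in direction \<open>v\<close>; one of the two
  factors of the denominator is absorbed by the derivative of the parametrized circle.\<close>

lemma dd_Cauchy:
  assumes "holo f W" "\<rho> > 0" "\<And>t. norm t \<le> \<rho> \<Longrightarrow> x + s t v \<in> W"
  shows "dd v f x = integral {0..1} (\<lambda>\<theta>. f (x + s (circ \<rho> \<theta>) v) / circ \<rho> \<theta>)"
proof -
  let ?g = "\<lambda>t. f (x + s t v)"
  have D: "(?g has_field_derivative dd v f (x + s t v)) (at t)" if "norm t \<le> \<rho>" for t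
    by (rule holo_line_dd[OF assms(1) assms(3)[OF that]])
  have "continuous_on (cball 0 \<rho>) ?g"
    by (intro continuous_at_imp_continuous_on ballI) (rule DERIV_isCont[OF D], simp)
  moreover have "?g holomorphic_on ball 0 \<rho>"
    unfolding holomorphic_on_def field_differentiable_def
    by (intro ballI exI, rule has_field_derivative_at_within[OF D]) simp
  ultimately have "(?g has_field_derivative (1 / (2 * of_real pi * \<i>) *
      contour_integral (circlepath 0 \<rho>) (\<lambda>u. ?g u / (u - 0)^2))) (at 0)"
    using assms(2) by (intro Cauchy_derivative_integral_circlepath) auto
  then have "dd v f x = 1 / (2 * of_real pi * \<i>) *
      contour_integral (circlepath 0 \<rho>) (\<lambda>u. ?g u / u^2)"
    unfolding dd_def by (simp add: DERIV_imp_deriv)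
  also have "contour_integral (circlepath 0 \<rho>) (\<lambda>u. ?g u / u^2)
      = integral {0..1} (\<lambda>\<theta>. (2 * of_real pi * \<i>) * (?g (circ \<rho> \<theta>) / circ \<rho> \<theta>))"
    unfolding contour_integral_integral
  proof (rule integral_cong)
    fix \<theta> :: real assume "\<theta> \<in> {0..1}"
    have "circlepath 0 \<rho> \<theta> = circ \<rho> \<theta>" by (simp add: circlepath circ_def mult_ac)
    moreover have "vector_derivative (circlepath 0 \<rho>) (at \<theta>) = 2 * of_real pi * \<i> * circ \<rho> \<theta>"
      by (simp add: vector_derivative_circlepath circ_def mult_ac)
    moreover have "circ \<rho> \<theta> \<noteq> 0" using assms(2) by (simp add: circ_def)
    ultimately show "?g (circlepath 0 \<rho> \<theta>) / (circlepath 0 \<rho> \<theta>)^2 * vector_derivative (circlepath 0 \<rho>) (at \<theta>)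
        = (2 * of_real pi * \<i>) * (?g (circ \<rho> \<theta>) / circ \<rho> \<theta>)"
      by (simp add: power2_eq_square)
  qed
  also have "integral {0..1} (\<lambda>\<theta>. (2 * of_real pi * \<i>) * (?g (circ \<rho> \<theta>) / circ \<rho> \<theta>))
      = (2 * of_real pi * \<i>) * integral {0..1} (\<lambda>\<theta>. ?g (circ \<rho> \<theta>) / circ \<rho> \<theta>)"
    by (rule integral_mult_right)
  finally show ?thesis by (simp only: mult.assoc[symmetric]) simp
qed

lemma s_bound: "\<exists>K>0. \<forall>t v. norm (s t v) \<le> norm t * norm v * K"
  using bounded_bilinear.pos_bounded[OF bilinear] by blast

lemma circle_nbhd:
  assumes "open W" "x0 \<in> W"
  shows "\<exists>r>0. \<exists>\<rho>>0. \<forall>x\<in>ball x0 r. \<forall>t. norm t \<le> \<rho> \<longrightarrow> x + s t v \<in> W"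
proof -
  obtain e where e: "e > 0" "ball x0 e \<subseteq> W" using assms by (meson open_contains_ball)
  obtain K where K: "K > 0" "\<And>t v. norm (s t v) \<le> norm t * norm v * K" using s_bound by blast
  define P where "P = norm v * K + 1"
  define \<rho> where "\<rho> = e / (2 * P)"
  have pos: "P > 0" using K(1) by (simp add: P_def add_nonneg_pos)
  have "\<rho> > 0" using e(1) pos by (simp add: \<rho>_def)
  moreover have "x + s t v \<in> W" if "x \<in> ball x0 (e/2)" "norm t \<le> \<rho>" for x t
  proof -
    have "norm (s t v) \<le> norm t * (norm v * K)" using K(2)[of t v] by (simp add: mult.assoc)
    also have "\<dots> \<le> \<rho> * (norm v * K)" using that K(1) by (intro mult_right_mono) auto
    also have "\<dots> \<le> \<rho> * P" using \<open>\<rho> > 0\<close> by (intro mult_left_mono) (auto simp: P_def)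
    also have "\<dots> = e / 2" using pos by (simp add: \<rho>_def)
    finally have "dist x (x + s t v) \<le> e / 2" by (simp add: dist_norm)
    then have "dist x0 (x + s t v) < e" using that(1) dist_triangle[of x0 "x + s t v" x] by simp
    then show ?thesis using e(2) by auto
  qed
  ultimately show ?thesis using e(1) by (intro exI[of _ "e/2"] conjI exI[of _ \<rho>]) auto
qed

text \<open>Cauchy's formula expresses the derivative through values of \<open>f\<close>, which is continuous.\<close>

lemma dd_continuous:
  assumes "open W" "holo f W"
  shows "continuous_on W (dd v f)"
proof -
  have "continuous (at x0) (dd v f)" if x0: "x0 \<in> W" for x0
  proof -
    obtain r \<rho> where r: "r > 0" "\<rho> > 0" "\<And>x t. x \<in> ball x0 r \<Longrightarrow> norm t \<le> \<rho> \<Longrightarrow> x + s t v \<in> W"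
      using circle_nbhd[OF assms(1) x0, of v] by blast
    have "continuous_on (ball x0 r) (\<lambda>x. integral (cbox 0 1) (\<lambda>\<theta>. f (x + s (circ \<rho> \<theta>) v) / circ \<rho> \<theta>))"
    proof (rule integral_continuous_on_param)
      have "continuous_on (ball x0 r \<times> cbox 0 1) (\<lambda>z. f (fst z + s (circ \<rho> (snd z)) v) / circ \<rho> (snd z))"
        using r by (intro continuous_intros continuous_on_compose2[OF holo_continuous[OF assms(2)]]
            bounded_linear.continuous_on[OF bounded_bilinear.bounded_linear_left[OF bilinear]])
          (auto simp: norm_circ, auto simp: circ_def)
      then show "continuous_on (ball x0 r \<times> cbox 0 1) (\<lambda>(x, \<theta>). f (x + s (circ \<rho> \<theta>) v) / circ \<rho> \<theta>)"
        by (simp add: case_prod_beta)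
    qed
    then have "continuous_on (ball x0 r) (dd v f)"
      by (rule continuous_on_eq) (subst dd_Cauchy[OF assms(2) r(2)], use r in auto)
    then show ?thesis using r(1) by (simp add: continuous_on_eq_continuous_at)
  qed
  then show ?thesis by (simp add: continuous_at_imp_continuous_on)
qed

lemma dd_shift: "dd w (\<lambda>x. f (x + a)) x = dd w f (x + a)"
  unfolding dd_def by (simp add: add_ac)

lemma holo_shift:
  assumes "holo f W" "\<And>x. x \<in> U \<Longrightarrow> x + a \<in> W"
  shows "holo (\<lambda>x. f (x + a)) U"
  unfolding holomorphic_wrt_def
proof
  fix x assume x: "x \<in> U"
  have "((\<lambda>x. f (x + a)) has_derivative (\<lambda>v. dd v f (x + a))) (at x)"
  proof -
    have "((\<lambda>x. x + a) has_derivative (\<lambda>h. h)) (at x)" by (auto intro!: derivative_eq_intros)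
    from has_derivative_compose[OF this holo_has_derivative(1)[OF assms(1) assms(2)[OF x]]] show ?thesis .
  qed
  then show "\<exists>f'. ((\<lambda>x. f (x + a)) has_derivative f') (at x) \<and> (\<forall>c v. f' (s c v) = c * f' v)"
    using holo_has_derivative(2)[OF assms(1) assms(2)[OF x]] by blast
qed

text \<open>
  Differentiating Cauchy's formula under the integral sign shows that derivatives of holomorphic
  functions are holomorphic. The integral obtained for a second derivative is again a Cauchy
  integral, which makes derivatives commute.
\<close>

lemma dd_local:
  assumes "open W" "holo f W" "x0 \<in> W"
  shows "\<exists>r>0. \<exists>\<rho>>0. holo (dd v f) (ball x0 r) \<and> (\<forall>t. norm t \<le> \<rho> \<longrightarrow> x0 + s t v \<in> W)
    \<and> dd w (dd v f) x0 = integral {0..1} (\<lambda>\<theta>. dd w f (x0 + s (circ \<rho> \<theta>) v) / circ \<rho> \<theta>)"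
proof -
  obtain r \<rho> where r: "r > 0" "\<rho> > 0" "\<And>x t. x \<in> ball x0 r \<Longrightarrow> norm t \<le> \<rho> \<Longrightarrow> x + s t v \<in> W"
    using circle_nbhd[OF assms(1,3), of v] by blast
  have nz: "circ \<rho> \<theta> \<noteq> 0" for \<theta> using r(2) by (simp add: circ_def)
  have inW: "x + s (circ \<rho> \<theta>) v \<in> W" if "x \<in> ball x0 r" for x \<theta>
    using r(3)[OF that] norm_circ[OF r(2)] by simp
  have holo1: "holo (\<lambda>x. f (x + s (circ \<rho> \<theta>) v)) (ball x0 r)" for \<theta>
    by (rule holo_shift[OF assms(2)]) (rule inW)
  have dd1: "dd w (\<lambda>x. f (x + s (circ \<rho> \<theta>) v) / circ \<rho> \<theta>) x = dd w f (x + s (circ \<rho> \<theta>) v) / circ \<rho> \<theta>"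
    if "x \<in> ball x0 r" for w \<theta> x
  proof -
    have "dd w (\<lambda>x. f (x + s (circ \<rho> \<theta>) v) * (1 / circ \<rho> \<theta>)) x
      = f (x + s (circ \<rho> \<theta>) v) * dd w (\<lambda>x. 1 / circ \<rho> \<theta>) x + dd w (\<lambda>x. f (x + s (circ \<rho> \<theta>) v)) x * (1 / circ \<rho> \<theta>)"
      by (rule holo_mult(2)[OF holo1 holo_const that])
    then show ?thesis by (simp add: dd_shift) (simp add: dd_def)
  qed
  have cont: "continuous_on (ball x0 r \<times> {0..1}) (\<lambda>(x, \<theta>). g (x + s (circ \<rho> \<theta>) v) / circ \<rho> \<theta>)"
    if "continuous_on W g" for g :: "'v \<Rightarrow> complex"
    unfolding case_prod_beta
    using inW nz by (intro continuous_intros continuous_on_compose2[OF that]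
            bounded_linear.continuous_on[OF bounded_bilinear.bounded_linear_left[OF bilinear]]) auto
  let ?I = "\<lambda>x. integral {0..1} (\<lambda>\<theta>. f (x + s (circ \<rho> \<theta>) v) / circ \<rho> \<theta>)"
  have holoF: "holo (\<lambda>x. f (x + s (circ \<rho> \<theta>) v) / circ \<rho> \<theta>) (ball x0 r)" for \<theta>
    by (intro holo_divide holo1 holo_const nz)
  have contF: "continuous_on (ball x0 r \<times> {0..1}) (\<lambda>(x, \<theta>). f (x + s (circ \<rho> \<theta>) v) / circ \<rho> \<theta>)"
    by (rule cont[OF holo_continuous[OF assms(2)]])
  have contF': "continuous_on (ball x0 r \<times> {0..1}) (\<lambda>(x, \<theta>). dd w (\<lambda>x. f (x + s (circ \<rho> \<theta>) v) / circ \<rho> \<theta>) x)" for w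
    by (rule continuous_on_eq[OF cont[OF dd_continuous[OF assms(1,2)]]]) (auto simp: dd1)
  note I = holo_integral[OF open_ball convex_ball holoF contF contF']
  have eq: "?I x = dd v f x" if "x \<in> ball x0 r" for x
    by (rule dd_Cauchy[OF assms(2) r(2), symmetric]) (rule r(3)[OF that])
  have "holo (dd v f) (ball x0 r)"
    by (rule holo_cong[OF I(1) open_ball eq])
  moreover have "dd w (dd v f) x0 = dd w ?I x0"
    by (rule dd_cong[OF open_ball, of x0 x0 r]) (use r(1) eq in auto)
  then have *: "dd w (dd v f) x0 = integral {0..1} (\<lambda>\<theta>. dd w f (x0 + s (circ \<rho> \<theta>) v) / circ \<rho> \<theta>)"
    using I(2)[of x0 w] dd1 r(1) by simp
  moreover have "\<forall>t. norm t \<le> \<rho> \<longrightarrow> x0 + s t v \<in> W" using r(1,3) by simp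
  ultimately show ?thesis using r(1,2) by (intro exI[of _ r] exI[of _ \<rho>] conjI)
qed

theorem holo_dd:
  assumes "open W" "holo f W"
  shows "holo (dd v f) W"
proof (rule holo_local)
  fix x0 assume x0: "x0 \<in> W"
  then obtain r where "r > 0" "holo (dd v f) (ball x0 r)" using dd_local[OF assms x0, of v] by blast
  then show "\<exists>W'. x0 \<in> W' \<and> holo (dd v f) W'" by (intro exI[of _ "ball x0 r"]) auto
qed

lemma dd_commute:
  assumes "open W" "holo f W" "x \<in> W"
  shows "dd w (dd v f) x = dd v (dd w f) x"
proof -
  obtain \<rho> where \<rho>: "\<rho> > 0" "\<And>t. norm t \<le> \<rho> \<Longrightarrow> x + s t v \<in> W"
    "dd w (dd v f) x = integral {0..1} (\<lambda>\<theta>. dd w f (x + s (circ \<rho> \<theta>) v) / circ \<rho> \<theta>)"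
    using dd_local[OF assms, of v w] by blast
  then show ?thesis using dd_Cauchy[OF holo_dd[OF assms(1,2)] \<rho>(1,2), of w] by simp
qed

lemma holo_linear_sub:
  assumes "holo g W'" "bounded_linear T" "\<And>c v. T (s c v) = s c (T v)" "\<And>x. x \<in> W \<Longrightarrow> T x \<in> W'"
  shows "holo (\<lambda>x. g (T x)) W" "x \<in> W \<Longrightarrow> dd w (\<lambda>x. g (T x)) x = dd (T w) g (T x)"
proof -
  have 1: "((\<lambda>x. g (T x)) has_derivative (\<lambda>v. dd (T v) g (T x))) (at x)"
    "dd (T (s c v)) g (T x) = c * dd (T v) g (T x)" if "x \<in> W" for x c v
    using has_derivative_compose[OF bounded_linear_imp_has_derivative[OF assms(2)] holo_has_derivative(1)[OF assms(1) assms(4)[OF that]]]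
      holo_has_derivative(2)[OF assms(1) assms(4)[OF that]] assms(3) by auto
  show "holo (\<lambda>x. g (T x)) W" unfolding holomorphic_wrt_def using 1 by blast
  show "x \<in> W \<Longrightarrow> dd w (\<lambda>x. g (T x)) x = dd (T w) g (T x)" by (rule dd_eq) (use 1 in auto)
qed

text \<open>
  Hadamard's lemma: integrate the derivative in direction \<open>a\<close> along the segment from the projection of
  \<open>x\<close> to the hyperplane \<open>lf = 0\<close> up to \<open>x\<close>.
\<close>

theorem holo_divisible:
  assumes f: "holo f UNIV" and lf: "bounded_linear lf" "\<And>c v. lf (s c v) = c * lf v" "lf a = 1"
    and zero: "\<And>x. lf x = 0 \<Longrightarrow> f x = 0"
  shows "\<exists>h. holo h UNIV \<and> (\<forall>x. f x = lf x * h x)"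
proof -
  define T where "T \<theta> x = x + s (of_real (\<theta> - 1) * lf x) a" for \<theta> :: real and x
  have T_lin: "bounded_linear (T \<theta>)" for \<theta>
    unfolding T_def using lf(1)
    by (intro bounded_linear_add bounded_linear_ident bounded_linear_compose[OF bounded_bilinear.bounded_linear_left[OF bilinear]]
        bounded_linear_const_mult)
  have T_s: "T \<theta> (s c v) = s c (T \<theta> v)" for \<theta> c v
    by (simp add: T_def lf(2) s_add assoc mult_ac)
  have T_cont: "continuous_on S (\<lambda>z. T (snd z) (fst z))" for S
    unfolding T_def
    by (intro continuous_intros bounded_linear.continuous_on[OF bounded_bilinear.bounded_linear_left[OF bilinear]]
        bounded_linear.continuous_on[OF lf(1)])
  define g where "g = dd a f"
  have g: "holo g UNIV" unfolding g_def by (rule holo_dd[OF _ f]) auto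
  define h where "h x = integral {0..1} (\<lambda>\<theta>. g (T \<theta> x))" for x
  have "holo h UNIV"
    unfolding h_def
  proof (rule holo_integral)
    show "holo (\<lambda>x. g (T \<theta> x)) UNIV" for \<theta>
      by (rule holo_linear_sub[OF g T_lin T_s]) simp
    show "continuous_on (UNIV \<times> {0..1}) (\<lambda>(x, \<theta>). g (T \<theta> x))"
      unfolding case_prod_beta
      by (rule continuous_on_compose2[OF holo_continuous[OF g] T_cont]) auto
    show "continuous_on (UNIV \<times> {0..1}) (\<lambda>(x, \<theta>). dd w (\<lambda>x. g (T \<theta> x)) x)" for w
    proof -
      have "dd w (\<lambda>x. g (T \<theta> x)) x = dd w g (T \<theta> x) + of_real (\<theta> - 1) * lf w * dd a g (T \<theta> x)" for x \<theta>
        unfolding holo_linear_sub(2)[OF g T_lin T_s UNIV_I UNIV_I]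
        by (simp add: T_def holo_has_derivative(2,3)[OF g UNIV_I])
      moreover have "continuous_on (UNIV \<times> {0..1}) (\<lambda>z. dd w g (T (snd z) (fst z))
          + of_real (snd z - 1) * lf w * dd a g (T (snd z) (fst z)))"
        by (intro continuous_intros continuous_on_compose2[OF dd_continuous[OF open_UNIV g] T_cont]) auto
      ultimately show ?thesis by (simp add: case_prod_beta)
    qed
  qed auto
  moreover have "f x = lf x * h x" for x
  proof -
    have "((\<lambda>\<theta>. lf x * g (T \<theta> x)) has_integral (f (T 1 x) - f (T 0 x))) {0..1}"
    proof (rule fundamental_theorem_of_calculus)
      fix \<theta> :: real
      have "((\<lambda>t. f (x + s t (s (lf x) a))) has_field_derivative dd (s (lf x) a) f (T \<theta> x)) (at (of_real (\<theta> - 1)))"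
        using holo_line_dd[OF f UNIV_I, where x = x and t = "of_real (\<theta> - 1)" and v = "s (lf x) a"] by (simp add: T_def assoc)
      moreover have "((\<lambda>\<theta>. of_real (\<theta> - 1)) has_vector_derivative (1::complex)) (at \<theta>)"
        by (auto intro!: derivative_eq_intros)
      ultimately have "((\<lambda>\<theta>. f (x + s (of_real (\<theta> - 1)) (s (lf x) a))) has_vector_derivative
          1 * dd (s (lf x) a) f (T \<theta> x)) (at \<theta>)"
        using field_vector_diff_chain_at[of "\<lambda>\<theta>. of_real (\<theta> - 1)" 1 \<theta>] unfolding o_def by blast
      then show "((\<lambda>\<theta>. f (T \<theta> x)) has_vector_derivative lf x * g (T \<theta> x)) (at \<theta> within {0..1})"
        by (simp add: T_def assoc g_def holo_has_derivative(2)[OF f UNIV_I] has_vector_derivative_at_within)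
    qed simp
    moreover have "T 1 x = x" by (simp add: T_def)
    moreover have "f (T 0 x) = 0"
      by (rule zero) (simp add: T_def bounded_linear.linear[OF lf(1)] linear_add lf)
    ultimately show ?thesis unfolding h_def by (auto dest: integral_unique)
  qed
  ultimately show ?thesis by blast
qed

end

lemma bounded_bilinear_cscale: "bounded_bilinear ((*s) :: complex \<Rightarrow> 'n::finite cspace \<Rightarrow> 'n cspace)"
proof
  fix a b :: complex and x y :: "'n cspace" and r :: real
  show "(a + b) *s x = a *s x + b *s x" "a *s (x + y) = a *s x + a *s y"
    by (simp_all add: vector_add_ldistrib vector_sadd_rdistrib)
  show "(r *\<^sub>R a) *s x = r *\<^sub>R (a *s x)" "a *s (r *\<^sub>R x) = r *\<^sub>R (a *s x)"
    by (simp_all add: vec_eq_iff)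
  have "norm (a *s x) \<le> norm a * norm x * 1" for a :: complex and x :: "'n cspace"
  proof -
    have "norm (a *s x) = norm a * norm x"
      unfolding norm_vec_def by (simp add: norm_mult L2_set_right_distrib)
    then show ?thesis by simp
  qed
  then show "\<exists>K. \<forall>a x. norm (a *s (x :: 'n cspace)) \<le> norm a * norm x * K" by blast
qed

interpretation V: complex_scaling "(*s) :: complex \<Rightarrow> 'n::finite cspace \<Rightarrow> 'n cspace"
  by (rule complex_scaling.intro[OF bounded_bilinear_cscale])
     (auto simp: vec_eq_iff scaleR_conv_of_real[symmetric])

lemma dir_deriv_dd: "dir_deriv = V.dd"
  by (auto simp: dir_deriv_def V.dd_def fun_eq_iff)

interpretation VV: complex_scaling "\<lambda>c v :: 'n::finite cspace \<times> 'n cspace. (c *s fst v, c *s snd v)"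
proof (rule complex_scaling.intro)
  interpret b: bounded_bilinear "(*s) :: complex \<Rightarrow> 'n cspace \<Rightarrow> 'n cspace" by (rule bounded_bilinear_cscale)
  show "bounded_bilinear (\<lambda>c v :: 'n cspace \<times> 'n cspace. (c *s fst v, c *s snd v))"
  proof
    obtain K where K: "\<And>a x. norm (a *s (x :: 'n cspace)) \<le> norm a * norm x * K" using b.bounded by blast
    have "norm (a *s fst v, a *s snd v) \<le> norm a * norm v * (\<bar>K\<bar> + \<bar>K\<bar>)" for a and v :: "'n cspace \<times> 'n cspace"
    proof -
      have "norm (a *s x) \<le> norm a * norm v * \<bar>K\<bar>" if "norm x \<le> norm v" for x :: "'n cspace"
      proof -
        have "norm (a *s x) \<le> norm a * norm x * \<bar>K\<bar>"
          using K[of a x] by (smt (verit) abs_ge_self mult_left_mono norm_ge_zero zero_le_mult_iff)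
        also have "\<dots> \<le> norm a * norm v * \<bar>K\<bar>" using that by (intro mult_right_mono mult_left_mono) auto
        finally show ?thesis .
      qed
      then have "norm (a *s fst v) \<le> norm a * norm v * \<bar>K\<bar>" "norm (a *s snd v) \<le> norm a * norm v * \<bar>K\<bar>"
        using norm_fst_le[of "fst v" "snd v"] norm_snd_le[of "snd v" "fst v"] by auto
      then have "norm (a *s fst v) + norm (a *s snd v) \<le> norm a * norm v * (\<bar>K\<bar> + \<bar>K\<bar>)"
        by (simp add: algebra_simps)
      then show ?thesis using norm_Pair_le[of "a *s fst v" "a *s snd v"] by linarith
    qed
    then show "\<exists>K. \<forall>a (v :: 'n cspace \<times> 'n cspace). norm (a *s fst v, a *s snd v) \<le> norm a * norm v * K" by blast
  qed (auto simp: b.add_left b.add_right b.scaleR_left b.scaleR_right)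
qed (auto simp: vec_eq_iff scaleR_conv_of_real[symmetric] prod_eq_iff)

lemma foldr_comp_Cons:
  "foldr (\<lambda>i F. T i \<circ> F) (x # xs) id u = T x (foldr (\<lambda>i F. T i \<circ> F) xs id u)"
  by simp

context refl_group
begin

subsection \<open>The function \<open>w\<close> and the functional \<open>\<mu>\<close>\<close>

definition alt_exp :: "'n cspace \<times> 'n cspace \<Rightarrow> complex" where
  "alt_exp v = (\<Sum>g\<in>G. of_int (\<epsilon> g) * exp (cform (cmat g *v fst v) (snd v)))"

lemma holo_fst_coord: "VV.holo (\<lambda>v. fst v $ i) UNIV" and holo_snd_coord: "VV.holo (\<lambda>v. snd v $ i) UNIV"
  by (auto intro!: VV.holo_linear bounded_linear_compose[OF bounded_linear_vec_nth] bounded_linear_fst bounded_linear_snd)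

lemma alt_exp_holo: "VV.holo alt_exp UNIV"
  unfolding alt_exp_def[abs_def] cform_def matrix_vector_mult_def
  by (intro VV.holo_sum VV.holo_mult VV.holo_const VV.holo_exp) (simp, intro VV.holo_sum VV.holo_mult VV.holo_const holo_fst_coord holo_snd_coord)+

lemma alt_exp_asym: "alt_exp (l, y) = asym (\<lambda>z. exp (cform z y)) l"
  by (simp add: alt_exp_def asym_def)

text \<open>The alternating sum of exponentials is anti-invariant in the first variable. The division proceeds as
  for polynomials, with Hadamard's lemma in place of divided differences.\<close>

lemma alt_exp_divisible: "\<exists>h. VV.holo h UNIV \<and> (\<forall>v. alt_exp v = \<Delta> (fst v) * h v)"
proof -
  have "\<exists>h. VV.holo h UNIV \<and> (\<forall>v. alt_exp v = (\<Prod>a\<in>T. cform (cvec a) (fst v)) * h v)" if "finite T" "T \<subseteq> A" for T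
    using that
  proof (induction T rule: finite_induct)
    case empty
    then show ?case using alt_exp_holo by auto
  next
    case (insert b T)
    then obtain h where h: "VV.holo h UNIV" "\<And>v. alt_exp v = (\<Prod>a\<in>T. cform (cvec a) (fst v)) * h v" by auto
    have b: "b \<in> A" using insert by auto
    have bb: "b \<bullet> b \<noteq> 0" using A_nonzero b by auto
    have h0: "h v = 0" if "cform (cvec b) (fst v) = 0" for v
    proof -
      have "h (fst v, snd v) = 0"
      proof (rule hyperplane_generic[OF b _ _ that])
        show "continuous_on UNIV (\<lambda>l. h (l, snd v))"
          by (rule continuous_on_compose2[OF VV.holo_continuous[OF h(1)]]) (auto intro!: continuous_intros)
        fix z assume z: "cform (cvec b) z = 0" "\<And>a. a \<in> A - {b} \<Longrightarrow> cform (cvec a) z \<noteq> 0"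
        have "alt_exp (z, snd v) = 0"
          unfolding alt_exp_asym
          by (rule antiinvariant_zero[OF b _ z(1)]) (simp add: asym_G refl_G b sign_refl)
        moreover have "(\<Prod>a\<in>T. cform (cvec a) z) \<noteq> 0"
          using z(2) insert by (auto simp: prod_zero_iff)
        ultimately show "h (z, snd v) = 0" using h(2)[of "(z, snd v)"] by simp
      qed
      then show ?thesis by simp
    qed
    have "\<exists>h'. VV.holo h' UNIV \<and> (\<forall>v. h v = cform (cvec b) (fst v) * h' v)"
    proof (rule VV.holo_divisible[OF h(1), of _ "((1 / of_real (b \<bullet> b)) *s cvec b, 0)"])
      show "bounded_linear (\<lambda>v. cform (cvec b) (fst v))"
        by (rule bounded_linear_compose[OF bounded_linear_cform bounded_linear_fst])
    qed (use bb h0 in \<open>auto simp: cform_linear cform_cvec\<close>)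
    then obtain h' where "VV.holo h' UNIV" "\<And>v. h v = cform (cvec b) (fst v) * h' v" by blast
    then show ?case using h(2) insert.hyps
      by (intro exI[of _ h']) (auto simp: algebra_simps)
  qed
  from this[OF finite_A order_refl] show ?thesis by (simp add: \<Delta>_def)
qed

lemma w_fun_props:
  "VV.holo (\<lambda>v. w_fun G A \<epsilon> (fst v) (snd v)) UNIV"
  "l \<in> regular_set A \<Longrightarrow> w_fun G A \<epsilon> l y = alt_exp (l, y) / \<Delta> l"
proof -
  let ?P = "\<lambda>w. VV.holo (\<lambda>v. w (fst v) (snd v)) UNIV \<and>
     (\<forall>l\<in>regular_set A. \<forall>y. w l y =
        (\<Sum>g\<in>G. of_int (\<epsilon> g) * exp (cform (cmat g *v l) y)) / (\<Prod>\<alpha>\<in>A. cform (cvec \<alpha>) l))"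
  obtain h where h: "VV.holo h UNIV" "\<And>v. alt_exp v = \<Delta> (fst v) * h v" using alt_exp_divisible by blast
  have "?P (\<lambda>l y. h (l, y))"
  proof (intro conjI ballI allI)
    show "VV.holo (\<lambda>v. h (fst v, snd v)) UNIV" using h(1) by simp
    fix l y assume "l \<in> regular_set A"
    then show "h (l, y) = (\<Sum>g\<in>G. of_int (\<epsilon> g) * exp (cform (cmat g *v l) y)) / (\<Prod>\<alpha>\<in>A. cform (cvec \<alpha>) l)"
      using h(2)[of "(l, y)"] \<Delta>_nonzero_iff[of l] by (simp add: \<Delta>_def alt_exp_def)
  qed
  moreover have "w = w'" if w: "?P w" "?P w'" for w w'
  proof (rule ext)
    fix l
    have "(\<lambda>l. w l y) = (\<lambda>l. w' l y)" for y
    proof (rule eq_off_regular)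
      have "continuous_on UNIV (\<lambda>l. (\<lambda>v. u (fst v) (snd v)) (l, y))" if "?P u" for u
        using that by (intro continuous_on_compose2[OF VV.holo_continuous, of "\<lambda>v. u (fst v) (snd v)" UNIV]) (auto intro!: continuous_intros)
      then show "continuous_on UNIV (\<lambda>l. w l y)" "continuous_on UNIV (\<lambda>l. w' l y)" using w by auto
    qed (use w in auto)
    then show "w l = w' l" by (auto dest: fun_cong)
  qed
  ultimately have "?P (w_fun G A \<epsilon>)" unfolding w_fun_def by (intro theI[of ?P])
  then show "VV.holo (\<lambda>v. w_fun G A \<epsilon> (fst v) (snd v)) UNIV"
    "l \<in> regular_set A \<Longrightarrow> w_fun G A \<epsilon> l y = alt_exp (l, y) / \<Delta> l"
    by (auto simp: \<Delta>_def alt_exp_def)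
qed

lemma coords_props: "distinct (coords :: 'n list)" "set (coords :: 'n list) = UNIV"
proof -
  have "\<exists>xs :: 'n list. distinct xs \<and> set xs = UNIV"
    using finite_distinct_list[of "UNIV :: 'n set"] by auto
  then have "distinct (coords :: 'n list) \<and> set (coords :: 'n list) = UNIV"
    unfolding coords_def by (rule someI_ex)
  then show "distinct (coords :: 'n list)" "set (coords :: 'n list) = UNIV" by auto
qed

definition joint_op :: "'n list \<Rightarrow> ('n \<Rightarrow> nat) \<Rightarrow> ('n cspace \<times> 'n cspace \<Rightarrow> complex) \<Rightarrow> 'n cspace \<times> 'n cspace \<Rightarrow> complex" where
  "joint_op xs k = foldr (\<lambda>i F. (VV.dd (0, axis i 1) ^^ k i) \<circ> F) xs id"

text \<open>Derivatives of \<open>w\<close> in the second variable are partial derivatives of a function that is holomorphic in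
  both variables; this is how their continuity in the first variable is obtained.\<close>

lemma joint_op_slice:
  "foldr (\<lambda>i F. (dir_deriv (axis i 1) ^^ k i) \<circ> F) xs id (\<lambda>y. H (l, y)) y = joint_op xs k H (l, y)"
proof -
  have 1: "dir_deriv e (\<lambda>y. H (l, y)) = (\<lambda>y. VV.dd (0, e) H (l, y))" for e H
    by (auto simp: dir_deriv_def VV.dd_def)
  have 2: "(dir_deriv e ^^ n) (\<lambda>y. H (l, y)) = (\<lambda>y. (VV.dd (0, e) ^^ n) H (l, y))" for e n H
    by (induction n) (auto simp: 1)
  have "foldr (\<lambda>i F. (dir_deriv (axis i 1) ^^ k i) \<circ> F) xs id (\<lambda>y. H (l, y)) = (\<lambda>y. joint_op xs k H (l, y))"
    by (induction xs) (auto simp: joint_op_def 2)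
  then show ?thesis by simp
qed

lemma joint_op_holo: "VV.holo H UNIV \<Longrightarrow> VV.holo (joint_op xs k H) UNIV"
proof -
  assume H: "VV.holo H UNIV"
  have 1: "VV.holo ((VV.dd e ^^ n) H) UNIV" if "VV.holo H UNIV" for e n H
    by (induction n) (auto intro!: VV.holo_dd that)
  show ?thesis using H by (induction xs) (auto simp: joint_op_def intro!: 1)
qed

lemma monomial_op_exp_sum:
  fixes \<xi> :: "real ^ 'n ^ 'n \<Rightarrow> 'n cspace"
  shows "monomial_op dir_deriv k (\<lambda>y. \<Sum>g\<in>G. c g * exp (cform (\<xi> g) y)) y
    = (\<Sum>g\<in>G. c g * monomial k (\<xi> g) * exp (cform (\<xi> g) y))"
proof -
  have 1: "dir_deriv (axis i 1) (\<lambda>y. \<Sum>g\<in>G. c g * exp (cform (\<xi> g) y))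
      = (\<lambda>y. \<Sum>g\<in>G. (c g * \<xi> g $ i) * exp (cform (\<xi> g) y))" for i c
  proof
    fix y
    have "((\<lambda>t. \<Sum>g\<in>G. c g * exp (cform (\<xi> g) y + t * (\<xi> g $ i))) has_field_derivative
        (\<Sum>g\<in>G. (c g * \<xi> g $ i) * exp (cform (\<xi> g) y))) (at 0)"
      by (auto intro!: derivative_eq_intros sum.cong)
    moreover have "cform (\<xi> g) (y + t *s axis i 1) = cform (\<xi> g) y + t * (\<xi> g $ i)" for t g
      by (simp add: cform_linear cform_commute[of _ "axis i 1"] cform_axis)
    ultimately show "dir_deriv (axis i 1) (\<lambda>y. \<Sum>g\<in>G. c g * exp (cform (\<xi> g) y)) y
        = (\<Sum>g\<in>G. (c g * \<xi> g $ i) * exp (cform (\<xi> g) y))"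
      unfolding dir_deriv_def by (simp add: DERIV_imp_deriv)
  qed
  have 2: "(dir_deriv (axis i 1) ^^ n) (\<lambda>y. \<Sum>g\<in>G. c g * exp (cform (\<xi> g) y))
      = (\<lambda>y. \<Sum>g\<in>G. (c g * (\<xi> g $ i) ^ n) * exp (cform (\<xi> g) y))" for i n c
  proof (induction n)
    case (Suc n)
    show ?case unfolding funpow.simps o_apply Suc 1 by (simp add: mult_ac)
  qed simp
  have 3: "foldr (\<lambda>i F. (dir_deriv (axis i 1) ^^ k i) \<circ> F) xs id (\<lambda>y. \<Sum>g\<in>G. c g * exp (cform (\<xi> g) y))
      = (\<lambda>y. \<Sum>g\<in>G. (c g * (\<Prod>i\<leftarrow>xs. (\<xi> g $ i) ^ k i)) * exp (cform (\<xi> g) y))" for xs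
  proof (induction xs)
    case (Cons i xs)
    show ?case unfolding foldr_comp_Cons Cons 2 by (simp add: mult_ac)
  qed simp
  have "(\<Prod>i\<leftarrow>coords. (\<xi> g $ i) ^ k i) = monomial k (\<xi> g)" for g
    unfolding monomial_def using coords_props prod.distinct_set_conv_list[of coords "\<lambda>i. (\<xi> g $ i) ^ k i"] by simp
  then show ?thesis unfolding monomial_op_def 3 by simp
qed

text \<open>At regular points, \<open>p(\<partial>)\<close> multiplies each exponential in \<open>w\<close> by a value of \<open>p\<close>. At the other points
  the formula holds by continuity.\<close>

theorem mu_eq_B:
  assumes p: "p \<in> polys"
  shows "mu G A \<epsilon> l p = B p l"
proof -
  let ?W = "\<lambda>v. w_fun G A \<epsilon> (fst v) (snd v)"
  let ?K = "{k. poly_coeffs p k \<noteq> 0}"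
  have mon: "monomial_op dir_deriv k (w_fun G A \<epsilon> l) 0 = joint_op coords k ?W (l, 0)" for k l
    using joint_op_slice[of k coords ?W l 0] by (simp add: monomial_op_def)
  have "(\<lambda>l. mu G A \<epsilon> l p) = B p"
  proof (rule eq_off_regular)
    have "continuous_on UNIV (\<lambda>l. \<Sum>k\<in>?K. poly_coeffs p k * joint_op coords k ?W (l, 0))"
      by (intro continuous_intros continuous_on_compose2[OF VV.holo_continuous[OF joint_op_holo[OF w_fun_props(1)]]]) auto
    then show "continuous_on UNIV (\<lambda>l. mu G A \<epsilon> l p)"
      by (simp add: mu_def poly_op_def mon)
    show "continuous_on UNIV (B p)" using B_props(1)[OF p] by (rule polys_continuous)
    fix l assume l: "l \<in> regular_set A"
    have w: "w_fun G A \<epsilon> l = (\<lambda>y. \<Sum>g\<in>G. (of_int (\<epsilon> g) / \<Delta> l) * exp (cform (cmat g *v l) y))"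
      by (rule ext) (simp add: w_fun_props(2)[OF l] alt_exp_def sum_divide_distrib)
    then have "mu G A \<epsilon> l p = (\<Sum>k\<in>?K. poly_coeffs p k * (\<Sum>g\<in>G. (of_int (\<epsilon> g) / \<Delta> l) * monomial k (cmat g *v l)))"
      unfolding mu_def poly_op_def w monomial_op_exp_sum by simp
    also have "\<dots> = (\<Sum>g\<in>G. \<Sum>k\<in>?K. (of_int (\<epsilon> g) / \<Delta> l) * (poly_coeffs p k * monomial k (cmat g *v l)))"
      unfolding sum_distrib_left by (subst sum.swap) (simp add: mult_ac)
    also have "\<dots> = (\<Sum>g\<in>G. (of_int (\<epsilon> g) / \<Delta> l) * p (cmat g *v l))"
      using has_coeffs_poly_coeffs[OF p] by (simp add: has_coeffs_def fun_eq_iff sum_distrib_left)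
    also have "\<dots> = B p l" by (simp add: B_regular[OF p l] asym_def sum_divide_distrib)
    finally show "mu G A \<epsilon> l p = B p l" .
  qed
  then show ?thesis by (rule fun_cong)
qed

end

section \<open>Dunkl operators\<close>

context refl_group
begin

text \<open>
  This part of a Dunkl operator makes sense for arbitrary functions, so that its commutativity is a
  statement about values on a single orbit.
\<close>

definition dunkl_diff :: "'n cspace \<Rightarrow> ('n cspace \<Rightarrow> complex) \<Rightarrow> 'n cspace \<Rightarrow> complex" where
  "dunkl_diff \<xi> u x = (\<Sum>a\<in>A. of_nat (m a) * (cform (cvec a) \<xi> / cform (cvec a) x)
        * (u (cmat (refl_mat a) *v x) - u x))"

lemma dunkl_alt: "dunkl A m \<xi> u x = dir_deriv \<xi> u x + dunkl_diff \<xi> u x"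
  by (simp add: dunkl_def dunkl_diff_def)

text \<open>These ratios do not change when a normal vector is rescaled, which makes sums over the chosen
  normal vectors invariant.\<close>

lemma perm_ratio:
  assumes "g \<in> G" "a \<in> A"
  shows "cform (cvec (perm g a)) (cmat g *v \<xi>) / cform (cvec (perm g a)) (cmat g *v x)
       = cform (cvec a) \<xi> / cform (cvec a) x"
proof -
  obtain c where c: "c \<noteq> 0" "cmat g *v cvec a = c *s cvec (perm g a)"
    using perm_cscale[OF assms] by blast
  have "cform (cvec a) y = c * cform (cvec (perm g a)) (cmat g *v y)" for y
    using cform_G[OF assms(1), of "cvec a" y] by (simp add: c cform_linear)
  then show ?thesis using c(1) by simp
qed

lemma perm_refl_apply:
  assumes "g \<in> G" "a \<in> A"
  shows "cmat (refl_mat (perm g a)) *v (cmat g *v x) = cmat g *v (cmat (refl_mat a) *v x)"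
proof -
  have "refl_mat (perm g a) ** g = g ** refl_mat a"
    using assms by (simp add: perm_props matrix_mul_assoc[symmetric] transpose_mult_G)
  then show ?thesis by (metis cmat_mult matrix_vector_mul_assoc)
qed

lemma dunkl_diff_G:
  assumes "g \<in> G"
  shows "dunkl_diff \<xi> (\<lambda>y. u (cmat g *v y)) x = dunkl_diff (cmat g *v \<xi>) u (cmat g *v x)"
  unfolding dunkl_diff_def
  by (subst (2) sum_A_reindex[OF assms], intro sum.cong refl)
     (simp add: perm_mult perm_ratio perm_refl_apply assms)

lemma dir_deriv_G: "dir_deriv \<xi> (\<lambda>y. u (M *v y)) x = dir_deriv (M *v \<xi>) u (M *v x)"
  by (simp add: dir_deriv_def matrix_vector_right_distrib vector_scalar_commute)

lemma dunkl_G: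
  "g \<in> G \<Longrightarrow> dunkl A m \<xi> (\<lambda>y. u (cmat g *v y)) x = dunkl A m (cmat g *v \<xi>) u (cmat g *v x)"
  by (simp add: dunkl_alt dunkl_diff_G dir_deriv_G)

lemma dunkl_diff_add_fun:
  "dunkl_diff \<xi> (\<lambda>y. u y + v y) x = dunkl_diff \<xi> u x + dunkl_diff \<xi> v x"
proof -
  have "c * (a + b - (d + e)) = c * (a - d) + c * (b - e)" for a b c d e :: complex
    by (simp add: algebra_simps)
  then show ?thesis unfolding dunkl_diff_def sum.distrib[symmetric] by (intro sum.cong refl)
qed

lemma dunkl_diff_scale_fun: "dunkl_diff \<xi> (\<lambda>y. c * u y) x = c * dunkl_diff \<xi> u x"
proof -
  have "k * (c * a - c * b) = c * (k * (a - b))" for a b k :: complex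
    by (simp add: algebra_simps)
  then show ?thesis unfolding dunkl_diff_def sum_distrib_left by (intro sum.cong refl)
qed

lemma dunkl_diff_diff_fun:
  "dunkl_diff \<xi> (\<lambda>y. u y - v y) x = dunkl_diff \<xi> u x - dunkl_diff \<xi> v x"
  using dunkl_diff_add_fun[of \<xi> u "\<lambda>y. -1 * v y"] dunkl_diff_scale_fun[of \<xi> "-1" v] by simp

lemma dunkl_diff_sum_fun:
  "dunkl_diff \<xi> (\<lambda>y. \<Sum>i\<in>I. u i y) x = (\<Sum>i\<in>I. dunkl_diff \<xi> (u i) x)"
proof (induction I rule: infinite_finite_induct)
  case (insert i I)
  then show ?case using dunkl_diff_add_fun[of \<xi> "u i" "\<lambda>y. \<Sum>i\<in>I. u i y"] by simp
qed (simp_all add: dunkl_diff_def)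

lemma dunkl_diff_add: "dunkl_diff (\<xi> + \<eta>) u x = dunkl_diff \<xi> u x + dunkl_diff \<eta> u x"
  and dunkl_diff_scale: "dunkl_diff (c *s \<xi>) u x = c * dunkl_diff \<xi> u x"
  by (simp_all add: dunkl_diff_def cform_linear algebra_simps add_divide_distrib sum.distrib
      sum_subtractf sum_distrib_left)

lemma dunkl_diff_cong:
  assumes "\<And>g. g \<in> G \<Longrightarrow> u (cmat g *v x) = v (cmat g *v x)"
  shows "dunkl_diff \<xi> u x = dunkl_diff \<xi> v x"
  unfolding dunkl_diff_def
  using assms[OF refl_G] assms[OF one_G] by (intro sum.cong) auto

lemma dunkl_diff_cong_orbit:
  assumes "\<And>g. g \<in> G \<Longrightarrow> u (cmat g *v x) = v (cmat g *v x)" "h \<in> G"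
  shows "dunkl_diff \<xi> u (cmat h *v x) = dunkl_diff \<xi> v (cmat h *v x)"
proof (rule dunkl_diff_cong)
  fix g assume "g \<in> G"
  then have "g ** h \<in> G" using assms mult_G by auto
  from assms(1)[OF this] show "u (cmat g *v (cmat h *v x)) = v (cmat g *v (cmat h *v x))"
    by (simp add: cmat_mult matrix_vector_mul_assoc)
qed

subsection \<open>Commutativity\<close>

definition refl_sum :: "'n cspace \<Rightarrow> 'n cspace \<Rightarrow> ('n cspace \<Rightarrow> complex) \<Rightarrow> 'n cspace \<Rightarrow> complex" where
  "refl_sum \<xi> \<zeta> u x = (\<Sum>a\<in>A. 2 * of_nat (m a) / of_real (a \<bullet> a) * cform (cvec a) \<xi> * cform (cvec a) \<zeta>
      * u (cmat (refl_mat a) *v x))"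

text \<open>A linear function changes under a reflection by a multiple of the linear form of \<open>a\<close>, which cancels
  the denominator. The correction \<open>refl_sum\<close> is symmetric in \<open>\<xi>\<close> and \<open>\<zeta>\<close> and has constant coefficients.\<close>

lemma dunkl_diff_linear_mult:
  assumes "x \<in> regular_set A"
  shows "dunkl_diff \<xi> (\<lambda>y. cform \<zeta> y * u y) x = cform \<zeta> x * dunkl_diff \<xi> u x - refl_sum \<xi> \<zeta> u x"
  unfolding dunkl_diff_def refl_sum_def sum_distrib_left sum_subtractf[symmetric]
proof (rule sum.cong[OF refl])
  fix a assume a: "a \<in> A"
  let ?y = "cmat (refl_mat a) *v x"
  have ax: "cform (cvec a) x \<noteq> 0" using assms a by (auto simp: regular_set_def)
  have "cform \<zeta> ?y = cform \<zeta> x - 2 * cform (cvec a) x / of_real (a \<bullet> a) * cform (cvec a) \<zeta>"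
    by (simp add: cmat_refl_mat_apply cform_linear cform_commute[of \<zeta>])
  moreover have "p / q * ((z - 2 * q / e * b) * v - z * w) = z * (p / q * (v - w)) - 2 / e * p * b * v"
    if "q \<noteq> 0" for p q z e b v w :: complex
    using that by (cases "e = 0") (simp_all add: field_simps)
  ultimately have *: "cform (cvec a) \<xi> / cform (cvec a) x * (cform \<zeta> ?y * u ?y - cform \<zeta> x * u x)
      = cform \<zeta> x * (cform (cvec a) \<xi> / cform (cvec a) x * (u ?y - u x))
        - 2 / of_real (a \<bullet> a) * cform (cvec a) \<xi> * cform (cvec a) \<zeta> * u ?y"
    using ax by (simp only:)
  have "of_nat (m a) * (cform (cvec a) \<xi> / cform (cvec a) x) * (cform \<zeta> ?y * u ?y - cform \<zeta> x * u x)
      = of_nat (m a) * (cform (cvec a) \<xi> / cform (cvec a) x * (cform \<zeta> ?y * u ?y - cform \<zeta> x * u x))"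
    by (simp only: mult.assoc)
  also have "\<dots> = cform \<zeta> x * (of_nat (m a) * (cform (cvec a) \<xi> / cform (cvec a) x) * (u ?y - u x))
      - 2 * of_nat (m a) / of_real (a \<bullet> a) * cform (cvec a) \<xi> * cform (cvec a) \<zeta> * u ?y"
    unfolding * by (simp add: algebra_simps)
  finally show "of_nat (m a) * (cform (cvec a) \<xi> / cform (cvec a) x) * (cform \<zeta> ?y * u ?y - cform \<zeta> x * u x)
     = cform \<zeta> x * (of_nat (m a) * (cform (cvec a) \<xi> / cform (cvec a) x) * (u ?y - u x))
      - 2 * of_nat (m a) / of_real (a \<bullet> a) * cform (cvec a) \<xi> * cform (cvec a) \<zeta> * u ?y" .
qed

definition diff_comm :: "'n cspace \<Rightarrow> 'n cspace \<Rightarrow> ('n cspace \<Rightarrow> complex) \<Rightarrow> 'n cspace \<Rightarrow> complex" where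
  "diff_comm \<xi> \<eta> u x = dunkl_diff \<xi> (dunkl_diff \<eta> u) x - dunkl_diff \<eta> (dunkl_diff \<xi> u) x"

text \<open>Moving a reflection across a difference operator in direction \<open>\<xi>\<close> reflects \<open>\<xi>\<close>, that is, subtracts a
  multiple of \<open>a\<close> proportional to the product of \<open>a\<close> and \<open>\<xi>\<close>; the resulting expression is symmetric.\<close>

lemma refl_sum_symmetric:
  "refl_sum \<xi> \<zeta> (dunkl_diff \<eta> u) x + dunkl_diff \<xi> (refl_sum \<eta> \<zeta> u) x
   = refl_sum \<eta> \<zeta> (dunkl_diff \<xi> u) x + dunkl_diff \<eta> (refl_sum \<xi> \<zeta> u) x"
proof -
  define k where "k a = 2 * of_nat (m a) / of_real (a \<bullet> a) * cform (cvec a) \<zeta>" for a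
  have rs: "refl_sum \<xi> \<zeta> u x = (\<Sum>a\<in>A. k a * cform (cvec a) \<xi> * u (cmat (refl_mat a) *v x))" for \<xi> u x
    by (simp add: refl_sum_def k_def mult_ac)
  have tr: "dunkl_diff \<xi> (\<lambda>y. u (cmat (refl_mat a) *v y)) x
      = dunkl_diff \<xi> u (cmat (refl_mat a) *v x)
        - 2 * cform (cvec a) \<xi> / of_real (a \<bullet> a) * dunkl_diff (cvec a) u (cmat (refl_mat a) *v x)"
    if "a \<in> A" for a \<xi>
  proof -
    have "cmat (refl_mat a) *v \<xi> = \<xi> + (- (2 * cform (cvec a) \<xi> / of_real (a \<bullet> a))) *s cvec a"
      by (simp add: cmat_refl_mat_apply vec_eq_iff)
    then show ?thesis
      using dunkl_diff_G[OF refl_G[OF that], of \<xi> u x] by (simp only: dunkl_diff_add dunkl_diff_scale) simp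
  qed
  have "refl_sum \<xi> \<zeta> (dunkl_diff \<eta> u) x + dunkl_diff \<xi> (refl_sum \<eta> \<zeta> u) x
      = (\<Sum>a\<in>A. k a * (cform (cvec a) \<xi> * dunkl_diff \<eta> u (cmat (refl_mat a) *v x)
        + cform (cvec a) \<eta> * dunkl_diff \<xi> u (cmat (refl_mat a) *v x)
        - 2 * cform (cvec a) \<xi> * cform (cvec a) \<eta> / of_real (a \<bullet> a) * dunkl_diff (cvec a) u (cmat (refl_mat a) *v x)))"
    for \<xi> \<eta>
  proof -
    have "dunkl_diff \<xi> (refl_sum \<eta> \<zeta> u) x
        = (\<Sum>a\<in>A. k a * cform (cvec a) \<eta> * dunkl_diff \<xi> (\<lambda>y. u (cmat (refl_mat a) *v y)) x)"
      unfolding rs[abs_def] by (simp add: dunkl_diff_sum_fun dunkl_diff_scale_fun)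
    then show ?thesis
      by (simp add: rs tr sum.distrib[symmetric] algebra_simps)
  qed
  from this[of \<xi> \<eta>] this[of \<eta> \<xi>] show ?thesis by (simp add: algebra_simps)
qed

text \<open>The Jacobi identity; its two correction terms cancel by \<open>refl_sum_symmetric\<close>.\<close>

lemma diff_comm_linear_mult:
  assumes x: "x \<in> regular_set A"
  shows "diff_comm \<xi> \<eta> (\<lambda>y. cform \<zeta> y * u y) x = cform \<zeta> x * diff_comm \<xi> \<eta> u x"
proof -
  have "dunkl_diff \<xi> (dunkl_diff \<eta> (\<lambda>y. cform \<zeta> y * u y)) x
      = cform \<zeta> x * dunkl_diff \<xi> (dunkl_diff \<eta> u) x
        - (refl_sum \<xi> \<zeta> (dunkl_diff \<eta> u) x + dunkl_diff \<xi> (refl_sum \<eta> \<zeta> u) x)" for \<xi> \<eta>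
  proof -
    have "dunkl_diff \<xi> (dunkl_diff \<eta> (\<lambda>y. cform \<zeta> y * u y)) x
        = dunkl_diff \<xi> (\<lambda>y. cform \<zeta> y * dunkl_diff \<eta> u y - refl_sum \<eta> \<zeta> u y) x"
      by (rule dunkl_diff_cong) (simp add: dunkl_diff_linear_mult regular_set_G[OF _ x])
    then show ?thesis by (simp add: dunkl_diff_diff_fun dunkl_diff_linear_mult[OF x])
  qed
  note expand = this
  show ?thesis
    unfolding diff_comm_def expand refl_sum_symmetric[of \<xi> \<zeta> \<eta> u x]
    by (simp only: right_diff_distrib) simp
qed

lemma diff_comm_cong:
  assumes "\<And>g. g \<in> G \<Longrightarrow> u (cmat g *v x) = v (cmat g *v x)"
  shows "diff_comm \<xi> \<eta> u x = diff_comm \<xi> \<eta> v x"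
  unfolding diff_comm_def
  using dunkl_diff_cong[of "dunkl_diff \<eta> u" x "dunkl_diff \<eta> v" \<xi>] dunkl_diff_cong[of "dunkl_diff \<xi> u" x "dunkl_diff \<xi> v" \<eta>]
    dunkl_diff_cong_orbit[of u x v, OF assms] by simp

lemma diff_comm_affine_mult:
  assumes x: "x \<in> regular_set A"
  shows "diff_comm \<xi> \<eta> (\<lambda>y. cform \<zeta> (y - b) * u y) x = cform \<zeta> (x - b) * diff_comm \<xi> \<eta> u x"
proof -
  have "diff_comm \<xi> \<eta> (\<lambda>y. cform \<zeta> y * u y - cform \<zeta> b * u y) x
      = diff_comm \<xi> \<eta> (\<lambda>y. cform \<zeta> y * u y) x - cform \<zeta> b * diff_comm \<xi> \<eta> u x"
    unfolding diff_comm_def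
    by (simp add: dunkl_diff_diff_fun[abs_def] dunkl_diff_scale_fun[abs_def] right_diff_distrib)
  then show ?thesis using diff_comm_linear_mult[OF x] by (simp add: cform_linear left_diff_distrib)
qed

text \<open>
  The commutator commutes with multiplication by polynomials and kills constants. Its value at \<open>x\<close>
  depends only on the values of \<open>u\<close> on the orbit of \<open>x\<close>. Multiplying \<open>u\<close> by a polynomial that vanishes
  on the orbit except at \<open>x\<close> therefore makes it indistinguishable from a constant.
\<close>

lemma diff_comm_zero:
  assumes x: "x \<in> regular_set A"
  shows "diff_comm \<xi> \<eta> u x = 0"
proof -
  define Y where "Y = (\<lambda>g. cmat g *v x) ` G - {x}"
  have finY: "finite Y" using finite_G by (simp add: Y_def)
  have "\<exists>\<eta>. cform \<eta> (x - y) \<noteq> 0" if "y \<in> Y" for y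
  proof -
    have "x - y \<noteq> 0" using that by (auto simp: Y_def)
    then show ?thesis by (metis cform_commute cform_nondeg)
  qed
  then obtain c where c: "\<And>y. y \<in> Y \<Longrightarrow> cform (c y) (x - y) \<noteq> 0" by metis
  define q where "q z = (\<Prod>y\<in>Y. cform (c y) (z - y))" for z
  have mult: "diff_comm \<xi> \<eta> (\<lambda>z. (\<Prod>y\<in>T. cform (c y) (z - y)) * u z) x
      = (\<Prod>y\<in>T. cform (c y) (x - y)) * diff_comm \<xi> \<eta> u x" if "finite T" for T u
    using that
  proof (induction T rule: finite_induct)
    case (insert t T)
    have "diff_comm \<xi> \<eta> (\<lambda>z. cform (c t) (z - t) * ((\<Prod>y\<in>T. cform (c y) (z - y)) * u z)) x
        = cform (c t) (x - t) * diff_comm \<xi> \<eta> (\<lambda>z. (\<Prod>y\<in>T. cform (c y) (z - y)) * u z) x"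
      by (rule diff_comm_affine_mult[OF x])
    then show ?case using insert by (simp add: mult.assoc)
  qed simp
  have "q x * diff_comm \<xi> \<eta> u x = diff_comm \<xi> \<eta> (\<lambda>z. q z * u z) x"
    using mult[OF finY] by (simp add: q_def)
  also have "\<dots> = diff_comm \<xi> \<eta> (\<lambda>z. q z * u x) x"
  proof (rule diff_comm_cong)
    fix g assume g: "g \<in> G"
    show "q (cmat g *v x) * u (cmat g *v x) = q (cmat g *v x) * u x"
    proof (cases "cmat g *v x = x")
      case False
      then have "cmat g *v x \<in> Y" using g by (auto simp: Y_def)
      then have "q (cmat g *v x) = 0" unfolding q_def using finY
        by (auto simp: prod_zero_iff intro!: bexI[of _ "cmat g *v x"])
      then show ?thesis by simp
    qed simp
  qed
  also have "\<dots> = q x * diff_comm \<xi> \<eta> (\<lambda>z. u x) x" using mult[OF finY] by (simp add: q_def)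
  also have "diff_comm \<xi> \<eta> (\<lambda>z. u x) x = 0" by (simp add: diff_comm_def dunkl_diff_def)
  finally have "q x * diff_comm \<xi> \<eta> u x = 0" by simp
  moreover have "q x \<noteq> 0" using c finY by (auto simp: q_def prod_zero_iff)
  ultimately show ?thesis by simp
qed

end

locale refl_domain = refl_group G A m \<epsilon>
  for G :: "(real ^ 'n::finite ^ 'n) set" and A m \<epsilon> +
  fixes W :: "'n cspace set"
  assumes open_W: "open W" and W_regular: "W \<subseteq> regular_set A"
    and W_stable: "\<And>g x. g \<in> G \<Longrightarrow> x \<in> W \<Longrightarrow> cmat g *v x \<in> W"
begin

lemma holo_cform: "V.holo (cform a) S"
  by (rule V.holo_linear[OF bounded_linear_cform]) (simp add: cform_linear)

lemma regular_W: "x \<in> W \<Longrightarrow> a \<in> A \<Longrightarrow> cform (cvec a) x \<noteq> 0"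
  using W_regular by (auto simp: regular_set_def)

lemma holo_G:
  assumes "holo_on u W" "g \<in> G"
  shows "holo_on (\<lambda>y. u (cmat g *v y)) W"
  by (rule V.holo_linear_sub[OF assms(1) matrix_vector_mul_bounded_linear])
     (use assms W_stable in \<open>auto simp: vector_scalar_commute\<close>)

lemma dir_deriv_linear:
  assumes "holo_on u W" "x \<in> W"
  shows "dir_deriv (\<xi> + \<eta>) u x = dir_deriv \<xi> u x + dir_deriv \<eta> u x"
    "dir_deriv (c *s \<xi>) u x = c * dir_deriv \<xi> u x"
  using V.holo_has_derivative[OF assms] by (simp_all add: dir_deriv_dd)

lemma holo_dir_deriv: "holo_on u W \<Longrightarrow> holo_on (dir_deriv \<xi> u) W"
  unfolding dir_deriv_dd by (rule V.holo_dd[OF open_W])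

lemma holo_dunkl_coeff: "a \<in> A \<Longrightarrow> holo_on (\<lambda>x. c * (cform (cvec a) \<xi> / cform (cvec a) x)) W"
  by (intro V.holo_mult V.holo_const V.holo_divide holo_cform regular_W)

lemma holo_dunkl_diff:
  assumes u: "holo_on u W"
  shows "holo_on (dunkl_diff \<xi> u) W"
  unfolding dunkl_diff_def[abs_def]
proof (rule V.holo_sum)
  fix a assume a: "a \<in> A"
  show "holo_on (\<lambda>x. of_nat (m a) * (cform (cvec a) \<xi> / cform (cvec a) x) * (u (cmat (refl_mat a) *v x) - u x)) W"
    by (rule V.holo_mult(1)[OF holo_dunkl_coeff[OF a] V.holo_diff[OF holo_G[OF u refl_G[OF a]] u]])
qed

lemma dunkl_alt': "dunkl A m \<xi> u = (\<lambda>x. dir_deriv \<xi> u x + dunkl_diff \<xi> u x)"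
  by (rule ext) (rule dunkl_alt)

lemma holo_dunkl: "holo_on u W \<Longrightarrow> holo_on (dunkl A m \<xi> u) W"
  unfolding dunkl_alt' by (intro V.holo_add(1) holo_dir_deriv holo_dunkl_diff)

lemma dunkl_cong:
  assumes "\<And>x. x \<in> W \<Longrightarrow> u x = v x" "x \<in> W"
  shows "dunkl A m \<xi> u x = dunkl A m \<xi> v x"
proof -
  have "dir_deriv \<xi> u x = dir_deriv \<xi> v x"
    unfolding dir_deriv_dd by (rule V.dd_cong[OF open_W assms(2,1)])
  moreover have "dunkl_diff \<xi> u x = dunkl_diff \<xi> v x"
    by (rule dunkl_diff_cong) (use assms W_stable in auto)
  ultimately show ?thesis by (simp add: dunkl_alt)
qed

lemma dunkl_add_fun:
  assumes "holo_on u W" "holo_on v W" "x \<in> W"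
  shows "dunkl A m \<xi> (\<lambda>y. u y + v y) x = dunkl A m \<xi> u x + dunkl A m \<xi> v x"
  using V.holo_add(2)[OF assms] by (simp add: dunkl_alt dunkl_diff_add_fun dir_deriv_dd)

lemma dunkl_scale_fun:
  assumes "holo_on u W" "x \<in> W"
  shows "dunkl A m \<xi> (\<lambda>y. c * u y) x = c * dunkl A m \<xi> u x"
proof -
  have "V.dd \<xi> (\<lambda>y. c * u y) x = c * V.dd \<xi> u x + V.dd \<xi> (\<lambda>y. c) x * u x"
    by (rule V.holo_mult(2)[OF V.holo_const assms])
  then have "V.dd \<xi> (\<lambda>y. c * u y) x = c * V.dd \<xi> u x" by (simp add: V.dd_def)
  then show ?thesis by (simp add: dunkl_alt dunkl_diff_scale_fun dir_deriv_dd distrib_left)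
qed

lemma dunkl_sum_fun:
  assumes "\<And>i. i \<in> I \<Longrightarrow> holo_on (u i) W" "x \<in> W"
  shows "dunkl A m \<xi> (\<lambda>y. \<Sum>i\<in>I. u i y) x = (\<Sum>i\<in>I. dunkl A m \<xi> (u i) x)"
  using assms(1)
proof (induction I rule: infinite_finite_induct)
  case (insert i I)
  then show ?case
    using dunkl_add_fun[of "u i" "\<lambda>y. \<Sum>i\<in>I. u i y" x \<xi>] assms(2) by (simp add: V.holo_sum)
qed (simp_all add: dunkl_def dir_deriv_def)

lemma dunkl_linear:
  assumes "holo_on u W" "x \<in> W"
  shows "dunkl A m (\<xi> + \<eta>) u x = dunkl A m \<xi> u x + dunkl A m \<eta> u x"
    "dunkl A m (c *s \<xi>) u x = c * dunkl A m \<xi> u x"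
  by (simp_all add: dunkl_alt dir_deriv_linear[OF assms] dunkl_diff_add dunkl_diff_scale algebra_simps)

text \<open>
  The mixed terms in a product of two Dunkl operators, brought into a form that is visibly symmetric in
  \<open>\<xi>\<close> and \<open>\<eta>\<close>.
\<close>

lemma dir_deriv_dunkl_diff:
  assumes u: "holo_on u W" and x: "x \<in> W"
  shows "dir_deriv \<xi> (dunkl_diff \<eta> u) x + dunkl_diff \<xi> (dir_deriv \<eta> u) x
    = (\<Sum>a\<in>A. of_nat (m a) *
        (- (cform (cvec a) \<eta> * cform (cvec a) \<xi> / (cform (cvec a) x)\<^sup>2 * (u (cmat (refl_mat a) *v x) - u x))
        + cform (cvec a) \<eta> / cform (cvec a) x * (dir_deriv \<xi> u (cmat (refl_mat a) *v x) - dir_deriv \<xi> u x)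
        + cform (cvec a) \<xi> / cform (cvec a) x * (dir_deriv \<eta> u (cmat (refl_mat a) *v x) - dir_deriv \<eta> u x)
        - cform (cvec a) \<eta> / cform (cvec a) x * (2 * cform (cvec a) \<xi> / of_real (a \<bullet> a))
            * dir_deriv (cvec a) u (cmat (refl_mat a) *v x)))"
proof -
  define d where "d a y = u (cmat (refl_mat a) *v y) - u y" for a y
  define c where "c a y = of_nat (m a) * (cform (cvec a) \<eta> / cform (cvec a) y)" for a y
  have d: "holo_on (d a) W" if "a \<in> A" for a
    unfolding d_def[abs_def] by (intro V.holo_diff holo_G u refl_G that)
  have c: "holo_on (c a) W" if "a \<in> A" for a
    unfolding c_def[abs_def] by (rule holo_dunkl_coeff[OF that])
  have dd_d: "V.dd \<xi> (d a) x = dir_deriv \<xi> u (cmat (refl_mat a) *v x)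
      - 2 * cform (cvec a) \<xi> / of_real (a \<bullet> a) * dir_deriv (cvec a) u (cmat (refl_mat a) *v x) - dir_deriv \<xi> u x"
    if a: "a \<in> A" for a
  proof -
    have ax: "cmat (refl_mat a) *v x \<in> W" using W_stable refl_G a x by auto
    have "V.dd \<xi> (\<lambda>y. u (cmat (refl_mat a) *v y) + (-1) * u y) x
        = V.dd \<xi> (\<lambda>y. u (cmat (refl_mat a) *v y)) x + V.dd \<xi> (\<lambda>y. (-1) * u y) x"
      by (rule V.holo_add(2)[OF holo_G[OF u refl_G[OF a]] V.holo_scale[OF u] x])
    also have "V.dd \<xi> (\<lambda>y. (-1) * u y) x = (-1) * V.dd \<xi> u x + V.dd \<xi> (\<lambda>y. -1) x * u x"
      by (rule V.holo_mult(2)[OF V.holo_const u x])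
    also have "V.dd \<xi> (\<lambda>y. -1) x = 0" by (simp add: V.dd_def)
    also have "V.dd \<xi> (\<lambda>y. u (cmat (refl_mat a) *v y)) x = dir_deriv (cmat (refl_mat a) *v \<xi>) u (cmat (refl_mat a) *v x)"
      unfolding dir_deriv_dd[symmetric] by (rule dir_deriv_G)
    also have "cmat (refl_mat a) *v \<xi> = \<xi> + (- (2 * cform (cvec a) \<xi> / of_real (a \<bullet> a))) *s cvec a"
      by (simp add: cmat_refl_mat_apply vec_eq_iff)
    finally show ?thesis
      unfolding dir_deriv_linear[OF u ax] by (simp add: d_def[abs_def] dir_deriv_dd)
  qed
  have dd_c: "V.dd \<xi> (c a) x = - (of_nat (m a) * (cform (cvec a) \<eta> * cform (cvec a) \<xi> / (cform (cvec a) x)\<^sup>2))"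
    if a: "a \<in> A" for a
  proof -
    have "((\<lambda>t. c a (x + t *s \<xi>)) has_field_derivative
        - (of_nat (m a) * (cform (cvec a) \<eta> * cform (cvec a) \<xi> / (cform (cvec a) x)\<^sup>2))) (at 0)"
      unfolding c_def using regular_W[OF x a]
      by (auto intro!: derivative_eq_intros simp: cform_linear power2_eq_square field_simps)
    then show ?thesis unfolding V.dd_def by (rule DERIV_imp_deriv)
  qed
  have sum: "V.dd \<xi> (\<lambda>y. \<Sum>a\<in>T. c a y * d a y) x = (\<Sum>a\<in>T. c a x * V.dd \<xi> (d a) x + V.dd \<xi> (c a) x * d a x)"
    if "finite T" "T \<subseteq> A" for T
    using that
  proof (induction T rule: finite_induct)
    case empty
    then show ?case by (simp add: V.dd_def)
  next
    case (insert a T)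
    then have a: "a \<in> A" "T \<subseteq> A" by auto
    have "V.dd \<xi> (\<lambda>y. c a y * d a y + (\<Sum>a\<in>T. c a y * d a y)) x
      = V.dd \<xi> (\<lambda>y. c a y * d a y) x + V.dd \<xi> (\<lambda>y. \<Sum>a\<in>T. c a y * d a y) x"
      using a by (intro V.holo_add(2)[OF _ _ x] V.holo_mult V.holo_sum c d) auto
    then show ?case using insert.hyps insert.IH[OF a(2)] V.holo_mult(2)[OF c[OF a(1)] d[OF a(1)] x] by simp
  qed
  have "dunkl_diff \<eta> u = (\<lambda>y. \<Sum>a\<in>A. c a y * d a y)"
    by (simp add: fun_eq_iff dunkl_diff_def c_def d_def)
  then have "dir_deriv \<xi> (dunkl_diff \<eta> u) x = (\<Sum>a\<in>A. c a x * V.dd \<xi> (d a) x + V.dd \<xi> (c a) x * d a x)"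
    using sum[OF finite_A order_refl] by (simp add: dir_deriv_dd)
  then have "dir_deriv \<xi> (dunkl_diff \<eta> u) x + dunkl_diff \<xi> (dir_deriv \<eta> u) x
     = (\<Sum>a\<in>A. c a x * V.dd \<xi> (d a) x + V.dd \<xi> (c a) x * d a x
       + of_nat (m a) * (cform (cvec a) \<xi> / cform (cvec a) x)
        * (dir_deriv \<eta> u (cmat (refl_mat a) *v x) - dir_deriv \<eta> u x))"
    by (simp add: dunkl_diff_def sum.distrib)
  moreover have "n * e * (S - k * T - E) + (- (n * h)) * b + n * f * F
      = n * (- (h * b) + e * (S - E) + f * F - e * k * T)" for n e S k T E h b f F :: complex
    by (simp add: algebra_simps)
  ultimately show ?thesis
    by (simp only:) (intro sum.cong refl, simp only: dd_d dd_c c_def d_def)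
qed

text \<open>The derivatives commute, the difference parts commute by \<open>diff_comm_zero\<close>, and the mixed terms are
  symmetric.\<close>

theorem dunkl_commute:
  assumes u: "holo_on u W" and x: "x \<in> W"
  shows "dunkl A m \<xi> (dunkl A m \<eta> u) x = dunkl A m \<eta> (dunkl A m \<xi> u) x"
proof -
  have expand: "dunkl A m \<xi> (dunkl A m \<eta> u) x = dir_deriv \<xi> (dir_deriv \<eta> u) x
      + (dir_deriv \<xi> (dunkl_diff \<eta> u) x + dunkl_diff \<xi> (dir_deriv \<eta> u) x)
      + dunkl_diff \<xi> (dunkl_diff \<eta> u) x" for \<xi> \<eta>
  proof -
    have "dir_deriv \<xi> (\<lambda>x. dir_deriv \<eta> u x + dunkl_diff \<eta> u x) x
        = dir_deriv \<xi> (dir_deriv \<eta> u) x + dir_deriv \<xi> (dunkl_diff \<eta> u) x"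
      using V.holo_add(2)[OF holo_dir_deriv[OF u] holo_dunkl_diff[OF u] x] by (simp add: dir_deriv_dd)
    then show ?thesis by (simp add: dunkl_alt' dunkl_diff_add_fun)
  qed
  have "dunkl_diff \<xi> (dunkl_diff \<eta> u) x = dunkl_diff \<eta> (dunkl_diff \<xi> u) x"
    using diff_comm_zero[of x \<xi> \<eta> u] W_regular x by (auto simp: diff_comm_def)
  moreover have "dir_deriv \<xi> (dir_deriv \<eta> u) x = dir_deriv \<eta> (dir_deriv \<xi> u) x"
    unfolding dir_deriv_dd by (rule V.dd_commute[OF open_W u x])
  moreover have "dir_deriv \<xi> (dunkl_diff \<eta> u) x + dunkl_diff \<xi> (dir_deriv \<eta> u) x
      = dir_deriv \<eta> (dunkl_diff \<xi> u) x + dunkl_diff \<eta> (dir_deriv \<xi> u) x"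
    unfolding dir_deriv_dunkl_diff[OF u x]
    by (intro sum.cong refl arg_cong[of _ _ "\<lambda>z. of_nat (m _) * z"]) (simp add: mult_ac)
  ultimately show ?thesis by (simp only: expand)
qed

subsection \<open>Polynomials in the Dunkl operators\<close>

abbreviation Dop :: "'n \<Rightarrow> ('n cspace \<Rightarrow> complex) \<Rightarrow> 'n cspace \<Rightarrow> complex" where
  "Dop i \<equiv> dunkl A m (axis i 1)"

text \<open>The monomials in the Dunkl operators, for an arbitrary order of the factors.\<close>

definition Dlist :: "'n list \<Rightarrow> ('n \<Rightarrow> nat) \<Rightarrow> ('n cspace \<Rightarrow> complex) \<Rightarrow> 'n cspace \<Rightarrow> complex" where
  "Dlist xs k = foldr (\<lambda>i F. (Dop i ^^ k i) \<circ> F) xs id"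

lemma Dlist_simps: "Dlist [] k u = u" "Dlist (i # xs) k u = (Dop i ^^ k i) (Dlist xs k u)"
  by (simp_all add: Dlist_def)

lemma Dpow_holo: "holo_on u W \<Longrightarrow> holo_on ((Dop i ^^ n) u) W"
  by (induction n) (auto intro: holo_dunkl)

lemma Dpow_cong: "(\<And>x. x \<in> W \<Longrightarrow> u x = v x) \<Longrightarrow> x \<in> W \<Longrightarrow> (Dop i ^^ n) u x = (Dop i ^^ n) v x"
  by (induction n arbitrary: x) (auto intro: dunkl_cong)

lemma Dpow_commute:
  assumes "holo_on u W" "x \<in> W"
  shows "(Dop j ^^ n) (Dop i u) x = Dop i ((Dop j ^^ n) u) x"
  using assms(2)
proof (induction n arbitrary: x)
  case (Suc n)
  have "(Dop j ^^ Suc n) (Dop i u) x = Dop j (Dop i ((Dop j ^^ n) u)) x"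
    using dunkl_cong[OF Suc.IH Suc.prems] by simp
  then show ?case using dunkl_commute[OF Dpow_holo[OF assms(1)] Suc.prems] by simp
qed simp

lemma Dlist_holo: "holo_on u W \<Longrightarrow> holo_on (Dlist xs k u) W"
  by (induction xs) (auto simp: Dlist_simps intro: Dpow_holo)

lemma Dlist_cong: "(\<And>x. x \<in> W \<Longrightarrow> u x = v x) \<Longrightarrow> x \<in> W \<Longrightarrow> Dlist xs k u x = Dlist xs k v x"
  by (induction xs arbitrary: x) (auto simp: Dlist_simps intro: Dpow_cong)

lemma Dlist_shift:
  assumes "holo_on u W" "x \<in> W" "distinct xs" "i \<in> set xs"
  shows "Dlist xs (k(i := Suc (k i))) u x = Dop i (Dlist xs k u) x"
  using assms(2-)
proof (induction xs arbitrary: x)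
  case (Cons j xs)
  show ?case
  proof (cases "j = i")
    case True
    then have "i \<notin> set xs" using Cons by auto
    then have "Dlist xs (k(i := Suc (k i))) u = Dlist xs k u"
      by (induction xs) (auto simp: Dlist_simps)
    then show ?thesis unfolding Dlist_simps using True by simp
  next
    case False
    have "Dlist (j # xs) (k(i := Suc (k i))) u x = (Dop j ^^ k j) (Dlist xs (k(i := Suc (k i))) u) x"
      using False by (simp add: Dlist_simps)
    also have "\<dots> = (Dop j ^^ k j) (Dop i (Dlist xs k u)) x"
      by (rule Dpow_cong[OF Cons.IH Cons.prems(1)]) (use Cons.prems False in auto)
    also have "\<dots> = Dop i ((Dop j ^^ k j) (Dlist xs k u)) x"
      by (rule Dpow_commute[OF Dlist_holo[OF assms(1)] Cons.prems(1)])
    finally show ?thesis by (simp only: Dlist_simps(2)[of j xs k])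
  qed
qed simp

definition pD :: "('n cspace \<Rightarrow> complex) \<Rightarrow> ('n cspace \<Rightarrow> complex) \<Rightarrow> 'n cspace \<Rightarrow> complex" where
  "pD = poly_op (dunkl A m)"

lemma monomial_op_Dlist: "monomial_op (dunkl A m) k = Dlist coords k"
  by (simp add: monomial_op_def Dlist_def)

lemma pD_eq:
  assumes "has_coeffs p c" "finite K" "{k. c k \<noteq> 0} \<subseteq> K"
  shows "pD p u x = (\<Sum>k\<in>K. c k * Dlist coords k u x)"
  unfolding pD_def poly_op_def poly_coeffs_eq[OF assms(1)] monomial_op_Dlist
  by (rule sum.mono_neutral_left) (use assms in auto)

lemma pD_add:
  assumes "p \<in> polys" "q \<in> polys"
  shows "pD (\<lambda>z. p z + q z) u x = pD p u x + pD q u x"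
proof -
  let ?c = "poly_coeffs p" and ?d = "poly_coeffs q"
  let ?K = "{k. ?c k \<noteq> 0} \<union> {k. ?d k \<noteq> 0}"
  have c: "has_coeffs p ?c" "has_coeffs q ?d" using assms has_coeffs_poly_coeffs by auto
  then have fin: "finite ?K" by (simp add: has_coeffs_def)
  have "pD (\<lambda>z. p z + q z) u x = (\<Sum>k\<in>?K. (?c k + ?d k) * Dlist coords k u x)"
    by (rule pD_eq[OF has_coeffs_add[OF c] fin]) auto
  moreover have "pD p u x = (\<Sum>k\<in>?K. ?c k * Dlist coords k u x)" by (rule pD_eq[OF c(1) fin]) auto
  moreover have "pD q u x = (\<Sum>k\<in>?K. ?d k * Dlist coords k u x)" by (rule pD_eq[OF c(2) fin]) auto
  ultimately show ?thesis by (simp add: distrib_right sum.distrib)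
qed

lemma pD_scale:
  assumes "p \<in> polys"
  shows "pD (\<lambda>z. a * p z) u x = a * pD p u x"
proof -
  let ?c = "poly_coeffs p"
  let ?K = "{k. ?c k \<noteq> 0}"
  have c: "has_coeffs p ?c" using assms has_coeffs_poly_coeffs by auto
  then have fin: "finite ?K" by (simp add: has_coeffs_def)
  have "pD (\<lambda>z. a * p z) u x = (\<Sum>k\<in>?K. (a * ?c k) * Dlist coords k u x)"
    by (rule pD_eq[OF has_coeffs_scale[OF c] fin]) auto
  moreover have "pD p u x = (\<Sum>k\<in>?K. ?c k * Dlist coords k u x)" by (rule pD_eq[OF c fin]) auto
  ultimately show ?thesis by (simp add: sum_distrib_left mult.assoc)
qed

lemma pD_monomial: "pD (monomial k) u x = Dlist coords k u x"
  by (subst pD_eq[OF has_coeffs_monomial, of "{k}"]) auto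

lemma pD_const: "pD (\<lambda>z. c) u x = c * u x"
proof -
  have "Dlist xs (\<lambda>i. 0) u = u" for xs by (induction xs) (auto simp: Dlist_simps)
  then have "pD (\<lambda>z. c * monomial (\<lambda>i. 0) z) u x = c * u x"
    by (subst pD_scale) (auto simp: pD_monomial intro: polys_monomial)
  then show ?thesis by simp
qed

lemma pD_sum: "(\<And>i. i \<in> I \<Longrightarrow> f i \<in> polys) \<Longrightarrow> pD (\<lambda>z. \<Sum>i\<in>I. f i z) u x = (\<Sum>i\<in>I. pD (f i) u x)"
proof (induction I rule: infinite_finite_induct)
  case (insert i I)
  then show ?case using pD_add[of "f i" "\<lambda>z. \<Sum>i\<in>I. f i z" u x] by (simp add: polys_sum)
qed (simp_all add: pD_const)

lemma pD_holo: "holo_on u W \<Longrightarrow> holo_on (pD p u) W"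
  unfolding pD_def poly_op_def[abs_def] monomial_op_Dlist
  by (intro V.holo_sum V.holo_scale Dlist_holo)

lemma pD_cong: "(\<And>x. x \<in> W \<Longrightarrow> u x = v x) \<Longrightarrow> x \<in> W \<Longrightarrow> pD p u x = pD p v x"
  unfolding pD_def poly_op_def monomial_op_Dlist
  by (intro sum.cong refl arg_cong2[of _ _ _ _ "(*)"] Dlist_cong) auto

lemma pD_coord:
  assumes p: "p \<in> polys" and u: "holo_on u W" and x: "x \<in> W"
  shows "pD (\<lambda>z. z $ i * p z) u x = Dop i (pD p u) x"
proof -
  obtain c where c: "has_coeffs p c" using p by (auto simp: polys_def)
  let ?K = "{k. c k \<noteq> 0}"
  have fin: "finite ?K" using c by (simp add: has_coeffs_def)
  have "(\<lambda>z. z $ i * p z) = (\<lambda>z. \<Sum>k\<in>?K. c k * monomial (k(i := Suc (k i))) z)"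
    using c by (simp add: has_coeffs_def sum_distrib_left monomial_coord[symmetric] mult.left_commute)
  then have "pD (\<lambda>z. z $ i * p z) u x = (\<Sum>k\<in>?K. c k * Dlist coords (k(i := Suc (k i))) u x)"
    by (simp add: pD_sum pD_scale pD_monomial polys_scale polys_monomial)
  also have "\<dots> = (\<Sum>k\<in>?K. Dop i (\<lambda>y. c k * Dlist coords k u y) x)"
    using coords_props by (intro sum.cong refl) (simp add: Dlist_shift[OF u x] dunkl_scale_fun[OF Dlist_holo[OF u] x])
  also have "\<dots> = Dop i (\<lambda>y. \<Sum>k\<in>?K. c k * Dlist coords k u y) x"
    by (rule dunkl_sum_fun[symmetric]) (auto intro!: V.holo_scale Dlist_holo u x)
  also have "(\<lambda>y. \<Sum>k\<in>?K. c k * Dlist coords k u y) = pD p u"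
    by (rule ext) (rule pD_eq[OF c fin order_refl, symmetric])
  finally show ?thesis .
qed

lemma pD_mult:
  assumes "p \<in> polys" "q \<in> polys" "holo_on u W" "x \<in> W"
  shows "pD (\<lambda>z. p z * q z) u x = pD p (pD q u) x"
  using assms(1,4)
proof (induction p arbitrary: x rule: polys_induct)
  case (const c)
  then show ?case by (simp add: pD_const pD_scale assms)
next
  case (add p p')
  then show ?case using pD_add[of "\<lambda>z. p z * q z" "\<lambda>z. p' z * q z" u x] pD_add[of p p' "pD q u" x] assms
    by (simp add: distrib_right polys_mult)
next
  case (coord i p)
  have "pD (\<lambda>z. z $ i * (p z * q z)) u x = Dop i (pD (\<lambda>z. p z * q z) u) x"
    by (rule pD_coord) (use coord assms in auto)
  also have "\<dots> = Dop i (pD p (pD q u)) x"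
    by (rule dunkl_cong[OF coord.IH coord.prems])
  also have "\<dots> = pD (\<lambda>z. z $ i * p z) (pD q u) x"
    by (rule pD_coord[symmetric]) (use coord assms pD_holo in auto)
  finally show ?case by (simp add: mult.assoc)
qed

lemma pD_linear:
  assumes p: "p \<in> polys" and u: "holo_on u W" and x: "x \<in> W"
  shows "pD (\<lambda>z. cform \<xi> z * p z) u x = dunkl A m \<xi> (pD p u) x"
proof -
  have "(\<lambda>z. cform \<xi> z * p z) = (\<lambda>z. \<Sum>i\<in>UNIV. \<xi> $ i * (z $ i * p z))"
    by (simp add: cform_def sum_distrib_right mult.assoc)
  then have "pD (\<lambda>z. cform \<xi> z * p z) u x = (\<Sum>i\<in>UNIV. \<xi> $ i * Dop i (pD p u) x)"
    using p by (simp add: pD_sum pD_scale polys_scale polys_coord_mult pD_coord[OF p u x])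
  also have "\<dots> = dunkl A m (\<Sum>i\<in>UNIV. \<xi> $ i *s axis i 1) (pD p u) x"
  proof -
    have "dunkl A m (\<Sum>i\<in>I. \<xi> $ i *s axis i 1) (pD p u) x = (\<Sum>i\<in>I. \<xi> $ i * Dop i (pD p u) x)" if "finite I" for I
      using that
    proof (induction I rule: finite_induct)
      case empty
      then show ?case using dunkl_linear(2)[OF pD_holo[OF u] x, of 0 0] by simp
    next
      case (insert i I)
      then show ?case by (simp add: dunkl_linear[OF pD_holo[OF u] x])
    qed
    then show ?thesis by simp
  qed
  also have "(\<Sum>i\<in>UNIV. \<xi> $ i *s axis i 1) = \<xi>"
    by (simp add: basis_expansion)
  finally show ?thesis .
qed

text \<open>On invariant functions the group only acts on the polynomial.\<close>

lemma pD_equivariant: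
  assumes "p \<in> polys" and u: "holo_on u W" and inv: "\<And>g x. g \<in> G \<Longrightarrow> x \<in> W \<Longrightarrow> u (cmat g *v x) = u x"
    and g: "g \<in> G" and "x \<in> W"
  shows "pD p u (cmat g *v x) = pD (\<lambda>z. p (cmat g *v z)) u x"
  using assms(1,5)
proof (induction p arbitrary: x rule: polys_induct)
  case (const c)
  then show ?case using inv[OF g] by (simp add: pD_const)
next
  case (add p q)
  then show ?case using pD_add[of "\<lambda>z. p (cmat g *v z)" "\<lambda>z. q (cmat g *v z)" u x]
    by (simp add: pD_add polys_matrix)
next
  case (coord i p)
  define \<xi> where "\<xi> = cmat (transpose g) *v axis i 1"
  have gx: "cmat g *v x \<in> W" using W_stable g coord by auto
  have \<xi>: "cmat g *v \<xi> = axis i 1" by (simp add: \<xi>_def cmat_cancel g)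
  have z: "(cmat g *v z) $ i = cform \<xi> z" for z
    by (simp add: \<xi>_def cform_axis[symmetric] cform_G_left[OF g])
  have "pD (\<lambda>z. z $ i * p z) u (cmat g *v x) = dunkl A m (cmat g *v \<xi>) (pD p u) (cmat g *v x)"
    unfolding \<xi> by (rule pD_coord[OF coord(1) u gx])
  also have "\<dots> = dunkl A m \<xi> (\<lambda>y. pD p u (cmat g *v y)) x" by (rule dunkl_G[OF g, symmetric])
  also have "\<dots> = dunkl A m \<xi> (pD (\<lambda>z. p (cmat g *v z)) u) x"
    by (rule dunkl_cong[OF coord.IH coord.prems])
  also have "\<dots> = pD (\<lambda>z. cform \<xi> z * p (cmat g *v z)) u x"
    by (rule pD_linear[symmetric]) (use coord u polys_matrix in auto)
  finally show ?case by (simp add: z)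
qed

end

section \<open>The KZ system in coordinates and the Calogero-Moser system\<close>

lemma mult_diff_swap: "c * (a - b) = - (c * (b - a))" for a b c :: complex
  by (simp add: algebra_simps)

lemma monomial_op_dir_deriv_cong:
  assumes "open S" "x \<in> S" "\<And>y. y \<in> S \<Longrightarrow> u y = v y"
  shows "monomial_op dir_deriv k u x = monomial_op dir_deriv k v x"
proof -
  have 1: "(dir_deriv e ^^ n) u y = (dir_deriv e ^^ n) v y" if "\<And>y. y \<in> S \<Longrightarrow> u y = v y" "y \<in> S" for e n u v y
    using that(2)
  proof (induction n arbitrary: y)
    case (Suc n)
    then show ?case using V.dd_cong[OF assms(1) Suc.prems Suc.IH] by (simp add: dir_deriv_dd)
  qed (use that in simp)
  have "foldr (\<lambda>i F. (dir_deriv (axis i 1) ^^ k i) \<circ> F) xs id u y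
      = foldr (\<lambda>i F. (dir_deriv (axis i 1) ^^ k i) \<circ> F) xs id v y" if "y \<in> S" for xs y
    using that
  proof (induction xs arbitrary: y)
    case (Cons i xs)
    show ?case unfolding foldr_comp_Cons by (rule 1[OF Cons.IH Cons.prems])
  qed (use assms(3) in simp)
  then show ?thesis using assms(2) by (simp add: monomial_op_def)
qed

lemma apply_diffop_cong:
  assumes "open S" "x \<in> S" "\<And>y. y \<in> S \<Longrightarrow> u y = v y"
  shows "apply_diffop L u x = apply_diffop L v x"
  unfolding apply_diffop_def using monomial_op_dir_deriv_cong[OF assms] by simp

context refl_group
begin

text \<open>
  The KZ equations for \<open>\<psi>\<close> in terms of the functions \<open>F p = \<mu>(p \<psi>)\<close>. The sign in front of the reflected
  term comes from the anti-invariance of \<open>\<mu>\<close>.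
\<close>

definition KZ_family :: "'n cspace \<Rightarrow> 'n cspace set \<Rightarrow> (('n cspace \<Rightarrow> complex) \<Rightarrow> 'n cspace \<Rightarrow> complex) \<Rightarrow> bool" where
  "KZ_family l U F \<longleftrightarrow>
     (\<forall>p\<in>polys. holo_on (F p) U) \<and>
     (\<forall>p\<in>polys. \<forall>q\<in>polys. \<forall>x\<in>U. F (\<lambda>z. p z + q z) x = F p x + F q x) \<and>
     (\<forall>c. \<forall>p\<in>polys. \<forall>x\<in>U. F (\<lambda>z. c * p z) x = c * F p x) \<and>
     (\<forall>q\<in>ideal_at G l. \<forall>x\<in>U. F q x = 0) \<and>
     (\<forall>p\<in>polys. \<forall>\<xi>. \<forall>x\<in>U. dir_deriv \<xi> (F p) x =
        (\<Sum>a\<in>A. of_nat (m a) * (cform (cvec a) \<xi> / cform (cvec a) x) * (F p x - F (\<lambda>z. p (cmat (refl_mat a) *v z)) x))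
        + F (\<lambda>z. cform \<xi> z * p z) x)"

lemma KZ_familyD:
  assumes "KZ_family l U F" "p \<in> polys"
  shows "holo_on (F p) U"
    "q \<in> polys \<Longrightarrow> x \<in> U \<Longrightarrow> F (\<lambda>z. p z + q z) x = F p x + F q x"
    "x \<in> U \<Longrightarrow> F (\<lambda>z. c * p z) x = c * F p x"
    "x \<in> U \<Longrightarrow> dir_deriv \<xi> (F p) x =
        (\<Sum>a\<in>A. of_nat (m a) * (cform (cvec a) \<xi> / cform (cvec a) x) * (F p x - F (\<lambda>z. p (cmat (refl_mat a) *v z)) x))
        + F (\<lambda>z. cform \<xi> z * p z) x"
  using assms unfolding KZ_family_def by blast+

lemma KZ_family_ideal: "KZ_family l U F \<Longrightarrow> q \<in> ideal_at G l \<Longrightarrow> x \<in> U \<Longrightarrow> F q x = 0"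
  unfolding KZ_family_def by blast

lemma KZ_family_subset: "KZ_family l U F \<Longrightarrow> U' \<subseteq> U \<Longrightarrow> KZ_family l U' F"
  unfolding KZ_family_def by (meson V.holo_subset subsetD)

lemma KZ_family_cong:
  assumes "KZ_family l U F" "open U" "\<And>p x. p \<in> polys \<Longrightarrow> x \<in> U \<Longrightarrow> F p x = F' p x"
  shows "KZ_family l U F'"
  unfolding KZ_family_def
proof (intro conjI ballI allI)
  fix p :: "'n cspace \<Rightarrow> complex" assume p: "p \<in> polys"
  show "holo_on (F' p) U"
    by (rule V.holo_cong[OF KZ_familyD(1)[OF assms(1) p] assms(2)]) (use assms(3) p in auto)
  fix \<xi> x assume x: "x \<in> U"
  have "dir_deriv \<xi> (F' p) x = dir_deriv \<xi> (F p) x"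
    unfolding dir_deriv_dd by (rule V.dd_cong[OF assms(2) x]) (use assms(3) p in auto)
  then show "dir_deriv \<xi> (F' p) x =
        (\<Sum>a\<in>A. of_nat (m a) * (cform (cvec a) \<xi> / cform (cvec a) x) * (F' p x - F' (\<lambda>z. p (cmat (refl_mat a) *v z)) x))
        + F' (\<lambda>z. cform \<xi> z * p z) x"
    using KZ_familyD(4)[OF assms(1) p x] assms(3) p x by (simp add: polys_matrix polys_mult polys_cform)
next
  fix p q :: "'n cspace \<Rightarrow> complex" and x assume "p \<in> polys" "q \<in> polys" "x \<in> U"
  then show "F' (\<lambda>z. p z + q z) x = F' p x + F' q x"
    using KZ_familyD(2)[OF assms(1)] assms(3) by (metis polys_add)
next
  fix c x and p :: "'n cspace \<Rightarrow> complex" assume "p \<in> polys" "x \<in> U"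
  then show "F' (\<lambda>z. c * p z) x = c * F' p x"
    using KZ_familyD(3)[OF assms(1)] assms(3) by (metis polys_scale)
next
  fix q x assume "q \<in> ideal_at G l" "x \<in> U"
  then show "F' q x = 0" using KZ_family_ideal[OF assms(1)] assms(3) ideal_at_polys by metis
qed

lemma KZ_family_local:
  assumes "\<And>x. x \<in> U \<Longrightarrow> \<exists>C. x \<in> C \<and> KZ_family l C F"
  shows "KZ_family l U F"
  unfolding KZ_family_def
proof (intro conjI ballI allI)
  fix p :: "'n cspace \<Rightarrow> complex" assume p: "p \<in> polys"
  show "holo_on (F p) U" by (rule V.holo_local) (use assms KZ_familyD(1) p in blast)
qed (use assms KZ_familyD KZ_family_ideal in meson)+

lemma KZ_family_add:
  assumes "KZ_family l U F" "KZ_family l U F'"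
  shows "KZ_family l U (\<lambda>p x. F p x + F' p x)"
  unfolding KZ_family_def
proof (intro conjI ballI allI)
  fix p :: "'n cspace \<Rightarrow> complex" assume p: "p \<in> polys"
  note h = KZ_familyD(1)[OF assms(1) p] KZ_familyD(1)[OF assms(2) p]
  show "holo_on (\<lambda>x. F p x + F' p x) U" by (rule V.holo_add(1)[OF h])
  fix \<xi> x assume x: "x \<in> U"
  have "dir_deriv \<xi> (\<lambda>x. F p x + F' p x) x = dir_deriv \<xi> (F p) x + dir_deriv \<xi> (F' p) x"
    unfolding dir_deriv_dd by (rule V.holo_add(2)[OF h x])
  moreover have "c * (a + b - (d + e)) = c * (a - d) + c * (b - e)" for a b c d e :: complex
    by (simp add: algebra_simps)
  ultimately show "dir_deriv \<xi> (\<lambda>x. F p x + F' p x) x =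
        (\<Sum>a\<in>A. of_nat (m a) * (cform (cvec a) \<xi> / cform (cvec a) x) * (F p x + F' p x
          - (F (\<lambda>z. p (cmat (refl_mat a) *v z)) x + F' (\<lambda>z. p (cmat (refl_mat a) *v z)) x)))
        + (F (\<lambda>z. cform \<xi> z * p z) x + F' (\<lambda>z. cform \<xi> z * p z) x)"
    using KZ_familyD(4)[OF assms(1) p x] KZ_familyD(4)[OF assms(2) p x] by (simp add: sum.distrib)
next
  fix p q :: "'n cspace \<Rightarrow> complex" and x assume "p \<in> polys" "q \<in> polys" "x \<in> U"
  then show "F (\<lambda>z. p z + q z) x + F' (\<lambda>z. p z + q z) x = F p x + F' p x + (F q x + F' q x)"
    using KZ_familyD(2)[OF assms(1)] KZ_familyD(2)[OF assms(2)] by simp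
next
  fix c x and p :: "'n cspace \<Rightarrow> complex" assume "p \<in> polys" "x \<in> U"
  then show "F (\<lambda>z. c * p z) x + F' (\<lambda>z. c * p z) x = c * (F p x + F' p x)"
    using KZ_familyD(3)[OF assms(1)] KZ_familyD(3)[OF assms(2)] by (simp add: distrib_left)
qed (use KZ_family_ideal[OF assms(1)] KZ_family_ideal[OF assms(2)] in simp)

lemma KZ_family_scale:
  assumes "KZ_family l U F"
  shows "KZ_family l U (\<lambda>p x. k * F p x)"
  unfolding KZ_family_def
proof (intro conjI ballI allI)
  fix p :: "'n cspace \<Rightarrow> complex" assume p: "p \<in> polys"
  note h = KZ_familyD(1)[OF assms(1) p]
  show "holo_on (\<lambda>x. k * F p x) U" by (rule V.holo_scale[OF h])
  fix \<xi> x assume x: "x \<in> U"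
  have "dir_deriv \<xi> (\<lambda>x. k * F p x) x = k * dir_deriv \<xi> (F p) x"
  proof -
    have "V.dd \<xi> (\<lambda>y. k * F p y) x = k * V.dd \<xi> (F p) x + V.dd \<xi> (\<lambda>y. k) x * F p x"
      by (rule V.holo_mult(2)[OF V.holo_const h x])
    then show ?thesis by (simp add: dir_deriv_dd) (simp add: V.dd_def)
  qed
  moreover have "c * (k * a - k * b) = k * (c * (a - b))" for a b c :: complex
    by (simp add: algebra_simps)
  ultimately show "dir_deriv \<xi> (\<lambda>x. k * F p x) x =
        (\<Sum>a\<in>A. of_nat (m a) * (cform (cvec a) \<xi> / cform (cvec a) x) * (k * F p x
          - k * F (\<lambda>z. p (cmat (refl_mat a) *v z)) x))
        + k * F (\<lambda>z. cform \<xi> z * p z) x"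
    using KZ_familyD(4)[OF assms(1) p x] by (simp only: distrib_left sum_distrib_left)
next
  fix p q :: "'n cspace \<Rightarrow> complex" and x assume "p \<in> polys" "q \<in> polys" "x \<in> U"
  then show "k * F (\<lambda>z. p z + q z) x = k * F p x + k * F q x"
    using KZ_familyD(2)[OF assms(1)] by (simp add: distrib_left)
next
  fix c x and p :: "'n cspace \<Rightarrow> complex" assume "p \<in> polys" "x \<in> U"
  then show "k * F (\<lambda>z. c * p z) x = c * (k * F p x)"
    using KZ_familyD(3)[OF assms(1)] by simp
qed (use KZ_family_ideal[OF assms] in simp)

end

subsection \<open>Invariant extension from a small neighbourhood\<close>

locale refl_nbhd = refl_group G A m \<epsilon>
  for G :: "(real ^ 'n::finite ^ 'n) set" and A m \<epsilon> +
  fixes C :: "'n cspace set"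
  assumes open_C: "open C" and C_regular: "C \<subseteq> regular_set A"
    and C_disjoint: "\<And>g x. g \<in> G \<Longrightarrow> x \<in> C \<Longrightarrow> cmat g *v x \<in> C \<Longrightarrow> g = mat 1"
begin

definition saturation :: "'n cspace set" where
  "saturation = {y. \<exists>g\<in>G. cmat g *v y \<in> C}"

lemma continuous_cmat: "continuous_on S (\<lambda>x. cmat g *v x)"
  by (intro linear_continuous_on matrix_vector_mul_bounded_linear)

lemma open_preimage: "open {y. cmat g *v y \<in> C}"
  using open_vimage[OF open_C continuous_cmat[of UNIV g]] by (simp add: vimage_def)

lemma C_subset_saturation: "C \<subseteq> saturation"
  using one_G by (auto simp: saturation_def intro!: bexI[of _ "mat 1"])

lemma saturation_cases:
  assumes "y \<in> saturation"
  obtains h x where "h \<in> G" "x \<in> C" "y = cmat h *v x"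
proof -
  obtain g where g: "g \<in> G" "cmat g *v y \<in> C" using assms by (auto simp: saturation_def)
  show thesis
    by (rule that[of "transpose g" "cmat g *v y"]) (use g transpose_G cmat_cancel in auto)
qed

end

sublocale refl_nbhd \<subseteq> refl_domain G A m \<epsilon> saturation
proof
  have "saturation = (\<Union>g\<in>G. {y. cmat g *v y \<in> C})" by (auto simp: saturation_def)
  then show "open saturation" using open_preimage by auto
  show "saturation \<subseteq> regular_set A"
  proof
    fix y assume "y \<in> saturation"
    then obtain h x where "h \<in> G" "x \<in> C" "y = cmat h *v x" by (rule saturation_cases)
    then show "y \<in> regular_set A" using C_regular regular_set_G by auto
  qed
  fix g x assume g: "g \<in> G" and x: "x \<in> saturation"
  obtain h where h: "h \<in> G" "cmat h *v x \<in> C" using x by (auto simp: saturation_def)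
  have "cmat (h ** transpose g) *v (cmat g *v x) = cmat h *v x"
    using cmat_cancel[OF g] by (simp add: cmat_mult matrix_vector_mul_assoc[symmetric])
  then show "cmat g *v x \<in> saturation" using h g transpose_G mult_G unfolding saturation_def
    by (intro CollectI bexI[of _ "h ** transpose g"]) auto
qed

context refl_nbhd
begin

text \<open>The group element that carries \<open>y\<close> into \<open>C\<close>; it is unique because the translates of \<open>C\<close> are disjoint.\<close>

definition sel :: "'n cspace \<Rightarrow> real ^ 'n ^ 'n" where
  "sel y = (THE g. g \<in> G \<and> cmat g *v y \<in> C)"

lemma sel_eq:
  assumes "g \<in> G" "cmat g *v y \<in> C"
  shows "sel y = g"
  unfolding sel_def
proof (rule the_equality)
  fix h assume h: "h \<in> G \<and> cmat h *v y \<in> C"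
  have "cmat (h ** transpose g) *v (cmat g *v y) = cmat h *v y"
    using cmat_cancel[OF assms(1)] by (simp add: cmat_mult matrix_vector_mul_assoc[symmetric])
  then have "h ** transpose g = mat 1"
    using C_disjoint[of "h ** transpose g" "cmat g *v y"] h assms transpose_G mult_G by auto
  then have "h ** (transpose g ** g) = g" by (simp add: matrix_mul_assoc)
  then show "h = g" using transpose_mult_G[OF assms(1)] by simp
qed (use assms in auto)

text \<open>
  A function on the saturation amounts to one function on each translate of \<open>C\<close>; these are transported
  to \<open>C\<close> and indexed by the group element that carries the translate to \<open>C\<close>.
\<close>

definition assemble :: "(real ^ 'n ^ 'n \<Rightarrow> 'n cspace \<Rightarrow> complex) \<Rightarrow> 'n cspace \<Rightarrow> complex" where
  "assemble \<Phi> y = \<Phi> (sel y) (cmat (sel y) *v y)"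

lemma assemble_eq: "h \<in> G \<Longrightarrow> x \<in> C \<Longrightarrow> assemble \<Phi> (cmat h *v x) = \<Phi> (transpose h) x"
  using sel_eq[of "transpose h" "cmat h *v x"] cmat_cancel[of h x] transpose_G[of h]
  by (simp add: assemble_def)

lemma assemble_C: "x \<in> C \<Longrightarrow> assemble \<Phi> x = \<Phi> (mat 1) x"
  using assemble_eq[OF one_G, of x \<Phi>] by (simp add: transpose_mat)

lemma assemble_holo:
  assumes "\<And>g. g \<in> G \<Longrightarrow> holo_on (\<Phi> g) C"
  shows "holo_on (assemble \<Phi>) saturation"
proof (rule V.holo_local)
  fix y assume "y \<in> saturation"
  then obtain g where g: "g \<in> G" "cmat g *v y \<in> C" by (auto simp: saturation_def)
  have "holo_on (\<lambda>y. \<Phi> g (cmat g *v y)) {y. cmat g *v y \<in> C}"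
    by (rule V.holo_linear_sub[OF assms[OF g(1)] matrix_vector_mul_bounded_linear])
       (auto simp: vector_scalar_commute)
  then have "holo_on (assemble \<Phi>) {y. cmat g *v y \<in> C}"
    by (rule V.holo_cong[OF _ open_preimage]) (simp add: assemble_def sel_eq[OF g(1)])
  then show "\<exists>W'. y \<in> W' \<and> holo_on (assemble \<Phi>) W'"
    using g(2) by (intro exI[of _ "{y. cmat g *v y \<in> C}"]) auto
qed

definition inv_ext :: "('n cspace \<Rightarrow> complex) \<Rightarrow> 'n cspace \<Rightarrow> complex" where
  "inv_ext \<phi> = assemble (\<lambda>g. \<phi>)"

lemma inv_ext_C: "x \<in> C \<Longrightarrow> inv_ext \<phi> x = \<phi> x"
  by (simp add: inv_ext_def assemble_C)

lemma inv_ext_holo: "holo_on \<phi> C \<Longrightarrow> holo_on (inv_ext \<phi>) saturation"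
  unfolding inv_ext_def by (rule assemble_holo)

lemma inv_ext_G:
  assumes "g \<in> G" "y \<in> saturation"
  shows "inv_ext \<phi> (cmat g *v y) = inv_ext \<phi> y"
proof -
  obtain h x where hx: "h \<in> G" "x \<in> C" "y = cmat h *v x" using saturation_cases[OF assms(2)] by blast
  have "inv_ext \<phi> (cmat (g ** h) *v x) = inv_ext \<phi> (cmat h *v x)"
    unfolding inv_ext_def using hx assms mult_G by (simp add: assemble_eq)
  then show ?thesis using hx by (simp add: cmat_mult matrix_vector_mul_assoc)
qed

lemma inv_ext_cong:
  assumes "\<And>x. x \<in> C \<Longrightarrow> \<phi> x = \<phi>' x" "y \<in> saturation"
  shows "inv_ext \<phi> y = inv_ext \<phi>' y"
proof -
  obtain h x where "h \<in> G" "x \<in> C" "y = cmat h *v x" using saturation_cases[OF assms(2)] by blast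
  then show ?thesis using assms(1) by (simp add: inv_ext_def assemble_eq)
qed

text \<open>
  Let \<open>E p\<close> take the value \<open>F (p \<circ> h) x\<close> at the point \<open>h x\<close>. On \<open>C\<close> the KZ equations read
  \<open>D\<^sub>\<xi> (E p) = E (\<xi> p)\<close>, since \<open>F (p \<circ> s\<^sub>\<alpha>)\<close> is the value of \<open>E p\<close> at the reflected point. By equivariance this
  holds on all translates, and the powers of the coordinates can be built up one by one.
\<close>

theorem KZ_family_pD:
  assumes F: "KZ_family l C F" and p: "p \<in> polys" and x: "x \<in> C"
  shows "pD p (inv_ext (F (\<lambda>z. 1))) x = F p x"
proof -
  define E where "E p = assemble (\<lambda>g. F (\<lambda>z. p (cmat (transpose g) *v z)))" for p
  have E: "E p (cmat h *v x) = F (\<lambda>z. p (cmat h *v z)) x" if "h \<in> G" "x \<in> C" for p h x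
    using that by (simp add: E_def assemble_eq)
  have E_C: "E p x = F p x" if "x \<in> C" for p x
    using E[OF one_G that, of p] by simp
  have E_G: "E p (cmat h *v y) = E (\<lambda>z. p (cmat h *v z)) y" if h: "h \<in> G" and y: "y \<in> saturation" for p h y
  proof -
    obtain k x where kx: "k \<in> G" "x \<in> C" "y = cmat k *v x" using saturation_cases[OF y] by blast
    have "E p (cmat (h ** k) *v x) = F (\<lambda>z. p (cmat (h ** k) *v z)) x"
      by (rule E) (use h kx mult_G in auto)
    then show ?thesis using E[OF kx(1,2), of "\<lambda>z. p (cmat h *v z)"] kx
      by (simp add: cmat_mult matrix_vector_mul_assoc)
  qed
  have base: "dunkl A m \<xi> (E p) x = E (\<lambda>z. cform \<xi> z * p z) x" if p: "p \<in> polys" and x: "x \<in> C" for \<xi> p x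
  proof -
    have "dir_deriv \<xi> (E p) x = dir_deriv \<xi> (F p) x"
      unfolding dir_deriv_dd by (rule V.dd_cong[OF open_C x E_C])
    moreover have "dunkl_diff \<xi> (E p) x = (\<Sum>a\<in>A. of_nat (m a) * (cform (cvec a) \<xi> / cform (cvec a) x)
        * (F (\<lambda>z. p (cmat (refl_mat a) *v z)) x - F p x))"
      unfolding dunkl_diff_def by (intro sum.cong refl) (simp add: E[OF refl_G x] E_C[OF x])
    moreover have "(\<Sum>a\<in>A. of_nat (m a) * (cform (cvec a) \<xi> / cform (cvec a) x)
        * (F (\<lambda>z. p (cmat (refl_mat a) *v z)) x - F p x))
      = - (\<Sum>a\<in>A. of_nat (m a) * (cform (cvec a) \<xi> / cform (cvec a) x)
        * (F p x - F (\<lambda>z. p (cmat (refl_mat a) *v z)) x))"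
      unfolding sum_negf[symmetric] by (intro sum.cong refl mult_diff_swap)
    ultimately show ?thesis
      using KZ_familyD(4)[OF F p x, of \<xi>] by (simp add: dunkl_alt E_C[OF x])
  qed
  have D: "dunkl A m \<xi> (E p) y = E (\<lambda>z. cform \<xi> z * p z) y" if p: "p \<in> polys" and y: "y \<in> saturation" for \<xi> p y
  proof -
    obtain h x where hx: "h \<in> G" "x \<in> C" "y = cmat h *v x" using saturation_cases[OF y] by blast
    define \<eta> where "\<eta> = cmat (transpose h) *v \<xi>"
    have xs: "x \<in> saturation" using hx C_subset_saturation by auto
    have "dunkl A m \<xi> (E p) y = dunkl A m (cmat h *v \<eta>) (E p) (cmat h *v x)"
      by (simp add: \<eta>_def hx cmat_cancel)
    also have "\<dots> = dunkl A m \<eta> (\<lambda>y. E p (cmat h *v y)) x" by (rule dunkl_G[OF hx(1), symmetric])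
    also have "\<dots> = dunkl A m \<eta> (E (\<lambda>z. p (cmat h *v z))) x"
      by (rule dunkl_cong[OF E_G[OF hx(1)] xs])
    also have "\<dots> = E (\<lambda>z. cform \<eta> z * p (cmat h *v z)) x"
      by (rule base[OF polys_matrix[OF p] hx(2)])
    also have "(\<lambda>z. cform \<eta> z * p (cmat h *v z)) = (\<lambda>z. cform \<xi> (cmat h *v z) * p (cmat h *v z))"
      by (simp add: \<eta>_def cform_G_left[OF hx(1)])
    also have "E (\<lambda>z. cform \<xi> (cmat h *v z) * p (cmat h *v z)) x = E (\<lambda>z. cform \<xi> z * p z) y"
      using E_G[OF hx(1) xs, of "\<lambda>z. cform \<xi> z * p z"] hx(3) by simp
    finally show ?thesis .
  qed
  have u: "inv_ext (F (\<lambda>z. 1)) = E (\<lambda>z. 1)" by (simp add: inv_ext_def E_def)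
  have holo_u: "holo_on (E (\<lambda>z. 1)) saturation"
    unfolding u[symmetric] by (intro inv_ext_holo KZ_familyD(1)[OF F]) auto
  have main: "pD p (E (\<lambda>z. 1)) y = E p y" if "p \<in> polys" "y \<in> saturation" for p y
    using that
  proof (induction p arbitrary: y rule: polys_induct)
    case (const c)
    obtain h x where hx: "h \<in> G" "x \<in> C" "y = cmat h *v x" using saturation_cases[OF const] by blast
    have "F (\<lambda>z. c * 1) x = c * F (\<lambda>z. 1) x" by (rule KZ_familyD(3)[OF F _ hx(2)]) auto
    then show ?case by (simp add: pD_const hx(3) E[OF hx(1,2)])
  next
    case (add p q)
    obtain h x where hx: "h \<in> G" "x \<in> C" "y = cmat h *v x" using saturation_cases[OF add(5)] by blast
    have "F (\<lambda>z. p (cmat h *v z) + q (cmat h *v z)) x = F (\<lambda>z. p (cmat h *v z)) x + F (\<lambda>z. q (cmat h *v z)) x"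
      by (rule KZ_familyD(2)[OF F _ _ hx(2)]) (use add polys_matrix in auto)
    then show ?case using add by (simp add: pD_add hx(3) E[OF hx(1,2)])
  next
    case (coord i p)
    have "pD (\<lambda>z. z $ i * p z) (E (\<lambda>z. 1)) y = Dop i (pD p (E (\<lambda>z. 1))) y"
      by (rule pD_coord) (use coord holo_u in auto)
    also have "\<dots> = Dop i (E p) y" by (rule dunkl_cong[OF coord.IH coord.prems])
    also have "\<dots> = E (\<lambda>z. z $ i * p z) y" using D[OF coord(1,3), of "axis i 1"] by (simp add: cform_axis)
    finally show ?case .
  qed
  show ?thesis unfolding u using main[OF p] x C_subset_saturation E_C by auto
qed

text \<open>
  The KZ equations are the identity \<open>D\<^sub>\<xi> (p(D) u) = (\<xi> p)(D) u\<close>, with values at reflected points rewritten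
  by equivariance. Since \<open>p \<mapsto> p(D)\<close> is multiplicative, \<open>u\<close> is an eigenfunction of all polynomials in
  the \<open>\<sigma>\<^sub>i\<close>, that is, of all invariants, and so \<open>p(D) u = 0\<close> for \<open>p\<close> in \<open>I(\<lambda>)\<close>.
\<close>

theorem KZ_family_of_eigenfunction:
  assumes \<sigma>: "free_homogeneous_generators G \<sigma>" and \<phi>: "holo_on \<phi> C"
    and eigen: "\<And>i x. x \<in> C \<Longrightarrow> pD (\<sigma> i) (inv_ext \<phi>) x = \<sigma> i l * \<phi> x"
  shows "KZ_family l C (\<lambda>p. pD p (inv_ext \<phi>))"
proof -
  let ?u = "inv_ext \<phi>"
  have u: "holo_on ?u saturation" by (rule inv_ext_holo[OF \<phi>])
  have \<sigma>_inv: "\<sigma> i \<in> inv_polys G" for i using \<sigma> by (simp add: free_homogeneous_generators_def)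
  have gen: "pD (\<sigma> i) ?u y = \<sigma> i l * ?u y" if y: "y \<in> saturation" for i y
  proof -
    obtain h x where hx: "h \<in> G" "x \<in> C" "y = cmat h *v x" using saturation_cases[OF y] by blast
    have xs: "x \<in> saturation" using hx C_subset_saturation by auto
    have "pD (\<sigma> i) ?u y = pD (\<lambda>z. \<sigma> i (cmat h *v z)) ?u x"
      unfolding hx(3) by (rule pD_equivariant[OF inv_polys_polys[OF \<sigma>_inv] u inv_ext_G hx(1) xs])
    also have "(\<lambda>z. \<sigma> i (cmat h *v z)) = \<sigma> i" using inv_polys_G[OF \<sigma>_inv hx(1)] by auto
    finally show ?thesis using eigen[OF hx(2)] inv_ext_G[OF hx(1) xs] inv_ext_C[OF hx(2)] hx(3) by simp
  qed
  have poly: "pD (\<lambda>z. P (\<chi> i. \<sigma> i z)) ?u y = P (\<chi> i. \<sigma> i l) * ?u y" if "P \<in> polys" "y \<in> saturation" for P y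
    using that
  proof (induction P arbitrary: y rule: polys_induct)
    case (const c)
    then show ?case by (simp add: pD_const)
  next
    case (add P Q)
    then show ?case using inv_polys_polys[OF \<sigma>_inv]
      by (simp add: pD_add polys_compose_polys distrib_right)
  next
    case (coord i P)
    let ?P = "\<lambda>z. P (\<chi> i. \<sigma> i z)"
    have P: "?P \<in> polys" using coord(1) inv_polys_polys[OF \<sigma>_inv] by (rule polys_compose_polys)
    have "pD (\<lambda>z. \<sigma> i z * ?P z) ?u y = pD (\<sigma> i) (pD ?P ?u) y"
      by (rule pD_mult[OF inv_polys_polys[OF \<sigma>_inv] P u coord(3)])
    also have "\<dots> = pD (\<sigma> i) (\<lambda>y. P (\<chi> i. \<sigma> i l) * ?u y) y"
      by (rule pD_cong[OF coord.IH coord.prems])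
    also have "\<dots> = pD (\<sigma> i) (pD (\<lambda>z. P (\<chi> i. \<sigma> i l)) ?u) y"
      by (simp add: pD_const[abs_def])
    also have "\<dots> = pD (\<lambda>z. \<sigma> i z * P (\<chi> i. \<sigma> i l)) ?u y"
      by (rule pD_mult[symmetric, OF inv_polys_polys[OF \<sigma>_inv] _ u coord(3)]) auto
    also have "\<dots> = P (\<chi> i. \<sigma> i l) * pD (\<sigma> i) ?u y"
      using pD_scale[OF inv_polys_polys[OF \<sigma>_inv], of "P (\<chi> i. \<sigma> i l)" i ?u y] by (simp add: mult.commute)
    finally show ?case using gen[OF coord(3)] by simp
  qed
  have inv0: "pD (\<lambda>z. h z * f z) ?u y = 0" if f: "f \<in> inv_polys G" "f l = 0" and h: "h \<in> polys" and y: "y \<in> saturation" for f h y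
  proof -
    obtain P where P: "P \<in> polys" "f = (\<lambda>z. P (\<chi> i. \<sigma> i z))"
      using \<sigma> f(1) unfolding free_homogeneous_generators_def bij_betw_def by blast
    have "pD f ?u y = 0" if "y \<in> saturation" for y
      using poly[OF P(1) that] P(2) f(2) by simp
    then have "pD h (pD f ?u) y = pD h (\<lambda>y. 0) y" by (intro pD_cong[OF _ y]) auto
    also have "\<dots> = pD h (pD (\<lambda>z. 0) ?u) y" by (simp add: pD_const[abs_def])
    also have "\<dots> = pD (\<lambda>z. h z * 0) ?u y" by (rule pD_mult[symmetric, OF h _ u y]) auto
    also have "\<dots> = 0" by (simp add: pD_const)
    finally show ?thesis using pD_mult[OF h inv_polys_polys[OF f(1)] u y] by simp
  qed
  let ?I = "{q \<in> polys. \<forall>h\<in>polys. \<forall>y\<in>saturation. pD (\<lambda>z. h z * q z) ?u y = 0}"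
  have sub: "ideal_at G l \<subseteq> ?I"
  proof (rule ideal_at_subset)
    show "ideal ?I poly_alg"
    proof (rule ideal_poly_algI)
      show "(\<lambda>z. 0) \<in> ?I" by (auto simp: pD_const)
    next
      fix p q :: "'n cspace \<Rightarrow> complex" assume *: "p \<in> ?I" "q \<in> ?I"
      have "pD (\<lambda>z. h z * (p z + q z)) ?u y = 0" if "h \<in> polys" "y \<in> saturation" for h y
        using pD_add[OF polys_mult[of h p] polys_mult[of h q]] * that by (simp add: distrib_left)
      then show "(\<lambda>z. p z + q z) \<in> ?I" using * by auto
    next
      fix q h :: "'n cspace \<Rightarrow> complex" assume *: "q \<in> ?I" "h \<in> polys"
      have "pD (\<lambda>z. k z * (h z * q z)) ?u y = 0" if k: "k \<in> polys" "y \<in> saturation" for k y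
      proof -
        have "(\<lambda>z. k z * h z) \<in> polys" using k * by auto
        then have "pD (\<lambda>z. (\<lambda>z. k z * h z) z * q z) ?u y = 0" using *(1) k(2) by fast
        then show ?thesis by (simp add: mult.assoc)
      qed
      then show "(\<lambda>z. h z * q z) \<in> ?I" using * by auto
    qed auto
    fix f assume "f \<in> inv_polys G" "f l = 0"
    then show "f \<in> ?I" using inv0 inv_polys_polys by auto
  qed
  show ?thesis
    unfolding KZ_family_def
  proof (intro conjI ballI allI)
    fix p :: "'n cspace \<Rightarrow> complex" assume p: "p \<in> polys"
    show "holo_on (pD p ?u) C" by (rule V.holo_subset[OF pD_holo[OF u] C_subset_saturation])
    fix \<xi> x assume x: "x \<in> C"
    then have xs: "x \<in> saturation" using C_subset_saturation by auto
    have "dir_deriv \<xi> (pD p ?u) x = dunkl A m \<xi> (pD p ?u) x - dunkl_diff \<xi> (pD p ?u) x"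
      by (simp add: dunkl_alt)
    also have "dunkl A m \<xi> (pD p ?u) x = pD (\<lambda>z. cform \<xi> z * p z) ?u x"
      by (rule pD_linear[OF p u xs, symmetric])
    also have "dunkl_diff \<xi> (pD p ?u) x = (\<Sum>a\<in>A. of_nat (m a) * (cform (cvec a) \<xi> / cform (cvec a) x)
        * (pD (\<lambda>z. p (cmat (refl_mat a) *v z)) ?u x - pD p ?u x))"
      unfolding dunkl_diff_def
      by (intro sum.cong refl) (simp add: pD_equivariant[OF p u inv_ext_G refl_G xs])
    also have "\<dots> = - (\<Sum>a\<in>A. of_nat (m a) * (cform (cvec a) \<xi> / cform (cvec a) x)
        * (pD p ?u x - pD (\<lambda>z. p (cmat (refl_mat a) *v z)) ?u x))"
      unfolding sum_negf[symmetric] by (intro sum.cong refl mult_diff_swap)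
    finally show "dir_deriv \<xi> (pD p ?u) x =
        (\<Sum>a\<in>A. of_nat (m a) * (cform (cvec a) \<xi> / cform (cvec a) x) * (pD p ?u x - pD (\<lambda>z. p (cmat (refl_mat a) *v z)) ?u x))
        + pD (\<lambda>z. cform \<xi> z * p z) ?u x" by simp
  next
    fix q x assume q: "q \<in> ideal_at G l" and "x \<in> C"
    then have "x \<in> saturation" using C_subset_saturation by auto
    moreover have "q \<in> ?I" using sub q by auto
    ultimately have "pD (\<lambda>z. (\<lambda>z. 1) z * q z) ?u x = 0" using polys_const[of 1] by fast
    then show "pD q ?u x = 0" by simp
  qed (auto simp: pD_add pD_scale)
qed

end

context refl_group
begin

text \<open>A regular point has trivial stabilizer, so its translates have positive distance from it, and a
  sufficiently small ball is disjoint from its translates.\<close>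

lemma small_neighbourhood:
  assumes "open U" "U \<subseteq> regular_set A" "x0 \<in> U"
  shows "\<exists>C. x0 \<in> C \<and> C \<subseteq> U \<and> refl_nbhd G A m \<epsilon> C"
proof -
  obtain e where e: "e > 0" "ball x0 e \<subseteq> U" using assms(1,3) by (meson open_contains_ball)
  have "finite ((\<lambda>g. cmat g *v x0) ` G)" using finite_G by auto
  then obtain d where d: "d > 0" "\<And>y. y \<in> (\<lambda>g. cmat g *v x0) ` G \<Longrightarrow> y \<noteq> x0 \<Longrightarrow> d \<le> dist x0 y"
    using finite_set_avoid[of _ x0] by metis
  have "\<exists>K. \<forall>v. norm (cmat g *v v) \<le> norm v * K" for g :: "real ^ 'n ^ 'n"
    using bounded_linear.bounded[OF matrix_vector_mul_bounded_linear[of "cmat g"]] by blast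
  then obtain K where K: "\<And>(g :: real ^ 'n ^ 'n) v. norm (cmat g *v v) \<le> norm v * K g" by metis
  define M where "M = (\<Sum>g\<in>G. \<bar>K g\<bar>)"
  have M: "norm (cmat g *v v) \<le> norm v * M" if "g \<in> G" for g v
  proof -
    have "K g \<le> M" using member_le_sum[of g G "\<lambda>g. \<bar>K g\<bar>"] that finite_G by (simp add: M_def)
    then show ?thesis using K[of g v] mult_left_mono[of "K g" M "norm v"] by simp
  qed
  have "M \<ge> 0" by (simp add: M_def sum_nonneg)
  \<comment> \<open>Points of a ball and their images both move by less than \<open>r + r * M\<close>, which stays below \<open>d\<close>.\<close>
  define r where "r = min e (d / (M + 1))"
  have r: "r > 0" "r \<le> e" using e(1) d(1) \<open>M \<ge> 0\<close> by (auto simp: r_def)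
  have "r * (M + 1) \<le> d / (M + 1) * (M + 1)"
    using \<open>M \<ge> 0\<close> by (intro mult_right_mono) (auto simp: r_def)
  also have "\<dots> = d" using \<open>M \<ge> 0\<close> by simp
  finally have rd: "r * (M + 1) \<le> d" .
  have "refl_nbhd G A m \<epsilon> (ball x0 r)"
  proof unfold_locales
    show "ball x0 r \<subseteq> regular_set A" using e(2) r(2) assms(2) by (meson dual_order.trans subset_ball)
    fix g x assume g: "g \<in> G" and x: "x \<in> ball x0 r" "cmat g *v x \<in> ball x0 r"
    have "cmat g *v x0 = x0"
    proof (rule ccontr)
      assume ne: "cmat g *v x0 \<noteq> x0"
      have "d \<le> dist x0 (cmat g *v x0)" using d(2) g ne by blast
      also have "\<dots> \<le> dist x0 (cmat g *v x) + dist (cmat g *v x) (cmat g *v x0)" by (rule dist_triangle)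
      also have "dist (cmat g *v x) (cmat g *v x0) \<le> dist x x0 * M"
        using M[OF g, of "x - x0"] by (simp add: dist_norm matrix_vector_mult_diff_distrib)
      also have "dist x x0 * M \<le> r * M" using x(1) \<open>M \<ge> 0\<close> by (intro mult_right_mono) (auto simp: dist_commute)
      finally have "d < r + r * M" using x(2) by simp
      then show False using rd by (simp add: algebra_simps)
    qed
    then show "g = mat 1" using regular_stabilizer[OF _ g] assms(2,3) by auto
  qed auto
  then show ?thesis using r e(2) by (intro exI[of _ "ball x0 r"]) auto
qed

text \<open>Locally \<open>F p\<close> is \<open>p(D)\<close> applied to the invariant extension of \<open>F 1\<close>.\<close>

lemma KZ_family_unique:
  assumes U: "open U" "U \<subseteq> regular_set A" and F: "KZ_family l U F" and F': "KZ_family l U F'"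
    and eq: "\<And>x. x \<in> U \<Longrightarrow> F (\<lambda>z. 1) x = F' (\<lambda>z. 1) x" and p: "p \<in> polys" and x: "x \<in> U"
  shows "F p x = F' p x"
proof -
  obtain C where C: "x \<in> C" "C \<subseteq> U" "refl_nbhd G A m \<epsilon> C" using small_neighbourhood[OF U x] by blast
  interpret refl_nbhd G A m \<epsilon> C by (rule C(3))
  have "F p x = pD p (inv_ext (F (\<lambda>z. 1))) x"
    by (rule KZ_family_pD[OF KZ_family_subset[OF F C(2)] p C(1), symmetric])
  also have "\<dots> = pD p (inv_ext (F' (\<lambda>z. 1))) x"
    by (rule pD_cong, rule inv_ext_cong) (use C(1,2) eq C_subset_saturation in auto)
  also have "\<dots> = F' p x"
    by (rule KZ_family_pD[OF KZ_family_subset[OF F' C(2)] p C(1)])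
  finally show ?thesis .
qed

text \<open>
  The defining property of a Calogero-Moser operator speaks of invariant functions; a differential
  operator does not distinguish \<open>\<phi>\<close> from its invariant extension on \<open>C\<close>.
\<close>

lemma calogero_moser_apply:
  assumes nb: "refl_nbhd G A m \<epsilon> C" and L: "calogero_moser_operator G A m p L"
    and \<phi>: "holo_on \<phi> C" and x: "x \<in> C"
  shows "apply_diffop L \<phi> x = refl_domain.pD A m p (refl_nbhd.inv_ext G C \<phi>) x"
proof -
  interpret refl_nbhd G A m \<epsilon> C by (rule nb)
  have "apply_diffop L \<phi> x = apply_diffop L (inv_ext \<phi>) x"
    by (rule apply_diffop_cong[OF open_C x]) (simp add: inv_ext_C)
  also have "\<dots> = poly_op (dunkl A m) p (inv_ext \<phi>) x"
  proof -
    have "apply_diffop L u y = poly_op (dunkl A m) p u y"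
      if "open W" "W \<subseteq> regular_set A" "holo_on u W"
        "\<forall>g\<in>G. \<forall>x\<in>W. cmat g *v x \<in> W \<and> u (cmat g *v x) = u x" "y \<in> W" for W u y
      using L that unfolding calogero_moser_operator_def by blast
    from this[OF open_W W_regular inv_ext_holo[OF \<phi>]] show ?thesis
      using W_stable inv_ext_G x C_subset_saturation by auto
  qed
  finally show ?thesis by (simp add: pD_def)
qed

text \<open>Locally \<open>\<sigma>\<^sub>i(D)\<close> sends \<open>F 1\<close> to \<open>F \<sigma>\<^sub>i\<close>, and \<open>\<sigma>\<^sub>i - \<sigma>\<^sub>i(\<lambda>)\<close> lies in \<open>I(\<lambda>)\<close>.\<close>

theorem CM_solution_of_KZ_family:
  assumes \<sigma>: "free_homogeneous_generators G \<sigma>"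
    and L: "\<And>i. calogero_moser_operator G A m (\<sigma> i) (L i)"
    and U: "open U" "U \<subseteq> regular_set A" and F: "KZ_family l U F"
  shows "restrict (F (\<lambda>z. 1)) U \<in> CM_solutions \<sigma> L l U"
proof -
  let ?\<phi> = "restrict (F (\<lambda>z. 1)) U"
  have \<phi>: "holo_on ?\<phi> U"
    by (rule V.holo_cong[OF KZ_familyD(1)[OF F] U(1)]) auto
  have "apply_diffop (L i) ?\<phi> x = \<sigma> i l * ?\<phi> x" if x: "x \<in> U" for i x
  proof -
    obtain C where C: "x \<in> C" "C \<subseteq> U" "refl_nbhd G A m \<epsilon> C" using small_neighbourhood[OF U x] by blast
    interpret refl_nbhd G A m \<epsilon> C by (rule C(3))
    have FC: "KZ_family l C F" by (rule KZ_family_subset[OF F C(2)])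
    have \<sigma>_inv: "\<sigma> i \<in> inv_polys G" using \<sigma> by (simp add: free_homogeneous_generators_def)
    have s: "\<sigma> i \<in> polys" by (rule inv_polys_polys[OF \<sigma>_inv])
    have "apply_diffop (L i) ?\<phi> x = pD (\<sigma> i) (inv_ext ?\<phi>) x"
      by (rule calogero_moser_apply[OF C(3) L V.holo_subset[OF \<phi> C(2)] C(1)])
    also have "\<dots> = pD (\<sigma> i) (inv_ext (F (\<lambda>z. 1))) x"
      by (rule pD_cong, rule inv_ext_cong) (use C(1,2) C_subset_saturation in auto)
    also have "\<dots> = F (\<sigma> i) x" by (rule KZ_family_pD[OF FC s C(1)])
    also have "\<dots> = F (\<lambda>z. (\<sigma> i z - \<sigma> i l) * 1 + \<sigma> i l * 1) x" by simp
    also have "\<dots> = F (\<lambda>z. (\<sigma> i z - \<sigma> i l) * 1) x + F (\<lambda>z. \<sigma> i l * 1) x"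
      by (rule KZ_familyD(2)[OF F _ _ x]) (use s in auto)
    also have "F (\<lambda>z. (\<sigma> i z - \<sigma> i l) * 1) x = 0"
      by (rule KZ_family_ideal[OF F ideal_at_generator[OF \<sigma>_inv] x]) auto
    also have "F (\<lambda>z. \<sigma> i l * 1) x = \<sigma> i l * F (\<lambda>z. 1) x"
      by (rule KZ_familyD(3)[OF F _ x]) auto
    finally show ?thesis by (simp only: restrict_apply'[OF x] add_0_left)
  qed
  then show ?thesis using \<phi> by (simp add: CM_solutions_def)
qed

text \<open>The local families around two points coincide on the overlap because both have \<open>\<phi>\<close> as value at \<open>1\<close>,
  so each point may be evaluated in the family of its own neighbourhood.\<close>

theorem KZ_family_of_CM_solution:
  assumes \<sigma>: "free_homogeneous_generators G \<sigma>"
    and L: "\<And>i. calogero_moser_operator G A m (\<sigma> i) (L i)"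
    and U: "open U" "U \<subseteq> regular_set A" and \<phi>: "\<phi> \<in> CM_solutions \<sigma> L l U"
  shows "\<exists>F. KZ_family l U F \<and> (\<forall>x\<in>U. F (\<lambda>z. 1) x = \<phi> x)"
proof -
  have h: "holo_on \<phi> U" and cm: "\<And>i x. x \<in> U \<Longrightarrow> apply_diffop (L i) \<phi> x = \<sigma> i l * \<phi> x"
    using \<phi> by (auto simp: CM_solutions_def)
  have "\<exists>C F. x \<in> C \<and> C \<subseteq> U \<and> open C \<and> KZ_family l C F \<and> (\<forall>y\<in>C. F (\<lambda>z. 1) y = \<phi> y)" if x: "x \<in> U" for x
  proof -
    obtain C where C: "x \<in> C" "C \<subseteq> U" "refl_nbhd G A m \<epsilon> C" using small_neighbourhood[OF U x] by blast
    interpret refl_nbhd G A m \<epsilon> C by (rule C(3))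
    have hC: "holo_on \<phi> C" by (rule V.holo_subset[OF h C(2)])
    have "KZ_family l C (\<lambda>p. pD p (inv_ext \<phi>))"
    proof (rule KZ_family_of_eigenfunction[OF \<sigma> hC])
      fix i y assume "y \<in> C"
      then show "pD (\<sigma> i) (inv_ext \<phi>) y = \<sigma> i l * \<phi> y"
        using calogero_moser_apply[OF C(3) L hC, of y i] cm[of y i] C(2) by auto
    qed
    moreover have "\<forall>y\<in>C. pD (\<lambda>z. 1) (inv_ext \<phi>) y = \<phi> y" by (simp add: pD_const inv_ext_C)
    ultimately show ?thesis using C open_C by blast
  qed
  then obtain C \<Phi> where C: "\<And>x. x \<in> U \<Longrightarrow> x \<in> C x" "\<And>x. x \<in> U \<Longrightarrow> C x \<subseteq> U" "\<And>x. x \<in> U \<Longrightarrow> open (C x)"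
    and \<Phi>: "\<And>x. x \<in> U \<Longrightarrow> KZ_family l (C x) (\<Phi> x)" "\<And>x y. x \<in> U \<Longrightarrow> y \<in> C x \<Longrightarrow> \<Phi> x (\<lambda>z. 1) y = \<phi> y"
    by metis
  define F where "F p x = \<Phi> x p x" for p x
  have "KZ_family l (C x) F" if x: "x \<in> U" for x
  proof (rule KZ_family_cong[OF \<Phi>(1)[OF x] C(3)[OF x]])
    fix p :: "'n cspace \<Rightarrow> complex" and y assume p: "p \<in> polys" and y: "y \<in> C x"
    then have yU: "y \<in> U" using C(2)[OF x] by auto
    show "\<Phi> x p y = F p y"
      unfolding F_def
    proof (rule KZ_family_unique[where U = "C x \<inter> C y" and F = "\<Phi> x" and F' = "\<Phi> y", OF _ _ _ _ _ p])
      show "open (C x \<inter> C y)" using C(3) x yU by auto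
      show "C x \<inter> C y \<subseteq> regular_set A" using C(2)[OF x] U(2) by auto
      show "KZ_family l (C x \<inter> C y) (\<Phi> x)" by (rule KZ_family_subset[OF \<Phi>(1)[OF x]]) auto
      show "KZ_family l (C x \<inter> C y) (\<Phi> y)" by (rule KZ_family_subset[OF \<Phi>(1)[OF yU]]) auto
      show "y \<in> C x \<inter> C y" using y C(1)[OF yU] by auto
      show "\<Phi> x (\<lambda>z. 1) w = \<Phi> y (\<lambda>z. 1) w" if "w \<in> C x \<inter> C y" for w
        using \<Phi>(2)[OF x] \<Phi>(2)[OF yU] that by auto
    qed
  qed
  then have "KZ_family l U F" using C(1) by (intro KZ_family_local) blast
  moreover have "F (\<lambda>z. 1) x = \<phi> x" if "x \<in> U" for x
    using \<Phi>(2)[OF that C(1)[OF that]] by (simp add: F_def)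
  ultimately show ?thesis by blast
qed

end

section \<open>Vector-valued solutions\<close>

lemma quot_class_set:
  "quot_class G l p = (\<lambda>i z. i z + p z) ` ideal_at G l"
  by (auto simp: quot_class_def a_r_coset_def' image_def)

lemma cring_quot: "cring (quot G l)"
  unfolding quot_def by (rule ideal.quotient_is_cring[OF ideal_at_ideal cring_poly_alg])

lemma abelian_group_quot: "abelian_group (quot G l)"
  by (rule ring.is_abelian_group[OF cring.axioms(1)[OF cring_quot]])

lemma quot_class_hom: "quot_class G l \<in> ring_hom poly_alg (quot G l)"
  unfolding quot_def quot_class_def[abs_def] by (rule ideal.rcos_ring_hom[OF ideal_at_ideal])

lemma quot_class_closed: "p \<in> polys \<Longrightarrow> quot_class G l p \<in> carrier (quot G l)"
  using ring_hom_closed[OF quot_class_hom] by simp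

lemma quot_class_add:
  "p \<in> polys \<Longrightarrow> q \<in> polys \<Longrightarrow> quot_class G l p \<oplus>\<^bsub>quot G l\<^esub> quot_class G l q = quot_class G l (\<lambda>z. p z + q z)"
  using ring_hom_add[OF quot_class_hom, of p q] by simp

lemma quot_class_mult:
  "p \<in> polys \<Longrightarrow> q \<in> polys \<Longrightarrow> quot_class G l p \<otimes>\<^bsub>quot G l\<^esub> quot_class G l q = quot_class G l (\<lambda>z. p z * q z)"
  using ring_hom_mult[OF quot_class_hom, of p q] by simp

lemma quot_smult_class: "p \<in> polys \<Longrightarrow> quot_smult G l c (quot_class G l p) = quot_class G l (\<lambda>z. c * p z)"
  unfolding quot_smult_def by (rule quot_class_mult) auto

lemma quot_pi_class: "p \<in> polys \<Longrightarrow> quot_pi G l \<xi> (quot_class G l p) = quot_class G l (\<lambda>z. cform \<xi> z * p z)"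
  unfolding quot_pi_def by (rule quot_class_mult) auto

lemma quot_carrier_cases:
  assumes "X \<in> carrier (quot G l)"
  obtains p where "p \<in> polys" "X = quot_class G l p"
  using assms by (auto simp: quot_def FactRing_def A_RCOSETS_def' quot_class_def)

lemma quot_smult_closed: "X \<in> carrier (quot G l) \<Longrightarrow> quot_smult G l c X \<in> carrier (quot G l)"
  by (elim quot_carrier_cases) (auto simp: quot_smult_class intro: quot_class_closed)

lemma quot_add_closed:
  "X \<in> carrier (quot G l) \<Longrightarrow> Y \<in> carrier (quot G l) \<Longrightarrow> X \<oplus>\<^bsub>quot G l\<^esub> Y \<in> carrier (quot G l)"
  by (rule abelian_monoid.a_closed[OF abelian_group.axioms(1)[OF abelian_group_quot]])

context refl_group
begin

lemma act_refl: "act (refl_mat (a :: real ^ 'n)) p = (\<lambda>z. p (cmat (refl_mat a) *v z))"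
  by (simp add: act_def matrix_inv_refl)

lemma ideal_at_G:
  assumes "g \<in> G" "q \<in> ideal_at G l"
  shows "(\<lambda>z. q (cmat g *v z)) \<in> ideal_at G l"
  unfolding ideal_at_iff
proof (intro conjI ballI)
  have q: "q \<in> polys" by (rule ideal_at_polys[OF assms(2)])
  then show "(\<lambda>z. q (cmat g *v z)) \<in> polys" by (rule polys_matrix)
  fix p :: "'n cspace \<Rightarrow> complex" assume p: "p \<in> polys"
  have *: "(\<lambda>z. p (cmat (transpose g) *v z) * q z) \<in> polys" by (rule polys_mult[OF polys_matrix[OF p] q])
  have "(\<lambda>z. p z * q (cmat g *v z)) = (\<lambda>z. (\<lambda>z. p (cmat (transpose g) *v z) * q z) (cmat g *v z))"
    using assms(1) by (simp add: cmat_cancel)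
  then have "B (\<lambda>z. p z * q (cmat g *v z)) l = of_int (\<epsilon> g) * B (\<lambda>z. p (cmat (transpose g) *v z) * q z) l"
    using B_compose[OF assms(1) *] by simp
  then show "B (\<lambda>z. p z * q (cmat g *v z)) l = 0" using B_mult_ideal[OF assms(2) polys_matrix[OF p]] by simp
qed

lemma quot_act_class:
  assumes a: "a \<in> A" and p: "p \<in> polys"
  shows "quot_act (refl_mat a) (quot_class G l p) = quot_class G l (\<lambda>z. p (cmat (refl_mat a) *v z))"
proof -
  have "i \<in> (\<lambda>i z. i (cmat (refl_mat a) *v z)) ` ideal_at G l" if "i \<in> ideal_at G l" for i
    using ideal_at_G[OF refl_G[OF a] that] by (intro image_eqI[of _ _ "\<lambda>z. i (cmat (refl_mat a) *v z)"]) auto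
  then have "(\<lambda>i z. i (cmat (refl_mat a) *v z)) ` ideal_at G l = ideal_at G l"
    using ideal_at_G[OF refl_G[OF a]] by blast
  then have "quot_class G l (\<lambda>z. p (cmat (refl_mat a) *v z))
      = (\<lambda>i z. i z + p (cmat (refl_mat a) *v z)) ` (\<lambda>i z. i (cmat (refl_mat a) *v z)) ` ideal_at G l"
    by (simp add: quot_class_set)
  then show ?thesis by (simp add: quot_act_def quot_class_set image_image act_refl)
qed

text \<open>
  This is \<open>\<mu>(p X)\<close>. A class is fed in through an arbitrary representative; by \<open>B_mult_ideal\<close> the choice does
  not matter.
\<close>

definition pairing :: "'n cspace \<Rightarrow> ('n cspace \<Rightarrow> complex) \<Rightarrow> ('n cspace \<Rightarrow> complex) set \<Rightarrow> complex" where
  "pairing l p X = B (\<lambda>z. p z * (SOME q. q \<in> polys \<and> X = quot_class G l q) z) l"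

text \<open>Nondegeneracy: the difference of \<open>p\<close> and \<open>q\<close> lies in the radical, which is \<open>I(\<lambda>)\<close>.\<close>

lemma quot_class_eqI:
  assumes "p \<in> polys" "q \<in> polys" "\<And>r. r \<in> polys \<Longrightarrow> B (\<lambda>z. r z * p z) l = B (\<lambda>z. r z * q z) l"
  shows "quot_class G l p = quot_class G l q"
proof -
  have sub: "quot_class G l p \<subseteq> quot_class G l q"
    if p: "p \<in> polys" and q: "q \<in> polys"
      and eq: "\<And>r. r \<in> polys \<Longrightarrow> B (\<lambda>z. r z * p z) l = B (\<lambda>z. r z * q z) l" for p q
  proof -
    have "B (\<lambda>z. r z * (p z - q z)) l = 0" if r: "r \<in> polys" for r
      using B_diff[OF polys_mult[OF r p] polys_mult[OF r q]] eq[OF r] by (simp add: right_diff_distrib)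
    then have d: "(\<lambda>z. p z - q z) \<in> ideal_at G l" using p q by (simp add: ideal_at_iff polys_diff)
    show ?thesis
    proof
      fix f assume "f \<in> quot_class G l p"
      then obtain i where i: "i \<in> ideal_at G l" "f = (\<lambda>z. i z + p z)" by (auto simp: quot_class_set)
      have "f = (\<lambda>z. (i z + (p z - q z)) + q z)" using i by simp
      then show "f \<in> quot_class G l q" unfolding quot_class_set
        by (rule image_eqI[OF _ ideal_at_add[OF i(1) d]])
    qed
  qed
  show ?thesis using sub[of p q] sub[of q p] assms by auto
qed

lemma class_B_eq:
  assumes "p \<in> polys" "q \<in> polys" "quot_class G l p = quot_class G l q" "r \<in> polys"
  shows "B (\<lambda>z. r z * p z) l = B (\<lambda>z. r z * q z) l"
proof -
  have "p \<in> quot_class G l p"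
    unfolding quot_class_set by (rule image_eqI[of _ _ "\<lambda>z. 0"]) (auto simp: ideal_at_zero)
  then obtain i where i: "i \<in> ideal_at G l" "p = (\<lambda>z. i z + q z)"
    unfolding assms(3) by (auto simp: quot_class_set)
  have "(\<lambda>z. r z * p z) = (\<lambda>z. r z * i z + r z * q z)" by (simp add: i(2) distrib_left)
  then show ?thesis
    using B_add[OF polys_mult[OF assms(4) ideal_at_polys[OF i(1)]] polys_mult[OF assms(4,2)]]
      B_mult_ideal[OF i(1) assms(4)] by simp
qed

lemma pairing_class:
  assumes "p \<in> polys" "q \<in> polys"
  shows "pairing l p (quot_class G l q) = B (\<lambda>z. p z * q z) l"
proof -
  let ?r = "SOME r. r \<in> polys \<and> quot_class G l q = quot_class G l r"
  have "?r \<in> polys \<and> quot_class G l q = quot_class G l ?r"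
    by (rule someI[of _ q]) (use assms in auto)
  then show ?thesis unfolding pairing_def using class_B_eq[of q ?r l p] assms by auto
qed

lemma pairing_separates:
  assumes "X \<in> carrier (quot G l)" "Y \<in> carrier (quot G l)" "\<And>p. p \<in> polys \<Longrightarrow> pairing l p X = pairing l p Y"
  shows "X = Y"
proof -
  obtain p q where pq: "p \<in> polys" "X = quot_class G l p" "q \<in> polys" "Y = quot_class G l q"
    using quot_carrier_cases[OF assms(1)] quot_carrier_cases[OF assms(2)] by metis
  show ?thesis unfolding pq(2,4)
    by (rule quot_class_eqI[OF pq(1,3)]) (use assms(3) pq in \<open>simp add: pairing_class\<close>)
qed

lemma pairing_add:
  assumes "p \<in> polys" "X \<in> carrier (quot G l)" "Y \<in> carrier (quot G l)"
  shows "pairing l p (X \<oplus>\<^bsub>quot G l\<^esub> Y) = pairing l p X + pairing l p Y"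
  using assms(2,3)
proof (elim quot_carrier_cases)
  fix q r assume *: "q \<in> polys" "X = quot_class G l q" "r \<in> polys" "Y = quot_class G l r"
  then show ?thesis
    using B_add[OF polys_mult[OF assms(1) *(1)] polys_mult[OF assms(1) *(3)]] assms(1)
    by (simp add: quot_class_add pairing_class polys_add distrib_left)
qed

lemma pairing_smult:
  assumes "p \<in> polys" "X \<in> carrier (quot G l)"
  shows "pairing l p (quot_smult G l c X) = c * pairing l p X"
  using assms(2)
proof (elim quot_carrier_cases)
  fix q assume *: "q \<in> polys" "X = quot_class G l q"
  then show ?thesis
    using B_scale[OF polys_mult[OF assms(1) *(1)], of c] assms(1)
    by (simp add: quot_smult_class pairing_class polys_scale mult.left_commute)
qed

lemma pairing_dual: "p \<in> polys \<Longrightarrow> pairing l p \<in> quot_dual G l"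
  by (simp add: quot_dual_def pairing_add pairing_smult)

lemma pairing_left:
  assumes "p \<in> polys" "q \<in> polys" "X \<in> carrier (quot G l)"
  shows "pairing l (\<lambda>z. p z + q z) X = pairing l p X + pairing l q X"
    "pairing l (\<lambda>z. c * p z) X = c * pairing l p X"
proof -
  obtain r where r: "r \<in> polys" "X = quot_class G l r" using quot_carrier_cases[OF assms(3)] by blast
  show "pairing l (\<lambda>z. p z + q z) X = pairing l p X + pairing l q X"
    using B_add[OF polys_mult[OF assms(1) r(1)] polys_mult[OF assms(2) r(1)]] assms r
    by (simp add: pairing_class polys_add distrib_right)
  show "pairing l (\<lambda>z. c * p z) X = c * pairing l p X"
    using B_scale[OF polys_mult[OF assms(1) r(1)], of c] assms r
    by (simp add: pairing_class polys_scale mult.assoc)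
qed

lemma pairing_ideal:
  assumes "q \<in> ideal_at G l" "X \<in> carrier (quot G l)"
  shows "pairing l q X = 0"
proof -
  obtain r where r: "r \<in> polys" "X = quot_class G l r" using quot_carrier_cases[OF assms(2)] by blast
  then show ?thesis
    using B_mult_ideal[OF assms(1) r(1)] ideal_at_polys[OF assms(1)] by (simp add: pairing_class mult.commute)
qed

lemma pairing_pi:
  assumes "p \<in> polys" "X \<in> carrier (quot G l)"
  shows "pairing l p (quot_pi G l \<xi> X) = pairing l (\<lambda>z. cform \<xi> z * p z) X"
proof -
  obtain r where r: "r \<in> polys" "X = quot_class G l r" using quot_carrier_cases[OF assms(2)] by blast
  then show ?thesis
    using assms(1) by (simp add: quot_pi_class pairing_class polys_mult polys_cform mult_ac)
qed

text \<open>
  Anti-invariance of \<open>\<mu>\<close> moves the reflection from the class to the polynomial at the price of a sign.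
\<close>

lemma pairing_refl:
  assumes "p \<in> polys" "X \<in> carrier (quot G l)" "a \<in> A"
  shows "pairing l p (quot_act (refl_mat a) X) = - pairing l (\<lambda>z. p (cmat (refl_mat a) *v z)) X"
proof -
  obtain r where r: "r \<in> polys" "X = quot_class G l r" using quot_carrier_cases[OF assms(2)] by blast
  let ?s = "\<lambda>z. cmat (refl_mat a) *v z"
  have *: "(\<lambda>z. p (?s z) * r z) \<in> polys" by (rule polys_mult[OF polys_matrix[OF assms(1)] r(1)])
  have "(\<lambda>z. p z * r (?s z)) = (\<lambda>z. (\<lambda>z. p (?s z) * r z) (?s z))" by simp
  then have "B (\<lambda>z. p z * r (?s z)) l = - B (\<lambda>z. p (?s z) * r z) l"
    using B_compose[OF refl_G[OF assms(3)] *] assms(3) by (simp add: sign_refl)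
  then show ?thesis using r assms by (simp add: quot_act_class pairing_class polys_matrix)
qed

lemma quot_act_closed: "X \<in> carrier (quot G l) \<Longrightarrow> a \<in> A \<Longrightarrow> quot_act (refl_mat a) X \<in> carrier (quot G l)"
  by (elim quot_carrier_cases) (auto simp: quot_act_class intro: quot_class_closed polys_matrix)

lemma quot_pi_closed: "X \<in> carrier (quot G l) \<Longrightarrow> quot_pi G l \<xi> X \<in> carrier (quot G l)"
  by (elim quot_carrier_cases) (auto simp: quot_pi_class intro!: quot_class_closed polys_mult)

lemma quot_mu_pairing:
  assumes "X \<in> carrier (quot G l)"
  shows "quot_mu G A \<epsilon> l X = pairing l (\<lambda>z. 1) X"
proof -
  obtain p where p: "p \<in> polys" "X = quot_class G l p" using quot_carrier_cases[OF assms] by blast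
  have "mu G A \<epsilon> l (\<lambda>z. i z + p z) = B p l" if i: "i \<in> ideal_at G l" for i
    using B_mult_ideal[OF i, of "\<lambda>z. 1"] B_add[OF ideal_at_polys[OF i] p(1)]
      mu_eq_B[OF polys_add[OF ideal_at_polys[OF i] p(1)]] by auto
  then have "mu G A \<epsilon> l ` X = {B p l}"
    unfolding p(2) quot_class_set using ideal_at_zero by (auto simp: image_image)
  then show ?thesis using p by (simp add: quot_mu_def pairing_class polys_const)
qed

lemma pairing_zero: "p \<in> polys \<Longrightarrow> pairing l p \<zero>\<^bsub>quot G l\<^esub> = 0"
proof -
  assume p: "p \<in> polys"
  have z: "\<zero>\<^bsub>quot G l\<^esub> \<in> carrier (quot G l)"
    by (rule abelian_monoid.zero_closed[OF abelian_group.axioms(1)[OF abelian_group_quot]])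
  have "\<zero>\<^bsub>quot G l\<^esub> \<oplus>\<^bsub>quot G l\<^esub> \<zero>\<^bsub>quot G l\<^esub> = \<zero>\<^bsub>quot G l\<^esub>"
    by (rule abelian_monoid.l_zero[OF abelian_group.axioms(1)[OF abelian_group_quot] z])
  then show ?thesis using pairing_add[OF p z z] by simp
qed

lemma pairing_finsum:
  assumes p: "p \<in> polys" and "finite T" "\<And>a. a \<in> T \<Longrightarrow> X a \<in> carrier (quot G l)"
  shows "(\<Oplus>\<^bsub>quot G l\<^esub>a\<in>T. X a) \<in> carrier (quot G l) \<and>
    pairing l p (\<Oplus>\<^bsub>quot G l\<^esub>a\<in>T. X a) = (\<Sum>a\<in>T. pairing l p (X a))"
  using assms(2,3)
proof (induction T rule: finite_induct)
  interpret Q: abelian_group "quot G l" by (rule abelian_group_quot)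
  case empty
  then show ?case by (simp add: pairing_zero[OF p])
next
  interpret Q: abelian_group "quot G l" by (rule abelian_group_quot)
  case (insert a T)
  then have "(\<Oplus>\<^bsub>quot G l\<^esub>a\<in>insert a T. X a) = X a \<oplus>\<^bsub>quot G l\<^esub> (\<Oplus>\<^bsub>quot G l\<^esub>a\<in>T. X a)"
    by (intro Q.finsum_insert) auto
  then show ?case using insert pairing_add[OF p] by simp
qed

lemma KZ_rhs_pairing:
  assumes p: "p \<in> polys" and X: "X \<in> carrier (quot G l)"
  shows "KZ_rhs G A m l \<xi> x X \<in> carrier (quot G l)"
    "pairing l p (KZ_rhs G A m l \<xi> x X) =
      (\<Sum>a\<in>A. of_nat (m a) * (cform (cvec a) \<xi> / cform (cvec a) x)
        * (pairing l p X - pairing l (\<lambda>z. p (cmat (refl_mat a) *v z)) X))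
      + pairing l (\<lambda>z. cform \<xi> z * p z) X"
proof -
  let ?T = "\<lambda>a. quot_smult G l (of_nat (m a) * (cform (cvec a) \<xi> / cform (cvec a) x))
          (quot_act (refl_mat a) X \<oplus>\<^bsub>quot G l\<^esub> X)"
  have T: "?T a \<in> carrier (quot G l)" if "a \<in> A" for a
    by (intro quot_smult_closed quot_add_closed quot_act_closed X that)
  note fs = pairing_finsum[OF p finite_A T]
  show "KZ_rhs G A m l \<xi> x X \<in> carrier (quot G l)"
    unfolding KZ_rhs_def using fs by (intro quot_add_closed quot_pi_closed X) auto
  have "pairing l p (?T a) = of_nat (m a) * (cform (cvec a) \<xi> / cform (cvec a) x)
        * (pairing l p X - pairing l (\<lambda>z. p (cmat (refl_mat a) *v z)) X)" if a: "a \<in> A" for a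
    by (simp add: pairing_smult[OF p] quot_add_closed quot_act_closed X a pairing_add[OF p] pairing_refl[OF p])
  then show "pairing l p (KZ_rhs G A m l \<xi> x X) =
      (\<Sum>a\<in>A. of_nat (m a) * (cform (cvec a) \<xi> / cform (cvec a) x)
        * (pairing l p X - pairing l (\<lambda>z. p (cmat (refl_mat a) *v z)) X))
      + pairing l (\<lambda>z. cform \<xi> z * p z) X"
    unfolding KZ_rhs_def using fs X by (simp add: pairing_add[OF p] quot_pi_closed pairing_pi[OF p])
qed

text \<open>A functional on the quotient is a functional on polynomials that vanishes on \<open>I(\<lambda>)\<close>, so
  \<open>functional_representation\<close> applies. Hence testing a map into the quotient with pairings is the same as
  testing it with all functionals.\<close>

lemma dual_is_pairing:
  assumes "f \<in> quot_dual G l"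
  shows "\<exists>p\<in>polys. \<forall>X\<in>carrier (quot G l). f X = pairing l p X"
proof -
  let ?F = "\<lambda>p. f (quot_class G l p)"
  have f: "f (X \<oplus>\<^bsub>quot G l\<^esub> Y) = f X + f Y" "f (quot_smult G l c X) = c * f X"
    if "X \<in> carrier (quot G l)" "Y \<in> carrier (quot G l)" for X Y c
    using assms that by (auto simp: quot_dual_def)
  have add: "?F (\<lambda>z. p z + q z) = ?F p + ?F q" if "p \<in> polys" "q \<in> polys" for p q
    using f(1)[OF quot_class_closed quot_class_closed] that by (simp add: quot_class_add)
  have scale: "?F (\<lambda>z. c * p z) = c * ?F p" if "p \<in> polys" for c p
    using f(2)[OF quot_class_closed quot_class_closed] that by (simp add: quot_smult_class)
  have "?F q = 0" if q: "q \<in> ideal_at G l" for q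
  proof -
    have "quot_class G l q = quot_class G l (\<lambda>z. 0)"
      by (rule quot_class_eqI) (use q B_mult_ideal[OF q] in \<open>auto simp: ideal_at_polys B_zero\<close>)
    then show ?thesis using scale[OF polys_const[of 0], of 0] by simp
  qed
  then obtain r where r: "r \<in> polys" "\<And>p. p \<in> polys \<Longrightarrow> ?F p = B (\<lambda>z. p z * r z) l"
    using functional_representation[of ?F l, OF add scale] by blast
  have "f X = pairing l r X" if X: "X \<in> carrier (quot G l)" for X
  proof -
    obtain q where q: "q \<in> polys" "X = quot_class G l q" using quot_carrier_cases[OF X] by blast
    then show ?thesis using r by (simp add: pairing_class mult.commute)
  qed
  then show ?thesis using r(1) by blast
qed

theorem KZ_solutions_iff:
  assumes U: "open U"
  shows "\<psi> \<in> KZ_solutions G A m l U \<longleftrightarrow>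
    \<psi> \<in> U \<rightarrow>\<^sub>E carrier (quot G l) \<and> KZ_family l U (\<lambda>p x. pairing l p (\<psi> x))"
proof (intro iffI conjI)
  assume \<psi>: "\<psi> \<in> KZ_solutions G A m l U"
  then show c: "\<psi> \<in> U \<rightarrow>\<^sub>E carrier (quot G l)" by (simp add: KZ_solutions_def)
  then have cx: "\<psi> x \<in> carrier (quot G l)" if "x \<in> U" for x using that by auto
  show "KZ_family l U (\<lambda>p x. pairing l p (\<psi> x))"
    unfolding KZ_family_def
  proof (intro conjI ballI allI)
    fix p :: "'n cspace \<Rightarrow> complex" assume p: "p \<in> polys"
    have comp: "pairing l p \<circ> \<psi> = (\<lambda>x. pairing l p (\<psi> x))" by auto
    have *: "holo_on (pairing l p \<circ> \<psi>) U"
      "\<And>\<xi> x. x \<in> U \<Longrightarrow> dir_deriv \<xi> (pairing l p \<circ> \<psi>) x = pairing l p (KZ_rhs G A m l \<xi> x (\<psi> x))"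
      using \<psi> pairing_dual[OF p] unfolding KZ_solutions_def by auto
    show "holo_on (\<lambda>x. pairing l p (\<psi> x)) U" using *(1) by (simp add: comp)
    fix \<xi> x assume x: "x \<in> U"
    show "dir_deriv \<xi> (\<lambda>x. pairing l p (\<psi> x)) x =
      (\<Sum>a\<in>A. of_nat (m a) * (cform (cvec a) \<xi> / cform (cvec a) x)
        * (pairing l p (\<psi> x) - pairing l (\<lambda>z. p (cmat (refl_mat a) *v z)) (\<psi> x)))
      + pairing l (\<lambda>z. cform \<xi> z * p z) (\<psi> x)"
      using *(2)[OF x] KZ_rhs_pairing(2)[OF p cx[OF x]] by (simp add: comp)
  qed (auto simp: pairing_left cx pairing_ideal)
next
  assume *: "\<psi> \<in> U \<rightarrow>\<^sub>E carrier (quot G l) \<and> KZ_family l U (\<lambda>p x. pairing l p (\<psi> x))"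
  then have cx: "\<psi> x \<in> carrier (quot G l)" if "x \<in> U" for x using that by auto
  show "\<psi> \<in> KZ_solutions G A m l U"
    unfolding KZ_solutions_def
  proof (intro CollectI conjI ballI allI)
    show "\<psi> \<in> U \<rightarrow>\<^sub>E carrier (quot G l)" using * by blast
    fix f assume f: "f \<in> quot_dual G l"
    obtain p where p: "p \<in> polys" "\<And>X. X \<in> carrier (quot G l) \<Longrightarrow> f X = pairing l p X"
      using dual_is_pairing[OF f] by blast
    have h: "holo_on (\<lambda>x. pairing l p (\<psi> x)) U" using * KZ_familyD(1) p(1) by blast
    show "holo_on (f \<circ> \<psi>) U" by (rule V.holo_cong[OF h U]) (simp add: p(2) cx)
    fix \<xi> x assume x: "x \<in> U"
    have "dir_deriv \<xi> (f \<circ> \<psi>) x = dir_deriv \<xi> (\<lambda>x. pairing l p (\<psi> x)) x"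
      unfolding dir_deriv_dd by (rule V.dd_cong[OF U x]) (simp add: p(2) cx)
    also have "\<dots> = pairing l p (KZ_rhs G A m l \<xi> x (\<psi> x))"
      unfolding KZ_rhs_pairing(2)[OF p(1) cx[OF x]] using * KZ_familyD(4)[OF _ p(1) x] by blast
    also have "\<dots> = f (KZ_rhs G A m l \<xi> x (\<psi> x))"
      by (rule p(2)[symmetric]) (rule KZ_rhs_pairing(1)[OF p(1) cx[OF x]])
    finally show "dir_deriv \<xi> (f \<circ> \<psi>) x = f (KZ_rhs G A m l \<xi> x (\<psi> x))" .
  qed
qed

text \<open>At each point the functional \<open>p \<mapsto> F p x\<close> is the pairing with some class.\<close>

lemma KZ_solution_of_family:
  assumes U: "open U" and F: "KZ_family l U F"
  shows "\<exists>\<psi>\<in>KZ_solutions G A m l U. \<forall>p\<in>polys. \<forall>x\<in>U. pairing l p (\<psi> x) = F p x"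
proof -
  have "\<exists>r\<in>polys. \<forall>p\<in>polys. F p x = B (\<lambda>z. p z * r z) l" if x: "x \<in> U" for x
    by (rule functional_representation[of "\<lambda>p. F p x"])
       (use x KZ_familyD[OF F] KZ_family_ideal[OF F] in auto)
  then obtain r where r: "\<And>x. x \<in> U \<Longrightarrow> r x \<in> polys" "\<And>x p. x \<in> U \<Longrightarrow> p \<in> polys \<Longrightarrow> F p x = B (\<lambda>z. p z * r x z) l"
    by metis
  define \<psi> where "\<psi> = (\<lambda>x\<in>U. quot_class G l (r x))"
  have pair: "pairing l p (\<psi> x) = F p x" if "p \<in> polys" "x \<in> U" for p x
    using that r by (simp add: \<psi>_def pairing_class)
  have "\<psi> \<in> U \<rightarrow>\<^sub>E carrier (quot G l)" using r(1) by (auto simp: \<psi>_def quot_class_closed)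
  moreover have "KZ_family l U (\<lambda>p x. pairing l p (\<psi> x))"
    by (rule KZ_family_cong[OF F U]) (simp add: pair)
  ultimately show ?thesis using pair KZ_solutions_iff[OF U] by blast
qed

end

section \<open>The isomorphism of solution spaces\<close>

lemma cring_complex_field: "cring complex_field"
proof (rule cringI)
  show "abelian_group complex_field"
  proof (rule abelian_groupI)
    fix x assume "x \<in> carrier complex_field"
    show "\<exists>y\<in>carrier complex_field. y \<oplus>\<^bsub>complex_field\<^esub> x = \<zero>\<^bsub>complex_field\<^esub>"
      by (intro bexI[of _ "- x"]) (auto simp: complex_field_def)
  qed (auto simp: complex_field_def)
  show "comm_monoid complex_field"
    by (rule comm_monoidI) (auto simp: complex_field_def)
qed (auto simp: complex_field_def algebra_simps)

lemma complex_field_simps [simp]: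
  "carrier complex_field = UNIV" "a \<otimes>\<^bsub>complex_field\<^esub> b = a * b" "\<one>\<^bsub>complex_field\<^esub> = 1"
  "a \<oplus>\<^bsub>complex_field\<^esub> b = a + b" "\<zero>\<^bsub>complex_field\<^esub> = 0"
  by (simp_all add: complex_field_def)

context refl_group
begin

lemma KZ_zero:
  assumes U: "open U" "U \<subseteq> regular_set A"
  shows "(\<lambda>x\<in>U. \<zero>\<^bsub>quot G l\<^esub>) \<in> KZ_solutions G A m l U"
  unfolding KZ_solutions_iff[OF U(1)]
proof
  show "(\<lambda>x\<in>U. \<zero>\<^bsub>quot G l\<^esub>) \<in> U \<rightarrow>\<^sub>E carrier (quot G l)"
    using abelian_monoid.zero_closed[OF abelian_group.axioms(1)[OF abelian_group_quot]] by auto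
  have "KZ_family l U (\<lambda>p x. 0)"
    by (auto simp: KZ_family_def V.holo_const dir_deriv_def)
  then show "KZ_family l U (\<lambda>p x. pairing l p ((\<lambda>x\<in>U. \<zero>\<^bsub>quot G l\<^esub>) x))"
    by (rule KZ_family_cong[OF _ U(1)]) (simp add: pairing_zero)
qed

lemma KZ_add:
  assumes U: "open U" and "\<psi> \<in> KZ_solutions G A m l U" "\<psi>' \<in> KZ_solutions G A m l U"
  shows "(\<lambda>x\<in>U. \<psi> x \<oplus>\<^bsub>quot G l\<^esub> \<psi>' x) \<in> KZ_solutions G A m l U"
proof -
  have c: "\<psi> x \<in> carrier (quot G l)" "\<psi>' x \<in> carrier (quot G l)" if "x \<in> U" for x
    using assms that by (auto simp: KZ_solutions_def)
  have "KZ_family l U (\<lambda>p x. pairing l p (\<psi> x) + pairing l p (\<psi>' x))"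
    using assms KZ_solutions_iff[OF U] by (intro KZ_family_add) auto
  then have "KZ_family l U (\<lambda>p x. pairing l p ((\<lambda>x\<in>U. \<psi> x \<oplus>\<^bsub>quot G l\<^esub> \<psi>' x) x))"
    by (rule KZ_family_cong[OF _ U]) (simp add: pairing_add c)
  then show ?thesis unfolding KZ_solutions_iff[OF U] using c by (auto intro: quot_add_closed)
qed

lemma KZ_smult:
  assumes U: "open U" and "\<psi> \<in> KZ_solutions G A m l U"
  shows "(\<lambda>x\<in>U. quot_smult G l c (\<psi> x)) \<in> KZ_solutions G A m l U"
proof -
  have c: "\<psi> x \<in> carrier (quot G l)" if "x \<in> U" for x
    using assms that by (auto simp: KZ_solutions_def)
  have "KZ_family l U (\<lambda>p x. c * pairing l p (\<psi> x))"
    using assms KZ_solutions_iff[OF U] by (intro KZ_family_scale) auto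
  then have "KZ_family l U (\<lambda>p x. pairing l p ((\<lambda>x\<in>U. quot_smult G l c (\<psi> x)) x))"
    by (rule KZ_family_cong[OF _ U]) (simp add: pairing_smult c)
  then show ?thesis unfolding KZ_solutions_iff[OF U] using c by (auto intro: quot_smult_closed)
qed

lemma KZ_solution_eqI:
  assumes "\<psi> \<in> KZ_solutions G A m l U" "\<psi>' \<in> KZ_solutions G A m l U"
    "\<And>p x. p \<in> polys \<Longrightarrow> x \<in> U \<Longrightarrow> pairing l p (\<psi> x) = pairing l p (\<psi>' x)"
  shows "\<psi> = \<psi>'"
proof (rule PiE_ext)
  show "\<psi> \<in> U \<rightarrow>\<^sub>E carrier (quot G l)" "\<psi>' \<in> U \<rightarrow>\<^sub>E carrier (quot G l)"
    using assms by (auto simp: KZ_solutions_def)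
  then show "\<psi> x = \<psi>' x" if "x \<in> U" for x
    using that assms(3) by (intro pairing_separates) auto
qed

lemma module_KZ_space:
  assumes U: "open U" "U \<subseteq> regular_set A"
  shows "module complex_field (KZ_space G A m l U)"
proof -
  let ?K = "KZ_solutions G A m l U"
  have c: "\<psi> x \<in> carrier (quot G l)" if "\<psi> \<in> ?K" "x \<in> U" for \<psi> x
    using that by (auto simp: KZ_solutions_def)
  note closed = KZ_zero[OF U] KZ_add[OF U(1)] KZ_smult[OF U(1)]
  note pair = pairing_add pairing_smult pairing_zero
  show ?thesis
  proof (rule moduleI[OF cring_complex_field])
    show "abelian_group (KZ_space G A m l U)"
    proof (rule abelian_groupI)
      fix \<psi> assume "\<psi> \<in> carrier (KZ_space G A m l U)"
      then have \<psi>: "\<psi> \<in> ?K" by (simp add: KZ_space_def)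
      have "(\<lambda>x\<in>U. (\<lambda>x\<in>U. quot_smult G l (-1) (\<psi> x)) x \<oplus>\<^bsub>quot G l\<^esub> \<psi> x) = (\<lambda>x\<in>U. \<zero>\<^bsub>quot G l\<^esub>)"
        by (rule KZ_solution_eqI[OF closed(2)[OF closed(3)[OF \<psi>] \<psi>] closed(1)])
           (simp add: pair c[OF \<psi>] quot_smult_closed)
      then show "\<exists>\<phi>\<in>carrier (KZ_space G A m l U). \<phi> \<oplus>\<^bsub>KZ_space G A m l U\<^esub> \<psi> = \<zero>\<^bsub>KZ_space G A m l U\<^esub>"
        using closed(3)[OF \<psi>, of "-1"]
        by (intro bexI[of _ "\<lambda>x\<in>U. quot_smult G l (-1) (\<psi> x)"]) (simp_all only: KZ_space_def ring_record_simps partial_object.simps)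
    next
      fix \<psi> \<phi> \<eta> assume "\<psi> \<in> carrier (KZ_space G A m l U)" "\<phi> \<in> carrier (KZ_space G A m l U)" "\<eta> \<in> carrier (KZ_space G A m l U)"
      then have *: "\<psi> \<in> ?K" "\<phi> \<in> ?K" "\<eta> \<in> ?K" by (simp_all add: KZ_space_def)
      have "(\<lambda>x\<in>U. (\<lambda>x\<in>U. \<psi> x \<oplus>\<^bsub>quot G l\<^esub> \<phi> x) x \<oplus>\<^bsub>quot G l\<^esub> \<eta> x)
          = (\<lambda>x\<in>U. \<psi> x \<oplus>\<^bsub>quot G l\<^esub> (\<lambda>x\<in>U. \<phi> x \<oplus>\<^bsub>quot G l\<^esub> \<eta> x) x)"
        by (rule KZ_solution_eqI[OF closed(2)[OF closed(2)[OF *(1,2)] *(3)] closed(2)[OF *(1) closed(2)[OF *(2,3)]]])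
           (simp add: pair c[OF *(1)] c[OF *(2)] c[OF *(3)] quot_add_closed)
      then show "\<psi> \<oplus>\<^bsub>KZ_space G A m l U\<^esub> \<phi> \<oplus>\<^bsub>KZ_space G A m l U\<^esub> \<eta>
          = \<psi> \<oplus>\<^bsub>KZ_space G A m l U\<^esub> (\<phi> \<oplus>\<^bsub>KZ_space G A m l U\<^esub> \<eta>)"
        by (simp add: KZ_space_def)
    next
      fix \<psi> \<phi> assume "\<psi> \<in> carrier (KZ_space G A m l U)" "\<phi> \<in> carrier (KZ_space G A m l U)"
      then have *: "\<psi> \<in> ?K" "\<phi> \<in> ?K" by (simp_all add: KZ_space_def)
      have "(\<lambda>x\<in>U. \<psi> x \<oplus>\<^bsub>quot G l\<^esub> \<phi> x) = (\<lambda>x\<in>U. \<phi> x \<oplus>\<^bsub>quot G l\<^esub> \<psi> x)"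
        by (rule KZ_solution_eqI[OF closed(2)[OF *] closed(2)[OF *(2,1)]])
           (simp add: pair c[OF *(1)] c[OF *(2)])
      then show "\<psi> \<oplus>\<^bsub>KZ_space G A m l U\<^esub> \<phi> = \<phi> \<oplus>\<^bsub>KZ_space G A m l U\<^esub> \<psi>"
        by (simp add: KZ_space_def)
      show "\<psi> \<oplus>\<^bsub>KZ_space G A m l U\<^esub> \<phi> \<in> carrier (KZ_space G A m l U)"
        using closed(2)[OF *] by (simp add: KZ_space_def)
    next
      fix \<psi> assume "\<psi> \<in> carrier (KZ_space G A m l U)"
      then have \<psi>: "\<psi> \<in> ?K" by (simp add: KZ_space_def)
      have "(\<lambda>x\<in>U. (\<lambda>x\<in>U. \<zero>\<^bsub>quot G l\<^esub>) x \<oplus>\<^bsub>quot G l\<^esub> \<psi> x) = \<psi>"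
        by (rule KZ_solution_eqI[OF closed(2)[OF closed(1) \<psi>] \<psi>])
           (simp add: pair c[OF \<psi>] abelian_monoid.zero_closed[OF abelian_group.axioms(1)[OF abelian_group_quot]])
      then show "\<zero>\<^bsub>KZ_space G A m l U\<^esub> \<oplus>\<^bsub>KZ_space G A m l U\<^esub> \<psi> = \<psi>" by (simp add: KZ_space_def)
    qed (use closed in \<open>auto simp: KZ_space_def\<close>)
  next
    fix a :: complex and \<psi> assume "\<psi> \<in> carrier (KZ_space G A m l U)"
    then have \<psi>: "\<psi> \<in> ?K" by (simp add: KZ_space_def)
    show "a \<odot>\<^bsub>KZ_space G A m l U\<^esub> \<psi> \<in> carrier (KZ_space G A m l U)"
      using closed(3)[OF \<psi>] by (simp add: KZ_space_def)
    fix b :: complex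
    have "(\<lambda>x\<in>U. quot_smult G l (a + b) (\<psi> x))
        = (\<lambda>x\<in>U. (\<lambda>x\<in>U. quot_smult G l a (\<psi> x)) x \<oplus>\<^bsub>quot G l\<^esub> (\<lambda>x\<in>U. quot_smult G l b (\<psi> x)) x)"
      by (rule KZ_solution_eqI[OF closed(3)[OF \<psi>] closed(2)[OF closed(3)[OF \<psi>] closed(3)[OF \<psi>]]])
         (simp add: pair c[OF \<psi>] quot_smult_closed distrib_right)
    then show "(a \<oplus>\<^bsub>complex_field\<^esub> b) \<odot>\<^bsub>KZ_space G A m l U\<^esub> \<psi>
        = a \<odot>\<^bsub>KZ_space G A m l U\<^esub> \<psi> \<oplus>\<^bsub>KZ_space G A m l U\<^esub> b \<odot>\<^bsub>KZ_space G A m l U\<^esub> \<psi>"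
      by (simp add: KZ_space_def)
    have "(\<lambda>x\<in>U. quot_smult G l (a * b) (\<psi> x)) = (\<lambda>x\<in>U. quot_smult G l a ((\<lambda>x\<in>U. quot_smult G l b (\<psi> x)) x))"
      by (rule KZ_solution_eqI[OF closed(3)[OF \<psi>] closed(3)[OF closed(3)[OF \<psi>]]])
         (simp add: pair c[OF \<psi>] quot_smult_closed)
    then show "(a \<otimes>\<^bsub>complex_field\<^esub> b) \<odot>\<^bsub>KZ_space G A m l U\<^esub> \<psi>
        = a \<odot>\<^bsub>KZ_space G A m l U\<^esub> (b \<odot>\<^bsub>KZ_space G A m l U\<^esub> \<psi>)"
      by (simp add: KZ_space_def)
    have "(\<lambda>x\<in>U. quot_smult G l 1 (\<psi> x)) = \<psi>"
      by (rule KZ_solution_eqI[OF closed(3)[OF \<psi>] \<psi>]) (simp add: pair c[OF \<psi>])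
    then show "\<one>\<^bsub>complex_field\<^esub> \<odot>\<^bsub>KZ_space G A m l U\<^esub> \<psi> = \<psi>" by (simp add: KZ_space_def)
  next
    fix a :: complex and \<psi> \<phi> assume "\<psi> \<in> carrier (KZ_space G A m l U)" "\<phi> \<in> carrier (KZ_space G A m l U)"
    then have *: "\<psi> \<in> ?K" "\<phi> \<in> ?K" by (simp_all add: KZ_space_def)
    have "(\<lambda>x\<in>U. quot_smult G l a ((\<lambda>x\<in>U. \<psi> x \<oplus>\<^bsub>quot G l\<^esub> \<phi> x) x))
        = (\<lambda>x\<in>U. (\<lambda>x\<in>U. quot_smult G l a (\<psi> x)) x \<oplus>\<^bsub>quot G l\<^esub> (\<lambda>x\<in>U. quot_smult G l a (\<phi> x)) x)"
      by (rule KZ_solution_eqI[OF closed(3)[OF closed(2)[OF *]] closed(2)[OF closed(3)[OF *(1)] closed(3)[OF *(2)]]])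
         (simp add: pair c[OF *(1)] c[OF *(2)] quot_smult_closed quot_add_closed distrib_left)
    then show "a \<odot>\<^bsub>KZ_space G A m l U\<^esub> (\<psi> \<oplus>\<^bsub>KZ_space G A m l U\<^esub> \<phi>)
        = a \<odot>\<^bsub>KZ_space G A m l U\<^esub> \<psi> \<oplus>\<^bsub>KZ_space G A m l U\<^esub> a \<odot>\<^bsub>KZ_space G A m l U\<^esub> \<phi>"
      by (simp add: KZ_space_def)
  qed
qed

text \<open>The closure properties are assumptions because they are inherited from the KZ solutions along the
  surjective Matsuo-Cherednik map.\<close>

lemma module_CM_space:
  assumes closed: "(\<lambda>x\<in>U. 0) \<in> CM_solutions \<sigma> L l U"
    "\<And>\<phi> \<phi>'. \<phi> \<in> CM_solutions \<sigma> L l U \<Longrightarrow> \<phi>' \<in> CM_solutions \<sigma> L l U \<Longrightarrow> (\<lambda>x\<in>U. \<phi> x + \<phi>' x) \<in> CM_solutions \<sigma> L l U"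
    "\<And>c \<phi>. \<phi> \<in> CM_solutions \<sigma> L l U \<Longrightarrow> (\<lambda>x\<in>U. c * \<phi> x) \<in> CM_solutions \<sigma> L l U"
  shows "module complex_field (CM_space \<sigma> L l U)"
proof -
  have ext: "\<phi> \<in> CM_solutions \<sigma> L l U \<Longrightarrow> \<phi> \<in> extensional U" for \<phi> by (simp add: CM_solutions_def)
  have eqI: "\<phi> = \<phi>'" if "\<phi> \<in> CM_solutions \<sigma> L l U" "\<phi>' \<in> CM_solutions \<sigma> L l U" "\<And>x. x \<in> U \<Longrightarrow> \<phi> x = \<phi>' x" for \<phi> \<phi>'
    using that ext by (intro extensionalityI[of _ U]) auto
  show ?thesis
  proof (rule moduleI[OF cring_complex_field])
    show "abelian_group (CM_space \<sigma> L l U)"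
    proof (rule abelian_groupI)
      fix \<phi> assume "\<phi> \<in> carrier (CM_space \<sigma> L l U)"
      then have *: "\<phi> \<in> CM_solutions \<sigma> L l U" by (simp add: CM_space_def)
      show "\<exists>\<phi>'\<in>carrier (CM_space \<sigma> L l U). \<phi>' \<oplus>\<^bsub>CM_space \<sigma> L l U\<^esub> \<phi> = \<zero>\<^bsub>CM_space \<sigma> L l U\<^esub>"
        using closed(3)[OF *, of "-1"] by (intro bexI[of _ "\<lambda>x\<in>U. -1 * \<phi> x"]) (auto simp: CM_space_def fun_eq_iff)
      show "\<zero>\<^bsub>CM_space \<sigma> L l U\<^esub> \<oplus>\<^bsub>CM_space \<sigma> L l U\<^esub> \<phi> = \<phi>"
        using eqI[OF closed(2)[OF closed(1) *] *] by (simp add: CM_space_def)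
    qed (auto simp: CM_space_def closed fun_eq_iff)
  next
    fix \<phi> assume "\<phi> \<in> carrier (CM_space \<sigma> L l U)"
    then have *: "\<phi> \<in> CM_solutions \<sigma> L l U" by (simp add: CM_space_def)
    show "\<one>\<^bsub>complex_field\<^esub> \<odot>\<^bsub>CM_space \<sigma> L l U\<^esub> \<phi> = \<phi>"
      using eqI[OF closed(3)[OF *, of 1] *] by (simp add: CM_space_def)
  qed (auto simp: CM_space_def closed fun_eq_iff algebra_simps)
qed

text \<open>The map sends \<open>\<psi>\<close> to the member \<open>F 1\<close> of its family. It is injective by \<open>KZ_family_unique\<close> and
  surjective by \<open>KZ_family_of_CM_solution\<close>.\<close>

theorem matsuo_cherednik_isomorphism:
  assumes \<sigma>: "free_homogeneous_generators G \<sigma>"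
    and L: "\<And>i. calogero_moser_operator G A m (\<sigma> i) (L i)"
    and U: "open U" "U \<subseteq> regular_set A"
  shows "module_isomorphism complex_field (KZ_space G A m l U) (CM_space \<sigma> L l U)
           (matsuo_cherednik G A \<epsilon> l U)"
proof -
  let ?K = "KZ_solutions G A m l U" and ?M = "CM_solutions \<sigma> L l U" and ?F = "matsuo_cherednik G A \<epsilon> l U"
  have c: "\<psi> x \<in> carrier (quot G l)" if "\<psi> \<in> ?K" "x \<in> U" for \<psi> x
    using that by (auto simp: KZ_solutions_def)
  have MC: "?F \<psi> = restrict (\<lambda>x. pairing l (\<lambda>z. 1) (\<psi> x)) U" if "\<psi> \<in> ?K" for \<psi>
    using c[OF that] by (auto simp: matsuo_cherednik_def quot_mu_pairing fun_eq_iff)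
  have one: "(\<lambda>z. 1) \<in> polys" by (rule polys_const)
  have into: "?F \<psi> \<in> ?M" if \<psi>: "\<psi> \<in> ?K" for \<psi>
    unfolding MC[OF \<psi>]
    using CM_solution_of_KZ_family[OF \<sigma> L U, where F = "\<lambda>p x. pairing l p (\<psi> x)"] \<psi> KZ_solutions_iff[OF U(1)] by blast
  have inj: "\<psi> = \<psi>'" if \<psi>: "\<psi> \<in> ?K" "\<psi>' \<in> ?K" and eq: "?F \<psi> = ?F \<psi>'" for \<psi> \<psi>'
  proof (rule KZ_solution_eqI[OF \<psi>])
    fix p :: "'n cspace \<Rightarrow> complex" and x assume p: "p \<in> polys" and x: "x \<in> U"
    have fam: "KZ_family l U (\<lambda>p x. pairing l p (\<psi> x))" "KZ_family l U (\<lambda>p x. pairing l p (\<psi>' x))"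
      using \<psi> KZ_solutions_iff[OF U(1)] by auto
    have eq1: "pairing l (\<lambda>z. 1) (\<psi> x) = pairing l (\<lambda>z. 1) (\<psi>' x)" if "x \<in> U" for x
      using fun_cong[OF eq, of x] that unfolding MC[OF \<psi>(1)] MC[OF \<psi>(2)] restrict_apply'[OF that] by simp
    show "pairing l p (\<psi> x) = pairing l p (\<psi>' x)"
      by (rule KZ_family_unique[OF U fam _ p x]) (rule eq1)
  qed
  have surj: "\<exists>\<psi>\<in>?K. ?F \<psi> = \<phi>" if \<phi>: "\<phi> \<in> ?M" for \<phi>
  proof -
    obtain F where F: "KZ_family l U F" "\<And>x. x \<in> U \<Longrightarrow> F (\<lambda>z. 1) x = \<phi> x"
      using KZ_family_of_CM_solution[OF \<sigma> L U \<phi>] by blast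
    obtain \<psi> where \<psi>: "\<psi> \<in> ?K" "\<And>p x. p \<in> polys \<Longrightarrow> x \<in> U \<Longrightarrow> pairing l p (\<psi> x) = F p x"
      using KZ_solution_of_family[OF U(1) F(1)] by blast
    have "?F \<psi> = \<phi>"
    proof (rule extensionalityI[of _ U])
      show "?F \<psi> \<in> extensional U" by (simp add: matsuo_cherednik_def)
      show "\<phi> \<in> extensional U" using \<phi> by (simp add: CM_solutions_def)
      show "?F \<psi> x = \<phi> x" if "x \<in> U" for x using that \<psi>(2)[OF one that] F(2)[OF that] by (simp add: MC[OF \<psi>(1)])
    qed
    then show ?thesis using \<psi>(1) by blast
  qed
  have bij: "bij_betw ?F ?K ?M"
    unfolding bij_betw_def inj_on_def using into inj surj by blast
  have add: "?F (\<lambda>x\<in>U. \<psi> x \<oplus>\<^bsub>quot G l\<^esub> \<psi>' x) = (\<lambda>x\<in>U. ?F \<psi> x + ?F \<psi>' x)" if "\<psi> \<in> ?K" "\<psi>' \<in> ?K" for \<psi> \<psi>'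
    using that c by (auto simp: MC KZ_add[OF U(1)] pairing_add one fun_eq_iff)
  have smult: "?F (\<lambda>x\<in>U. quot_smult G l k (\<psi> x)) = (\<lambda>x\<in>U. k * ?F \<psi> x)" if "\<psi> \<in> ?K" for k \<psi>
    using that c by (auto simp: MC KZ_smult[OF U(1)] pairing_smult one fun_eq_iff)
  have "module complex_field (CM_space \<sigma> L l U)"
  proof (rule module_CM_space)
    have "?F (\<lambda>x\<in>U. \<zero>\<^bsub>quot G l\<^esub>) = (\<lambda>x\<in>U. 0)"
      by (auto simp: MC[OF KZ_zero[OF U]] pairing_zero one fun_eq_iff)
    then show "(\<lambda>x\<in>U. 0) \<in> ?M" using into[OF KZ_zero[OF U]] by simp
  next
    fix \<phi> \<phi>' assume "\<phi> \<in> ?M" "\<phi>' \<in> ?M"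
    then obtain \<psi> \<psi>' where *: "\<psi> \<in> ?K" "\<psi>' \<in> ?K" "?F \<psi> = \<phi>" "?F \<psi>' = \<phi>'" using surj by metis
    show "(\<lambda>x\<in>U. \<phi> x + \<phi>' x) \<in> ?M" using into[OF KZ_add[OF U(1) *(1,2)]] add[OF *(1,2)] *(3,4) by simp
  next
    fix k \<phi> assume "\<phi> \<in> ?M"
    then obtain \<psi> where *: "\<psi> \<in> ?K" "?F \<psi> = \<phi>" using surj by metis
    show "(\<lambda>x\<in>U. k * \<phi> x) \<in> ?M" using into[OF KZ_smult[OF U(1) *(1), of k]] smult[OF *(1)] *(2) by simp
  qed
  then show ?thesis
    unfolding module_isomorphism_def using module_KZ_space[OF U] bij add smult
    by (simp add: KZ_space_def CM_space_def)
qed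

end

theorem theorem3p4:
  fixes G :: "(real ^ 'n::finite ^ 'n) set"
    and A :: "(real ^ 'n) set"
    and m :: "real ^ 'n \<Rightarrow> nat"
    and \<epsilon> :: "real ^ 'n ^ 'n \<Rightarrow> int"
    and \<sigma> :: "'n \<Rightarrow> complex ^ 'n \<Rightarrow> complex"
    and L :: "'n \<Rightarrow> 'n diffop"
    and l :: "complex ^ 'n"
    and U :: "(complex ^ 'n) set"
  assumes "finite_reflection_group G"
    and "normal_vectors G A"
    and "invariant_multiplicity G A m"
    and "sign_character G \<epsilon>"
    and "free_homogeneous_generators G \<sigma>"
    and "\<And>i. calogero_moser_operator G A m (\<sigma> i) (L i)"
    and "open U" and "connected U" and "simply_connected U"
    and "U \<subseteq> regular_set A"
  shows "module_isomorphism complex_field (KZ_space G A m l U) (CM_space \<sigma> L l U)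
           (matsuo_cherednik G A \<epsilon> l U)"
proof -
  interpret refl_group G A m \<epsilon> by unfold_locales (fact assms(1-4))+
  show ?thesis by (rule matsuo_cherednik_isomorphism[OF assms(5,6,7,10)])
qed

end
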